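(* Let $\boldsymbol k$ be a field of characteristic $0$, let $S=\boldsymbol k[x_1,\dots,x_n]$ be standard graded ($\deg x_i=1$) with a homogeneous Poisson bracket of degree $p:=\deg\{\,,\}\le0$, and let $I\subset S$ be a Poisson ideal generated by quadrics such that $A=S/I$ is a Koszul algebra. Let $(R,\partial)$ be the minimal model of $A$. Then all the elements $\pi_m$, $m\ge1$, of the recursive construction described in the context can be chosen homogeneous of the same $x$-degree $p+2$.
   Context: A Poisson ideal is an ideal $I$ with $\{I,S\}\subseteq I$. $\Lambda_{ij}:=\{x_i,x_j\}$; the bracket has degree $p$ if $\deg\{a,b\}=\deg a+\deg b+p$. Resolvent and minimal model. Let $\mathcal I=\bigsqcup_{m\ge1}\mathcal I_m$ with all $\mathcal I_m$ finite; to $i\in\mathcal I_m$ attach a variable $x_i^{(m)}$ of cohomological degree $-m$ and parity that of $m$. A semifree dg $S$-algebra is the graded-commutative polynomial algebra $R=S[x_i^{(m)}]$ with an $S$-linear degree $+1$ derivation $\partial$, $\partial^2=0$, such that $F_i:=\partial x_i^{(m)}\in R_{\le m-1}$ for $i\in\mathcal I_m$, where $R_{\le r}$ is the dg subalgebra on variables with $m\le r$ (its differential is $\partial_{\le r}$; $R_{\le0}=S$). It is a resolvent of $A=S/I$ if the composite $R\to S\to S/I$ (all $x_i^{(m)}\mapsto0$) is a quasi-isomorphism. The $x_i^{(m)}$ carry internal degrees with $\deg\partial=0$. It is a minimal model if $\partial x_j^{(1)}\in\mathfrak m=(x_1,\dots,x_n)$ for all $j\in \mathcal I_1$ and $\partial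 x_j^{(r)}\in\mathfrak n^2$ for $r\ge2$, where $\mathfrak n$ is the kernel of $R\to S\to\boldsymbol k$; it exists and is unique up to isomorphism. Write $x_i^{(0)}=x_i$, $\mathcal I_0=\{1,\dots,n\}$, and $f_\mu=\partial x_\mu^{(1)}$, $\mu\in\mathcal I_1$. Multiderivations. $\mathfrak h_{\le r}=\boldsymbol k[x_i^{(m)},\xi^i_{(m)}\mid 0\le m\le r,\ i\in\mathcal I_m]$ is the graded-commutative polynomial algebra with $|x_i^{(m)}|=-m$, $|\xi^i_{(m)}|=m+1$. The Schouten bracket (degree $-1$) is $$[\![X,Y]\!]=\sum_{m,i}X\frac{\overleftarrow\partial}{\partial\xi^i_{(m)}}\frac{\overrightarrow\partial}{\partial x_i^{(m)}}Y-X\frac{\overleftarrow\partial}{\partial x_i^{(m)}}\frac{\overrightarrow\partial}{\partial\xi^i_{(m)}}Y$$ (right derivatives of $X$, left derivatives of $Y$). The filtration degree is multiplicative with $\mathrm{fd}(\xi^i_{(m)})=m+1$, $\mathrm{fd}(x_i^{(m)})=0$, and $\mathcal F^q\mathfrak h_{\le r}$ is the $R_{\le r}$-span of monomials of filtration degree $\ge q$. $\partial_{\le r}$ is extended to $\mathfrak h_{\le r}$ by $\partial_{\le r}\xi^i_{(m)}=0$. Recursive construction. Put $\pi_0^{\le r}=\sum_{m=1}^r\sum_{j\in\mathcal I_m}F_j\,\xi^j_{(m)}$ and $\pi_1=\frac12\sum_{i,j=1}^n\Lambda_{ij}\xi^i_{(0)}\xi^j_{(0)}$. For $m\ge2$ one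 recursively chooses $\pi_m\in\mathcal F^{m+1}\mathfrak h_{\le m-1}$ of cohomological degree $2$ with $$\Big[\!\!\Big[\pi_0^{\le m-1}+\sum_{i=1}^{m-1}\pi_i,\ \pi_0^{\le m-1}+\sum_{i=1}^{m-1}\pi_i\Big]\!\!\Big]\equiv-2\,\partial_{\le m-1}\pi_m\pmod{\mathcal F^{m+2}\mathfrak h_{\le m-1}}.$$ $x$-degree: $X$ is homogeneous of $x$-degree $k$ if $\mathcal EX=kX$, where $\mathcal E=\sum_{m\ge0}\sum_{i\in\mathcal I_m}x_i^{(m)}\frac{\partial}{\partial x_i^{(m)}}$ (acting with the $\xi$'s as constants), i.e. every monomial contains exactly $k$ factors from the variables $x_i^{(m)}$, $m\ge0$. The zero element is homogeneous of every $x$-degree. *)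

theory Defs
  imports "HOL-Library.Poly_Mapping" "HOL-Library.Nat_Bijection"
begin

section \<open>Graded-commutative polynomial algebras\<close>

text \<open>
  All algebras in play are subalgebras of one graded-commutative polynomial algebra over the field
  \<open>'k\<close>, on the variables \<open>Xvar m i\<close> (for $x_i^{(m)}$, of degree $-m$) and
  \<open>Xivar m i\<close> (for $\xi^i_{(m)}$, of degree $m+1$), where \<open>m\<close> and \<open>i\<close> are arbitrary natural numbers.
  The finite index sets $\mathcal I_m$ are finite sets \<open>J m\<close> of natural numbers.
\<close>

datatype gvariable = Xvar nat nat | Xivar nat nat

fun cdeg_var :: "gvariable \<Rightarrow> int" where
  "cdeg_var (Xvar m i) = - int m"
| "cdeg_var (Xivar m i) = int m + 1"

definition odd_var :: "gvariable \<Rightarrow> bool" where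
  "odd_var v \<longleftrightarrow> odd (cdeg_var v)"

text \<open>
  An injective numbering of the variables.  A monomial with exponent vector \<open>u\<close> stands for the
  product of its variables in increasing order of \<open>var_rank\<close>; another order would only change the
  signs of the basis monomials.
\<close>

fun var_rank :: "gvariable \<Rightarrow> nat" where
  "var_rank (Xvar m i) = 2 * prod_encode (m, i)"
| "var_rank (Xivar m i) = 2 * prod_encode (m, i) + 1"

lemma var_rank_eq_iff [simp]: "var_rank v = var_rank w \<longleftrightarrow> v = w"
  by (cases v; cases w) (auto, presburger+)

type_synonym gmon = "gvariable \<Rightarrow>\<^sub>0 nat"

text \<open>Odd variables square to zero, so they occur in a monomial at most once.\<close>

definition admissible :: "gmon \<Rightarrow> bool" where
  "admissible u \<longleftrightarrow> (\<forall>v. odd_var v \<longrightarrow> Poly_Mapping.lookup u v \<le> 1)"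

definition odd_part :: "gmon \<Rightarrow> gvariable set" where
  "odd_part u = {v \<in> Poly_Mapping.keys u. odd_var v}"

text \<open>
  The sign with which the concatenation of the monomials \<open>u\<close> and \<open>v\<close> is sorted, and 0 if they share
  an odd variable.
\<close>

definition koszul_sign :: "gmon \<Rightarrow> gmon \<Rightarrow> int" where
  "koszul_sign u v =
     (if odd_part u \<inter> odd_part v = {}
      then (- 1) ^ card {(a, b). a \<in> odd_part u \<and> b \<in> odd_part v \<and> var_rank b < var_rank a}
      else 0)"

typedef (overloaded) ('k::zero) galg =
  "{f :: gmon \<Rightarrow>\<^sub>0 'k. \<forall>u \<in> Poly_Mapping.keys f. admissible u}"
  by (rule exI[of _ 0]) simp

definition gcoeff :: "'k::zero galg \<Rightarrow> gmon \<Rightarrow> 'k" where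
  "gcoeff X u = Poly_Mapping.lookup (Rep_galg X) u"

definition gkeys :: "'k::zero galg \<Rightarrow> gmon set" where
  "gkeys X = Poly_Mapping.keys (Rep_galg X)"

text \<open>The monomial \<open>u\<close> with coefficient \<open>c\<close>; zero if \<open>u\<close> is not admissible.\<close>

definition gmonom :: "gmon \<Rightarrow> 'k::zero \<Rightarrow> 'k galg" where
  "gmonom u c = Abs_galg (if admissible u then Poly_Mapping.single u c else 0)"

lemma finite_gkeys [simp]: "finite (gkeys X)"
  by (simp add: gkeys_def)

lemma in_gkeys_iff: "u \<in> gkeys X \<longleftrightarrow> gcoeff X u \<noteq> 0"
  by (simp add: gkeys_def gcoeff_def in_keys_iff)

lemma gkeys_admissible: "u \<in> gkeys X \<Longrightarrow> admissible u"
  using Rep_galg[of X] by (auto simp: gkeys_def)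

lemma galg_eqI: "(\<And>u. gcoeff X u = gcoeff Y u) \<Longrightarrow> X = Y"
  unfolding gcoeff_def by (metis Rep_galg_inject poly_mapping_eqI)

lemma gcoeff_gmonom:
  "gcoeff (gmonom u c) w = (if admissible u \<and> w = u then c else 0)"
proof -
  have "Rep_galg (gmonom u c) = (if admissible u then Poly_Mapping.single u c else 0)"
    unfolding gmonom_def by (rule Abs_galg_inverse) auto
  then show ?thesis
    by (auto simp: gcoeff_def lookup_single when_def)
qed

instantiation galg :: (comm_ring_1) ab_group_add
begin

definition zero_galg :: "'a galg" where
  "0 = Abs_galg 0"

definition plus_galg :: "'a galg \<Rightarrow> 'a galg \<Rightarrow> 'a galg" where
  "X + Y = Abs_galg (Rep_galg X + Rep_galg Y)"

definition uminus_galg :: "'a galg \<Rightarrow> 'a galg" where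
  "- X = Abs_galg (- Rep_galg X)"

definition minus_galg :: "'a galg \<Rightarrow> 'a galg \<Rightarrow> 'a galg" where
  "X - Y = Abs_galg (Rep_galg X - Rep_galg Y)"

lemma Rep_zero: "Rep_galg (0 :: 'a galg) = 0"
  unfolding zero_galg_def by (rule Abs_galg_inverse) auto

lemma Rep_plus: "Rep_galg (X + Y) = Rep_galg X + Rep_galg (Y :: 'a galg)"
  unfolding plus_galg_def
  by (rule Abs_galg_inverse) (use Rep_galg[of X] Rep_galg[of Y] Poly_Mapping.keys_add in fastforce)

lemma Rep_uminus: "Rep_galg (- X) = - Rep_galg (X :: 'a galg)"
  unfolding uminus_galg_def
  by (rule Abs_galg_inverse) (use Rep_galg[of X] in \<open>auto simp: in_keys_iff\<close>)

lemma Rep_minus: "Rep_galg (X - Y) = Rep_galg X - Rep_galg (Y :: 'a galg)"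
  unfolding minus_galg_def
proof (rule Abs_galg_inverse, safe)
  fix u assume "u \<in> Poly_Mapping.keys (Rep_galg X - Rep_galg Y)"
  then have "u \<in> Poly_Mapping.keys (Rep_galg X) \<or> u \<in> Poly_Mapping.keys (Rep_galg Y)"
    by (auto simp: in_keys_iff lookup_minus)
  then show "admissible u" using Rep_galg[of X] Rep_galg[of Y] by auto
qed

instance
  by intro_classes
    (simp_all add: Rep_galg_inject[symmetric] Rep_zero Rep_plus Rep_uminus Rep_minus algebra_simps)

end

lemma gcoeff_0 [simp]: "gcoeff 0 u = (0 :: 'k::comm_ring_1)"
  by (simp add: gcoeff_def Rep_zero)

lemma gcoeff_add [simp]: "gcoeff (X + Y) u = gcoeff X u + (gcoeff Y u :: 'k::comm_ring_1)"
  by (simp add: gcoeff_def Rep_plus lookup_add)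

lemma gcoeff_uminus [simp]: "gcoeff (- X) u = - (gcoeff X u :: 'k::comm_ring_1)"
  by (simp add: gcoeff_def Rep_uminus)

lemma gcoeff_diff [simp]: "gcoeff (X - Y) u = gcoeff X u - (gcoeff Y u :: 'k::comm_ring_1)"
  by (simp add: gcoeff_def Rep_minus lookup_minus)

lemma gcoeff_sum: "gcoeff (sum f A) u = (\<Sum>a\<in>A. gcoeff (f a) u :: 'k::comm_ring_1)"
  by (induction A rule: infinite_finite_induct) auto

lemma gmonom_0 [simp]: "gmonom u (0 :: 'k::comm_ring_1) = 0"
  by (rule galg_eqI) (simp add: gcoeff_gmonom)

lemma gmonom_add: "gmonom u (a + b) = gmonom u a + gmonom u (b :: 'k::comm_ring_1)"
  by (rule galg_eqI) (simp add: gcoeff_gmonom)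

lemma galg_expand_superset:
  assumes "finite U" "gkeys X \<subseteq> U"
  shows "X = (\<Sum>u\<in>U. gmonom u (gcoeff X u :: 'k::comm_ring_1))"
proof (rule galg_eqI)
  fix w
  have "gcoeff (\<Sum>u\<in>U. gmonom u (gcoeff X u)) w
      = (\<Sum>u\<in>U. if u = w then (if admissible w then gcoeff X w else 0) else 0)"
    unfolding gcoeff_sum by (intro sum.cong) (auto simp: gcoeff_gmonom)
  also have "\<dots> = gcoeff X w"
    using assms gkeys_admissible[of w X] by (auto simp: in_gkeys_iff)
  finally show "gcoeff X w = gcoeff (\<Sum>u\<in>U. gmonom u (gcoeff X u)) w" by simp
qed

lemma galg_expand: "X = (\<Sum>u\<in>gkeys X. gmonom u (gcoeff X u :: 'k::comm_ring_1))"
  by (rule galg_expand_superset) auto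

lemma odd_part_add: "odd_part (u + v) = odd_part u \<union> odd_part v"
  by (auto simp: odd_part_def in_keys_iff lookup_add)

lemma finite_odd_part [simp]: "finite (odd_part u)"
  by (simp add: odd_part_def)

lemma admissible_add_iff:
  assumes "admissible u" "admissible v"
  shows "admissible (u + v) \<longleftrightarrow> odd_part u \<inter> odd_part v = {}"
proof
  assume a: "admissible (u + v)"
  show "odd_part u \<inter> odd_part v = {}"
  proof (rule ccontr)
    assume "odd_part u \<inter> odd_part v \<noteq> {}"
    then obtain w where "odd_var w" "Poly_Mapping.lookup u w \<noteq> 0" "Poly_Mapping.lookup v w \<noteq> 0"
      by (auto simp: odd_part_def in_keys_iff)
    with a show False by (force simp: admissible_def lookup_add)
  qed
next
  assume d: "odd_part u \<inter> odd_part v = {}"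
  show "admissible (u + v)"
    unfolding admissible_def
  proof (intro allI impI)
    fix w assume w: "odd_var w"
    with d have "Poly_Mapping.lookup u w = 0 \<or> Poly_Mapping.lookup v w = 0"
      by (auto simp: odd_part_def in_keys_iff)
    with w assms show "Poly_Mapping.lookup (u + v) w \<le> 1"
      by (auto simp: admissible_def lookup_add)
  qed
qed

lemma finite_inversions: "finite {(a, b). a \<in> odd_part u \<and> b \<in> odd_part v \<and> P a b}"
  by (rule finite_subset[of _ "odd_part u \<times> odd_part v"]) auto

lemma koszul_sign_add_left:
  assumes "odd_part u \<inter> odd_part v = {}"
  shows "koszul_sign (u + v) w = koszul_sign u w * koszul_sign v w"
proof -
  have "{(a, b). a \<in> odd_part (u + v) \<and> b \<in> odd_part w \<and> var_rank b < var_rank a}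
     = {(a, b). a \<in> odd_part u \<and> b \<in> odd_part w \<and> var_rank b < var_rank a}
     \<union> {(a, b). a \<in> odd_part v \<and> b \<in> odd_part w \<and> var_rank b < var_rank a}"
    by (auto simp: odd_part_add)
  moreover have "{(a, b). a \<in> odd_part u \<and> b \<in> odd_part w \<and> var_rank b < var_rank a}
     \<inter> {(a, b). a \<in> odd_part v \<and> b \<in> odd_part w \<and> var_rank b < var_rank a} = {}"
    using assms by auto
  ultimately have "card {(a, b). a \<in> odd_part (u + v) \<and> b \<in> odd_part w \<and> var_rank b < var_rank a}
     = card {(a, b). a \<in> odd_part u \<and> b \<in> odd_part w \<and> var_rank b < var_rank a}
     + card {(a, b). a \<in> odd_part v \<and> b \<in> odd_part w \<and> var_rank b < var_rank a}"
    by (simp add: card_Un_disjoint finite_inversions)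
  then show ?thesis
    by (auto simp: koszul_sign_def odd_part_add Int_Un_distrib2 power_add)
qed

lemma koszul_sign_add_right:
  assumes "odd_part v \<inter> odd_part w = {}"
  shows "koszul_sign u (v + w) = koszul_sign u v * koszul_sign u w"
proof -
  have "{(a, b). a \<in> odd_part u \<and> b \<in> odd_part (v + w) \<and> var_rank b < var_rank a}
     = {(a, b). a \<in> odd_part u \<and> b \<in> odd_part v \<and> var_rank b < var_rank a}
     \<union> {(a, b). a \<in> odd_part u \<and> b \<in> odd_part w \<and> var_rank b < var_rank a}"
    by (auto simp: odd_part_add)
  moreover have "{(a, b). a \<in> odd_part u \<and> b \<in> odd_part v \<and> var_rank b < var_rank a}
     \<inter> {(a, b). a \<in> odd_part u \<and> b \<in> odd_part w \<and> var_rank b < var_rank a} = {}"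
    using assms by auto
  ultimately have "card {(a, b). a \<in> odd_part u \<and> b \<in> odd_part (v + w) \<and> var_rank b < var_rank a}
     = card {(a, b). a \<in> odd_part u \<and> b \<in> odd_part v \<and> var_rank b < var_rank a}
     + card {(a, b). a \<in> odd_part u \<and> b \<in> odd_part w \<and> var_rank b < var_rank a}"
    by (simp add: card_Un_disjoint finite_inversions)
  then show ?thesis
    by (auto simp: koszul_sign_def odd_part_add Int_Un_distrib power_add)
qed

lemma koszul_sign_cocycle:
  "koszul_sign u v * koszul_sign (u + v) w = koszul_sign v w * koszul_sign u (v + w)"
proof (cases "odd_part u \<inter> odd_part v = {}"; cases "odd_part v \<inter> odd_part w = {}")
  assume "odd_part u \<inter> odd_part v = {}" "odd_part v \<inter> odd_part w = {}"
  then show ?thesis by (simp add: koszul_sign_add_left koszul_sign_add_right mult_ac)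
next
  assume "odd_part u \<inter> odd_part v = {}" "odd_part v \<inter> odd_part w \<noteq> {}"
  then show ?thesis by (auto simp: koszul_sign_def odd_part_add)
next
  assume "odd_part u \<inter> odd_part v \<noteq> {}" "odd_part v \<inter> odd_part w = {}"
  then show ?thesis by (auto simp: koszul_sign_def odd_part_add)
next
  assume "odd_part u \<inter> odd_part v \<noteq> {}" "odd_part v \<inter> odd_part w \<noteq> {}"
  then show ?thesis by (auto simp: koszul_sign_def)
qed

lemma odd_part_0 [simp]: "odd_part 0 = {}"
  by (simp add: odd_part_def)

lemma koszul_sign_0 [simp]: "koszul_sign 0 u = 1" "koszul_sign u 0 = 1"
  by (simp_all add: koszul_sign_def)

instantiation galg :: (comm_ring_1) ring_1
begin

definition one_galg :: "'a galg" where
  "1 = gmonom 0 1"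

definition times_galg :: "'a galg \<Rightarrow> 'a galg \<Rightarrow> 'a galg" where
  "X * Y = (\<Sum>u\<in>gkeys X. \<Sum>v\<in>gkeys Y.
      gmonom (u + v) (of_int (koszul_sign u v) * gcoeff X u * gcoeff Y v))"

lemma times_galg_superset:
  fixes X Y :: "'a galg"
  assumes "finite U" "gkeys X \<subseteq> U" "finite V" "gkeys Y \<subseteq> V"
  shows "X * Y = (\<Sum>u\<in>U. \<Sum>v\<in>V.
      gmonom (u + v) (of_int (koszul_sign u v) * gcoeff X u * gcoeff Y v))"
proof -
  have "X * Y = (\<Sum>u\<in>gkeys X. \<Sum>v\<in>V.
      gmonom (u + v) (of_int (koszul_sign u v) * gcoeff X u * gcoeff Y v))"
    unfolding times_galg_def
    by (intro sum.cong sum.mono_neutral_left) (use assms in \<open>auto simp: in_gkeys_iff\<close>)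
  also have "\<dots> = (\<Sum>u\<in>U. \<Sum>v\<in>V.
      gmonom (u + v) (of_int (koszul_sign u v) * gcoeff X u * gcoeff Y v))"
    by (intro sum.mono_neutral_left) (use assms in \<open>auto simp: in_gkeys_iff\<close>)
  finally show ?thesis .
qed

lemma gkeys_add_subset: "gkeys (X + Y) \<subseteq> gkeys X \<union> gkeys (Y :: 'a galg)"
  by (auto simp: in_gkeys_iff)

lemma times_galg_add_left: "(X + Y) * Z = X * Z + Y * (Z :: 'a galg)"
proof -
  have 1: "(X + Y) * Z = (\<Sum>u\<in>gkeys X \<union> gkeys Y. \<Sum>v\<in>gkeys Z.
      gmonom (u + v) (of_int (koszul_sign u v) * gcoeff (X + Y) u * gcoeff Z v))"
    by (rule times_galg_superset) (use gkeys_add_subset in auto)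
  have 2: "X * Z = (\<Sum>u\<in>gkeys X \<union> gkeys Y. \<Sum>v\<in>gkeys Z.
      gmonom (u + v) (of_int (koszul_sign u v) * gcoeff X u * gcoeff Z v))"
    by (rule times_galg_superset) auto
  have 3: "Y * Z = (\<Sum>u\<in>gkeys X \<union> gkeys Y. \<Sum>v\<in>gkeys Z.
      gmonom (u + v) (of_int (koszul_sign u v) * gcoeff Y u * gcoeff Z v))"
    by (rule times_galg_superset) auto
  show ?thesis unfolding 1 2 3
    by (simp add: sum.distrib[symmetric] gmonom_add[symmetric] algebra_simps)
qed

lemma times_galg_add_right: "Z * (X + Y) = Z * X + Z * (Y :: 'a galg)"
proof -
  have 1: "Z * (X + Y) = (\<Sum>u\<in>gkeys Z. \<Sum>v\<in>gkeys X \<union> gkeys Y.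
      gmonom (u + v) (of_int (koszul_sign u v) * gcoeff Z u * gcoeff (X + Y) v))"
    by (rule times_galg_superset) (use gkeys_add_subset in auto)
  have 2: "Z * X = (\<Sum>u\<in>gkeys Z. \<Sum>v\<in>gkeys X \<union> gkeys Y.
      gmonom (u + v) (of_int (koszul_sign u v) * gcoeff Z u * gcoeff X v))"
    by (rule times_galg_superset) auto
  have 3: "Z * Y = (\<Sum>u\<in>gkeys Z. \<Sum>v\<in>gkeys X \<union> gkeys Y.
      gmonom (u + v) (of_int (koszul_sign u v) * gcoeff Z u * gcoeff Y v))"
    by (rule times_galg_superset) auto
  show ?thesis unfolding 1 2 3
    by (simp add: sum.distrib[symmetric] gmonom_add[symmetric] algebra_simps)
qed

lemma times_galg_0: "0 * X = (0 :: 'a galg)" "X * 0 = (0 :: 'a galg)"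
  using times_galg_add_left[of 0 0 X] times_galg_add_right[of X 0 0] by simp_all

lemma times_galg_sum_left: "sum f A * X = (\<Sum>a\<in>A. f a * (X :: 'a galg))"
  by (induction A rule: infinite_finite_induct) (auto simp: times_galg_0 times_galg_add_left)

lemma times_galg_sum_right: "X * sum f A = (\<Sum>a\<in>A. X * (f a :: 'a galg))"
  by (induction A rule: infinite_finite_induct) (auto simp: times_galg_0 times_galg_add_right)

lemma gmonom_mult:
  assumes "admissible u" "admissible v"
  shows "gmonom u a * gmonom v b
    = gmonom (u + v) (of_int (koszul_sign u v) * a * (b :: 'a))"
  by (subst times_galg_superset[of "{u}" _ "{v}"])
     (use assms in \<open>auto simp: in_gkeys_iff gcoeff_gmonom split: if_splits\<close>)

lemma gmonom_not_admissible: "\<not> admissible u \<Longrightarrow> gmonom u (a :: 'a) = 0"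
  by (rule galg_eqI) (simp add: gcoeff_gmonom)

lemma gmonom_mult_assoc:
  "gmonom u a * gmonom v b * gmonom w c = gmonom u a * (gmonom v b * gmonom w (c :: 'a))"
proof (cases "admissible u \<and> admissible v \<and> admissible w")
  case True
  then have adm: "admissible u" "admissible v" "admissible w" by auto
  have L: "gmonom u a * gmonom v b * gmonom w c
      = gmonom (u + v + w) (of_int (koszul_sign u v * koszul_sign (u + v) w) * (a * b * c))"
  proof (cases "admissible (u + v)")
    case True
    then show ?thesis by (simp add: gmonom_mult adm mult_ac)
  next
    case False
    then have "koszul_sign u v = 0" by (simp add: admissible_add_iff adm koszul_sign_def)
    then show ?thesis by (simp add: gmonom_mult adm times_galg_0)
  qed
  have R: "gmonom u a * (gmonom v b * gmonom w c)
      = gmonom (u + (v + w)) (of_int (koszul_sign v w * koszul_sign u (v + w)) * (a * b * c))"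
  proof (cases "admissible (v + w)")
    case True
    then show ?thesis by (simp add: gmonom_mult adm mult_ac)
  next
    case False
    then have "koszul_sign v w = 0" by (simp add: admissible_add_iff adm koszul_sign_def)
    then show ?thesis by (simp add: gmonom_mult adm times_galg_0)
  qed
  show ?thesis unfolding L R koszul_sign_cocycle by (simp add: add.assoc)
next
  case False
  then show ?thesis by (auto simp: gmonom_not_admissible times_galg_0)
qed

lemma admissible_0: "admissible 0"
  by (simp add: admissible_def)

instance
proof
  fix X Y Z :: "'a galg"
  have "(\<Sum>u\<in>gkeys X. gmonom u (gcoeff X u)) * (\<Sum>u\<in>gkeys Y. gmonom u (gcoeff Y u))
          * (\<Sum>u\<in>gkeys Z. gmonom u (gcoeff Z u))
      = (\<Sum>u\<in>gkeys X. gmonom u (gcoeff X u)) * ((\<Sum>u\<in>gkeys Y. gmonom u (gcoeff Y u))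
          * (\<Sum>u\<in>gkeys Z. gmonom u (gcoeff Z u)))"
    by (simp only: times_galg_sum_left times_galg_sum_right gmonom_mult_assoc)
  then show "X * Y * Z = X * (Y * Z)"
    by (simp only: galg_expand[symmetric])
  have "1 * (\<Sum>u\<in>gkeys X. gmonom u (gcoeff X u)) = (\<Sum>u\<in>gkeys X. gmonom u (gcoeff X u))"
    unfolding times_galg_sum_right one_galg_def
    by (intro sum.cong) (auto simp: gmonom_mult admissible_0 gkeys_admissible)
  then show "1 * X = X" by (simp only: galg_expand[symmetric])
  have "(\<Sum>u\<in>gkeys X. gmonom u (gcoeff X u)) * 1 = (\<Sum>u\<in>gkeys X. gmonom u (gcoeff X u))"
    unfolding times_galg_sum_left one_galg_def
    by (intro sum.cong) (auto simp: gmonom_mult admissible_0 gkeys_admissible)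
  then show "X * 1 = X" by (simp only: galg_expand[symmetric])
  show "(X + Y) * Z = X * Z + Y * Z" by (rule times_galg_add_left)
  show "X * (Y + Z) = X * Y + X * Z" by (rule times_galg_add_right)
  have "gcoeff (0 :: 'a galg) 0 \<noteq> gcoeff 1 0"
    by (simp add: one_galg_def gcoeff_gmonom admissible_0)
  then show "(0 :: 'a galg) \<noteq> 1" by metis
qed

end

definition gvar :: "gvariable \<Rightarrow> 'k::comm_ring_1 galg" where
  "gvar v = gmonom (Poly_Mapping.single v 1) 1"

definition gconst :: "'k::comm_ring_1 \<Rightarrow> 'k galg" where
  "gconst c = gmonom 0 c"

text \<open>The left and right partial derivatives: an odd variable is first moved to the left end,
  respectively to the right end, of the monomial.\<close>

definition lderiv :: "gvariable \<Rightarrow> 'k::comm_ring_1 galg \<Rightarrow> 'k galg" where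
  "lderiv v X = (\<Sum>u\<in>gkeys X.
     gmonom (u - Poly_Mapping.single v 1)
       ((if odd_var v then (- 1) ^ card {w \<in> odd_part u. var_rank w < var_rank v} else 1)
         * of_nat (Poly_Mapping.lookup u v) * gcoeff X u))"

definition rderiv :: "gvariable \<Rightarrow> 'k::comm_ring_1 galg \<Rightarrow> 'k galg" where
  "rderiv v X = (\<Sum>u\<in>gkeys X.
     gmonom (u - Poly_Mapping.single v 1)
       ((if odd_var v then (- 1) ^ card {w \<in> odd_part u. var_rank v < var_rank w} else 1)
         * of_nat (Poly_Mapping.lookup u v) * gcoeff X u))"

text \<open>The subalgebra generated by a set of variables.\<close>

definition subalg :: "gvariable set \<Rightarrow> 'k::comm_ring_1 galg set" where
  "subalg V = {X. \<forall>u\<in>gkeys X. Poly_Mapping.keys u \<subseteq> V}"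

text \<open>Homogeneity for the grading in which the variable \<open>v\<close> has degree \<open>w v\<close>.\<close>

definition mon_weight :: "(gvariable \<Rightarrow> int) \<Rightarrow> gmon \<Rightarrow> int" where
  "mon_weight w u = (\<Sum>v\<in>Poly_Mapping.keys u. int (Poly_Mapping.lookup u v) * w v)"

definition homogeneous :: "(gvariable \<Rightarrow> int) \<Rightarrow> int \<Rightarrow> 'k::comm_ring_1 galg \<Rightarrow> bool" where
  "homogeneous w e X \<longleftrightarrow> (\<forall>u\<in>gkeys X. mon_weight w u = e)"


section \<open>The polynomial ring, Poisson structures and Koszul algebras\<close>

definition S_alg :: "nat \<Rightarrow> 'k::comm_ring_1 galg set" where
  "S_alg n = subalg {Xvar 0 i | i. i \<in> {1..n}}"

definition S_deg :: "nat \<Rightarrow> int \<Rightarrow> 'k::comm_ring_1 galg set" where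
  "S_deg n e = {s \<in> S_alg n. homogeneous (\<lambda>_. 1) e s}"

definition S_ideal_gen :: "nat \<Rightarrow> 'k::comm_ring_1 galg set \<Rightarrow> 'k galg set" where
  "S_ideal_gen n Q =
     {\<Sum>q\<in>Q'. c q * q | Q' c. finite Q' \<and> Q' \<subseteq> Q \<and> (\<forall>q\<in>Q'. c q \<in> S_alg n)}"

definition is_poisson_bracket ::
  "nat \<Rightarrow> ('k::comm_ring_1 galg \<Rightarrow> 'k galg \<Rightarrow> 'k galg) \<Rightarrow> bool" where
  "is_poisson_bracket n br \<longleftrightarrow>
     (\<forall>a\<in>S_alg n. \<forall>b\<in>S_alg n. br a b \<in> S_alg n) \<and>
     (\<forall>a\<in>S_alg n. \<forall>b\<in>S_alg n. \<forall>c\<in>S_alg n. br (a + b) c = br a c + br b c) \<and>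
     (\<forall>t. \<forall>a\<in>S_alg n. \<forall>b\<in>S_alg n. br (gconst t * a) b = gconst t * br a b) \<and>
     (\<forall>a\<in>S_alg n. \<forall>b\<in>S_alg n. br a b = - br b a) \<and>
     (\<forall>a\<in>S_alg n. \<forall>b\<in>S_alg n. \<forall>c\<in>S_alg n. br a (b * c) = br a b * c + b * br a c) \<and>
     (\<forall>a\<in>S_alg n. \<forall>b\<in>S_alg n. \<forall>c\<in>S_alg n.
        br a (br b c) + br b (br c a) + br c (br a b) = 0)"

definition bracket_has_degree ::
  "nat \<Rightarrow> ('k::comm_ring_1 galg \<Rightarrow> 'k galg \<Rightarrow> 'k galg) \<Rightarrow> int \<Rightarrow> bool" where
  "bracket_has_degree n br p \<longleftrightarrow>
     (\<forall>d e. \<forall>a\<in>S_deg n d. \<forall>b\<in>S_deg n e. br a b \<in> S_deg n (d + e + p))"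

definition is_S_ideal :: "nat \<Rightarrow> 'k::comm_ring_1 galg set \<Rightarrow> bool" where
  "is_S_ideal n I \<longleftrightarrow> I \<subseteq> S_alg n \<and> 0 \<in> I \<and> (\<forall>a\<in>I. \<forall>b\<in>I. a + b \<in> I)
     \<and> (\<forall>s\<in>S_alg n. \<forall>a\<in>I. s * a \<in> I)"

definition is_poisson_ideal ::
  "nat \<Rightarrow> ('k::comm_ring_1 galg \<Rightarrow> 'k galg \<Rightarrow> 'k galg) \<Rightarrow> 'k galg set \<Rightarrow> bool" where
  "is_poisson_ideal n br I \<longleftrightarrow> is_S_ideal n I \<and> (\<forall>a\<in>I. \<forall>s\<in>S_alg n. br a s \<in> I)"

definition generated_by_quadrics :: "nat \<Rightarrow> 'k::comm_ring_1 galg set \<Rightarrow> bool" where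
  "generated_by_quadrics n I \<longleftrightarrow> (\<exists>Q. Q \<subseteq> S_deg n 2 \<and> I = S_ideal_gen n Q)"

text \<open>
  $A = S/I$ is Koszul if $k = A/A_+$ has a linear graded free resolution
  $\cdots \to A(-2)^{b_2} \to A(-1)^{b_1} \to A^{b_0} = A \to k \to 0$.
  The graded map $A(-t-1)^{b_{t+1}} \to A(-t)^{b_t}$ is a matrix \<open>M t\<close> of elements of $A_1$, given
  here by linear forms in $S$; elements of $A$ are represented by elements of $S$, with equality
  modulo $I$.
\<close>

definition is_koszul_quotient :: "nat \<Rightarrow> 'k::comm_ring_1 galg set \<Rightarrow> bool" where
  "is_koszul_quotient n I \<longleftrightarrow>
     (\<exists>(b :: nat \<Rightarrow> nat) (M :: nat \<Rightarrow> nat \<Rightarrow> nat \<Rightarrow> 'k galg).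
        b 0 = 1 \<and>
        (\<forall>t. \<forall>i<b t. \<forall>j<b (Suc t). M t i j \<in> S_deg n 1) \<and>
        (\<forall>a\<in>S_alg n. gcoeff a 0 = 0 \<longleftrightarrow>
           (\<exists>c. (\<forall>j<b 1. c j \<in> S_alg n) \<and> a - (\<Sum>j<b 1. M 0 0 j * c j) \<in> I)) \<and>
        (\<forall>t c. (\<forall>j<b (Suc t). c j \<in> S_alg n) \<longrightarrow>
           ((\<forall>i<b t. (\<Sum>j<b (Suc t). M t i j * c j) \<in> I) \<longleftrightarrow>
            (\<exists>e. (\<forall>l<b (Suc (Suc t)). e l \<in> S_alg n) \<and>
                 (\<forall>j<b (Suc t). c j - (\<Sum>l<b (Suc (Suc t)). M (Suc t) j l * e l) \<in> I)))))"


section \<open>Resolvents and minimal models\<close>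

text \<open>
  \<open>J m\<close> is the index set $\mathcal I_m$, with \<open>J 0 = {1..n}\<close>, and \<open>wt m i\<close> the internal
  degree of $x_i^{(m)}$.
\<close>

definition R_le :: "(nat \<Rightarrow> nat set) \<Rightarrow> nat \<Rightarrow> 'k::comm_ring_1 galg set" where
  "R_le J r = subalg {Xvar m i | m i. m \<le> r \<and> i \<in> J m}"

definition R_alg :: "(nat \<Rightarrow> nat set) \<Rightarrow> 'k::comm_ring_1 galg set" where
  "R_alg J = subalg {Xvar m i | m i. i \<in> J m}"

fun int_weight :: "(nat \<Rightarrow> nat \<Rightarrow> int) \<Rightarrow> gvariable \<Rightarrow> int" where
  "int_weight wt (Xvar m i) = wt m i"
| "int_weight wt (Xivar m i) = 0"  \<comment> \<open>never used: internal degrees are only needed on R\<close>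

definition is_semifree_dga ::
  "nat \<Rightarrow> (nat \<Rightarrow> nat set) \<Rightarrow> (nat \<Rightarrow> nat \<Rightarrow> int) \<Rightarrow> ('k::comm_ring_1 galg \<Rightarrow> 'k galg) \<Rightarrow> bool" where
  "is_semifree_dga n J wt d \<longleftrightarrow>
     J 0 = {1..n} \<and> (\<forall>m. finite (J m)) \<and> (\<forall>i\<in>J 0. wt 0 i = 1) \<and>
     (\<forall>a\<in>R_alg J. d a \<in> R_alg J) \<and>
     (\<forall>a\<in>R_alg J. \<forall>b\<in>R_alg J. d (a + b) = d a + d b) \<and>
     (\<forall>s\<in>S_alg n. \<forall>a\<in>R_alg J. d (s * a) = s * d a) \<and>
     (\<forall>e. \<forall>a\<in>R_alg J. homogeneous cdeg_var e a \<longrightarrow> homogeneous cdeg_var (e + 1) (d a)) \<and>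
     (\<forall>e. \<forall>a\<in>R_alg J. \<forall>b\<in>R_alg J. homogeneous cdeg_var e a \<longrightarrow>
        d (a * b) = d a * b + (if even e then a * d b else - (a * d b))) \<and>
     (\<forall>a\<in>R_alg J. d (d a) = 0) \<and>
     (\<forall>m\<ge>1. \<forall>i\<in>J m. d (gvar (Xvar m i)) \<in> R_le J (m - 1)) \<and>
     (\<forall>e. \<forall>a\<in>R_alg J. homogeneous (int_weight wt) e a \<longrightarrow> homogeneous (int_weight wt) e (d a))"

text \<open>The projection $R \to S$, $x_i^{(m)} \mapsto 0$ for $m \ge 1$.\<close>

definition proj_S :: "nat \<Rightarrow> 'k::comm_ring_1 galg \<Rightarrow> 'k galg" where
  "proj_S n X = (\<Sum>u\<in>{u \<in> gkeys X. Poly_Mapping.keys u \<subseteq> {Xvar 0 i | i. i \<in> {1..n}}}.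
     gmonom u (gcoeff X u))"

text \<open>
  $R \to S/I$ is a quasi-isomorphism, $S/I$ carrying the zero differential: it is a chain map, and
  injective and surjective on cohomology.
\<close>

definition is_resolvent ::
  "nat \<Rightarrow> (nat \<Rightarrow> nat set) \<Rightarrow> (nat \<Rightarrow> nat \<Rightarrow> int) \<Rightarrow> ('k::comm_ring_1 galg \<Rightarrow> 'k galg)
     \<Rightarrow> 'k galg set \<Rightarrow> bool" where
  "is_resolvent n J wt d I \<longleftrightarrow> is_semifree_dga n J wt d \<and>
     (\<forall>X\<in>R_alg J. proj_S n (d X) \<in> I) \<and>
     (\<forall>X\<in>R_alg J. d X = 0 \<and> proj_S n X \<in> I \<longrightarrow> (\<exists>Y\<in>R_alg J. d Y = X)) \<and>
     (\<forall>s\<in>S_alg n. \<exists>X\<in>R_alg J. d X = 0 \<and> proj_S n X - s \<in> I)"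

definition aug_ideal :: "(nat \<Rightarrow> nat set) \<Rightarrow> 'k::comm_ring_1 galg set" where
  "aug_ideal J = {X \<in> R_alg J. gcoeff X 0 = 0}"

definition aug_ideal_sq :: "(nat \<Rightarrow> nat set) \<Rightarrow> 'k::comm_ring_1 galg set" where
  "aug_ideal_sq J = {\<Sum>l<N. a l * b l | (N :: nat) a b.
     \<forall>l<N. a l \<in> aug_ideal J \<and> b l \<in> aug_ideal J}"

definition is_minimal_model ::
  "nat \<Rightarrow> (nat \<Rightarrow> nat set) \<Rightarrow> (nat \<Rightarrow> nat \<Rightarrow> int) \<Rightarrow> ('k::comm_ring_1 galg \<Rightarrow> 'k galg)
     \<Rightarrow> 'k galg set \<Rightarrow> bool" where
  "is_minimal_model n J wt d I \<longleftrightarrow> is_resolvent n J wt d I \<and>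
     (\<forall>j\<in>J 1. d (gvar (Xvar 1 j)) \<in> S_ideal_gen n {gvar (Xvar 0 i) | i. i \<in> {1..n}}) \<and>
     (\<forall>r\<ge>2. \<forall>j\<in>J r. d (gvar (Xvar r j)) \<in> aug_ideal_sq J)"


section \<open>Multiderivations and the recursive construction\<close>

definition h_le :: "(nat \<Rightarrow> nat set) \<Rightarrow> nat \<Rightarrow> 'k::comm_ring_1 galg set" where
  "h_le J r = subalg ({Xvar m i | m i. m \<le> r \<and> i \<in> J m} \<union> {Xivar m i | m i. m \<le> r \<and> i \<in> J m})"

definition schouten ::
  "(nat \<Rightarrow> nat set) \<Rightarrow> nat \<Rightarrow> 'k::comm_ring_1 galg \<Rightarrow> 'k galg \<Rightarrow> 'k galg" where
  "schouten J r X Y = (\<Sum>m\<le>r. \<Sum>i\<in>J m.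
     rderiv (Xivar m i) X * lderiv (Xvar m i) Y - rderiv (Xvar m i) X * lderiv (Xivar m i) Y)"

fun fdeg_var :: "gvariable \<Rightarrow> int" where
  "fdeg_var (Xvar m i) = 0"
| "fdeg_var (Xivar m i) = int m + 1"

definition filt :: "(nat \<Rightarrow> nat set) \<Rightarrow> nat \<Rightarrow> nat \<Rightarrow> 'k::comm_ring_1 galg set" where
  "filt J q r = {X \<in> h_le J r. \<forall>u\<in>gkeys X. mon_weight fdeg_var u \<ge> int q}"

text \<open>
  The extension of $\partial_{\le r}$ to $\mathfrak h_{\le r}$ with $\partial_{\le r}\xi^i_{(m)} = 0$:
  the unique degree 1 derivation that agrees with \<open>d\<close> on the variables $x_i^{(m)}$, $m \le r$
  (zero for $m = 0$) and kills the $\xi^i_{(m)}$.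
\<close>

definition d_ext ::
  "(nat \<Rightarrow> nat set) \<Rightarrow> ('k::comm_ring_1 galg \<Rightarrow> 'k galg) \<Rightarrow> nat \<Rightarrow> 'k galg \<Rightarrow> 'k galg" where
  "d_ext J d r X = (\<Sum>m=1..r. \<Sum>i\<in>J m. d (gvar (Xvar m i)) * lderiv (Xvar m i) X)"

definition pi0 ::
  "(nat \<Rightarrow> nat set) \<Rightarrow> ('k::comm_ring_1 galg \<Rightarrow> 'k galg) \<Rightarrow> nat \<Rightarrow> 'k galg" where
  "pi0 J d r = (\<Sum>m=1..r. \<Sum>j\<in>J m. d (gvar (Xvar m j)) * gvar (Xivar m j))"

definition pi1 :: "nat \<Rightarrow> ('k::field_char_0 galg \<Rightarrow> 'k galg \<Rightarrow> 'k galg) \<Rightarrow> 'k galg" where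
  "pi1 n br = gconst (1 / 2) * (\<Sum>i=1..n. \<Sum>j=1..n.
     br (gvar (Xvar 0 i)) (gvar (Xvar 0 j)) * gvar (Xivar 0 i) * gvar (Xivar 0 j))"

definition is_pi_sequence ::
  "nat \<Rightarrow> ('k::field_char_0 galg \<Rightarrow> 'k galg \<Rightarrow> 'k galg) \<Rightarrow> (nat \<Rightarrow> nat set)
     \<Rightarrow> ('k galg \<Rightarrow> 'k galg) \<Rightarrow> (nat \<Rightarrow> 'k galg) \<Rightarrow> bool" where
  "is_pi_sequence n br J d \<pi> \<longleftrightarrow> \<pi> 1 = pi1 n br \<and>
     (\<forall>m\<ge>2. \<pi> m \<in> filt J (m + 1) (m - 1) \<and> homogeneous cdeg_var 2 (\<pi> m) \<and>
        (let P = pi0 J d (m - 1) + (\<Sum>i=1..m - 1. \<pi> i)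
         in schouten J (m - 1) P P - (- 2 * d_ext J d (m - 1) (\<pi> m)) \<in> filt J (m + 2) (m - 1)))"

text \<open>
  The Euler operator of the variables $x_i^{(m)}$, $m \ge 0$; only the finitely many variables
  occurring in \<open>X\<close> contribute.
\<close>

definition euler_x :: "'k::comm_ring_1 galg \<Rightarrow> 'k galg" where
  "euler_x X = (\<Sum>v\<in>(\<Union>u\<in>gkeys X. Poly_Mapping.keys u) \<inter> {Xvar m i | m i. True}.
     gvar v * lderiv v X)"

definition x_homogeneous :: "int \<Rightarrow> 'k::comm_ring_1 galg \<Rightarrow> bool" where
  "x_homogeneous k X \<longleftrightarrow> euler_x X = gconst (of_int k) * X"

end

theory Submission
  imports Defs
begin

text \<open>
  Each \<open>x\<close> of level \<open>m\<close> in the minimal model of a Koszul algebra has internal degree \<open>m + 1\<close>, so that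
  \<open>\<partial>\<close> is quadratic.  To see this, adjoin to \<open>R\<close> a variable killing each \<open>x\<close> (the acyclic closure of Tate,
  polynomial in characteristic 0) and compare it with the linear resolution of \<open>k\<close>: the new variable
  for the first \<open>x\<close> of wrong internal degree would be a boundary modulo decomposables, against minimality.

  The obstruction to choosing \<open>\<pi>\<^sub>m\<close> is then closed by the Jacobi identity of the Schouten bracket, and exact
  since \<open>R\<close> is a resolution.  As \<open>\<pi>\<^sub>0\<close> has \<open>x\<close>-degree 2, its part of \<open>x\<close>-degree \<open>p + 3\<close> is cancelled by the
  part of \<open>x\<close>-degree \<open>p + 2\<close> of a solution.  The only other part has \<open>x\<close>-degree \<open>2 p + 3\<close>; for \<open>p < 0\<close> it is the
  differential of an element of \<open>x\<close>-degree \<open>2 p + 2 \<le> 0\<close>, hence zero.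
\<close>

subsection \<open>Monomials, homogeneous components and parity\<close>

text \<open>The internal degree w of an x of level m is squeezed from two sides. Minimality gives
  only the lower bound m + 1: once the lower levels are settled, a monomial of \<partial>x has w + 1
  - m factors, and there are at least two. The Koszul property enters for the upper bound: a step
  along the linear resolution costs one internal degree and gains one cohomological degree, so the
  variable killing x arrives in cohomological degree 0 with internal degree w - m - 1, where only a
  nonzero constant could fail to be a boundary. No quotient ring or tensor product is formed for
  this; A-linear algebra is done in each \<xi>-coefficient separately, modulo I.

  In the recursion the filtration is weighted by level so that bracketing with
  \<open>\<pi> i\<close> raises it, while bracketing with \<open>pi0\<close> is the differential up
  to higher terms. Each stage is then a question about cycles of R, one for each \<xi>-monomial. The
  first obstruction is exceptional: its coefficients have degree 0, where being a boundary also
  requires an image in I, and there the Poisson ideal enters.\<close>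

lemma gcoeff_nonadm: "\<not> admissible u \<Longrightarrow> gcoeff X u = 0"
  using gkeys_admissible in_gkeys_iff by metis

lemma gkeys_0 [simp]: "gkeys (0 :: 'k::comm_ring_1 galg) = {}"
  by (auto simp: in_gkeys_iff)

lemma gkeys_eq_empty_iff [simp]: "gkeys (X :: 'k::comm_ring_1 galg) = {} \<longleftrightarrow> X = 0"
  by (auto simp: in_gkeys_iff set_eq_iff intro: galg_eqI)

lemma gkeys_gmonom: "gkeys (gmonom u c) \<subseteq> {u}"
  by (auto simp: in_gkeys_iff gcoeff_gmonom split: if_splits)

lemma gkeys_uminus [simp]: "gkeys (- X) = gkeys (X :: 'k::comm_ring_1 galg)"
  by (auto simp: in_gkeys_iff)

lemma gkeys_diff_subset: "gkeys (X - Y) \<subseteq> gkeys X \<union> gkeys (Y :: 'k::comm_ring_1 galg)"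
  by (auto simp: in_gkeys_iff)

lemma gkeys_sum_subset: "gkeys (sum f A :: 'k::comm_ring_1 galg) \<subseteq> (\<Union>a\<in>A. gkeys (f a))"
proof
  fix u assume "u \<in> gkeys (sum f A)"
  then have "(\<Sum>a\<in>A. gcoeff (f a) u) \<noteq> 0" by (simp add: in_gkeys_iff gcoeff_sum)
  then obtain a where "a \<in> A" "gcoeff (f a) u \<noteq> 0" by (meson sum.neutral)
  then show "u \<in> (\<Union>a\<in>A. gkeys (f a))" by (auto simp: in_gkeys_iff)
qed

lemma gkeys_mult:
  assumes "w \<in> gkeys (X * Y :: 'k::comm_ring_1 galg)"
  obtains u v where "u \<in> gkeys X" "v \<in> gkeys Y" "w = u + v"
proof -
  from assms have "w \<in> (\<Union>u\<in>gkeys X. gkeys (\<Sum>v\<in>gkeys Y. gmonom (u + v)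
     (of_int (koszul_sign u v) * gcoeff X u * gcoeff Y v)))"
    unfolding times_galg_def by (rule subsetD[OF gkeys_sum_subset])
  then obtain u where u: "u \<in> gkeys X" "w \<in> gkeys (\<Sum>v\<in>gkeys Y. gmonom (u + v)
     (of_int (koszul_sign u v) * gcoeff X u * gcoeff Y v))" by (rule UN_E)
  from u(2) have "w \<in> (\<Union>v\<in>gkeys Y. gkeys (gmonom (u + v)
     (of_int (koszul_sign u v) * gcoeff X u * gcoeff Y v)))"
    by (rule subsetD[OF gkeys_sum_subset])
  then obtain v where v: "v \<in> gkeys Y" "w \<in> gkeys (gmonom (u + v)
     (of_int (koszul_sign u v) * gcoeff X u * gcoeff Y v))" by (rule UN_E)
  from v(2) have "w = u + v" by (rule subsetD[OF gkeys_gmonom, THEN singletonD])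
  with u v show thesis by (auto intro: that)
qed

text \<open>The third premise ranges over the monomials of the given \<open>X\<close> alone, so that
  a hypothesis on \<open>X\<close>, such as homogeneity, is available for each of them.\<close>

lemma galg_induct:
  fixes X :: "'k::comm_ring_1 galg"
  assumes "P 0" "\<And>X Y. P X \<Longrightarrow> P Y \<Longrightarrow> P (X + Y)"
    and "\<And>u. u \<in> gkeys X \<Longrightarrow> P (gmonom u (gcoeff X u))"
  shows "P X"
proof -
  have "P (\<Sum>u\<in>U. gmonom u (gcoeff X u))" if "finite U" "U \<subseteq> gkeys X" for U
    using that by (induction U) (auto intro: assms)
  from this[of "gkeys X"] show ?thesis by (simp flip: galg_expand)
qed

lemma gmonom_mult_if:
  "gmonom u a * gmonom v (b :: 'k::comm_ring_1)
    = (if admissible u \<and> admissible v then gmonom (u + v) (of_int (koszul_sign u v) * a * b) else 0)"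
  by (auto simp: gmonom_mult gmonom_not_admissible)

lemma gmonom_uminus: "gmonom u (- c) = - gmonom u (c :: 'k::comm_ring_1)"
  by (rule galg_eqI) (simp add: gcoeff_gmonom)

lemma gcoeff_gconst_mult [simp]: "gcoeff (gconst c * X) u = c * gcoeff X (u :: gmon)"
proof (induction X rule: galg_induct)
  case (3 v)
  then show ?case by (simp add: gconst_def gmonom_mult admissible_0 gkeys_admissible gcoeff_gmonom)
qed (simp_all add: algebra_simps)

lemma gcoeff_mult_gconst [simp]: "gcoeff (X * gconst c) u = c * gcoeff X (u :: gmon)"
proof (induction X rule: galg_induct)
  case (3 v)
  then show ?case by (simp add: gconst_def gmonom_mult admissible_0 gkeys_admissible gcoeff_gmonom mult.commute)
qed (simp_all add: algebra_simps)

lemma gconst_commute: "gconst c * X = X * gconst c"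
  by (rule galg_eqI) simp

lemma gcoeff_gconst: "gcoeff (gconst c) u = (if u = 0 then c else 0)"
  by (simp add: gconst_def gcoeff_gmonom admissible_0)

lemma gconst_0 [simp]: "gconst (0 :: 'k::comm_ring_1) = 0"
  by (simp add: gconst_def)

lemma gconst_1 [simp]: "gconst (1 :: 'k::comm_ring_1) = 1"
  by (simp add: gconst_def one_galg_def)

lemma gconst_add: "gconst (a + b :: 'k::comm_ring_1) = gconst a + gconst b"
  by (rule galg_eqI) (simp add: gcoeff_gconst)

lemma gconst_uminus: "gconst (- a :: 'k::comm_ring_1) = - gconst a"
  by (rule galg_eqI) (simp add: gcoeff_gconst)

lemma gconst_mult: "gconst (a * b :: 'k::comm_ring_1) = gconst a * gconst b"
  by (rule galg_eqI) (simp add: gcoeff_gconst)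

lemma gconst_of_nat: "gconst (of_nat k :: 'k::comm_ring_1) = of_nat k"
  by (induction k) (simp_all add: gconst_add)

lemma gconst_numeral: "gconst (numeral k :: 'k::comm_ring_1) = numeral k"
  using gconst_of_nat[of "numeral k"] by simp

lemma gconst_mult_gmonom: "gconst a * gmonom u b = gmonom u (a * b :: 'k::comm_ring_1)"
  by (rule galg_eqI) (simp add: gcoeff_gmonom)

lemma gkeys_gconst_mult: "gkeys (gconst c * X) \<subseteq> gkeys (X :: 'k::comm_ring_1 galg)"
  by (auto simp: in_gkeys_iff)

text \<open>Subalgebras, homogeneous pieces and filtration steps are all spans of sets of monomials;
  their closure properties come from this one notion.\<close>

definition kspan :: "gmon set \<Rightarrow> 'k::comm_ring_1 galg set" where
  "kspan K = {X. gkeys X \<subseteq> K}"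

lemma kspan_0 [simp]: "0 \<in> kspan K"
  and kspan_add: "X \<in> kspan K \<Longrightarrow> Y \<in> kspan K \<Longrightarrow> X + Y \<in> kspan K"
  and kspan_diff: "X \<in> kspan K \<Longrightarrow> Y \<in> kspan K \<Longrightarrow> X - Y \<in> kspan K"
  and kspan_uminus: "X \<in> kspan K \<Longrightarrow> - X \<in> kspan K"
  and kspan_gconst_mult: "X \<in> kspan K \<Longrightarrow> gconst c * X \<in> kspan K"
  and kspan_gmonom: "u \<in> K \<Longrightarrow> gmonom u c \<in> kspan K"
  unfolding kspan_def using gkeys_add_subset gkeys_diff_subset gkeys_gconst_mult gkeys_gmonom
  by (blast | simp)+

lemma kspan_sum: "(\<And>a. a \<in> A \<Longrightarrow> f a \<in> kspan K) \<Longrightarrow> sum f A \<in> kspan K"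
  by (induction A rule: infinite_finite_induct) (auto intro: kspan_add)

lemma kspan_mult:
  assumes "X \<in> kspan K" "Y \<in> kspan L" "\<And>u v. u \<in> K \<Longrightarrow> v \<in> L \<Longrightarrow> u + v \<in> M"
  shows "X * Y \<in> kspan M"
  using assms unfolding kspan_def by (blast elim: gkeys_mult)

lemma kspan_mono: "X \<in> kspan K \<Longrightarrow> K \<subseteq> L \<Longrightarrow> X \<in> kspan L"
  by (auto simp: kspan_def)

definition wspan :: "(gvariable \<Rightarrow> int) \<Rightarrow> int set \<Rightarrow> 'k::comm_ring_1 galg set" where
  "wspan w E = kspan {u. mon_weight w u \<in> E}"

lemma homogeneous_wspan: "homogeneous w e X \<longleftrightarrow> X \<in> wspan w {e}"
  by (auto simp: homogeneous_def wspan_def kspan_def)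

lemma subalg_kspan: "subalg V = kspan {u. Poly_Mapping.keys u \<subseteq> V}"
  by (auto simp: subalg_def kspan_def)

lemma mon_weight_superset:
  assumes "finite V" "Poly_Mapping.keys u \<subseteq> V"
  shows "mon_weight w u = (\<Sum>v\<in>V. int (Poly_Mapping.lookup u v) * w v)"
  unfolding mon_weight_def using assms by (intro sum.mono_neutral_left) (auto simp: in_keys_iff)

lemma mon_weight_0 [simp]: "mon_weight w 0 = 0"
  by (simp add: mon_weight_def)

lemma mon_weight_add: "mon_weight w (u + v) = mon_weight w u + mon_weight w v"
proof -
  let ?V = "Poly_Mapping.keys u \<union> Poly_Mapping.keys v"
  have "finite ?V" by simp
  moreover have "Poly_Mapping.keys (u + v) \<subseteq> ?V" by (rule Poly_Mapping.keys_add)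
  ultimately show ?thesis
    by (subst (1 2 3) mon_weight_superset[of ?V]) (auto simp: lookup_add algebra_simps sum.distrib)
qed

lemma mon_weight_single [simp]: "mon_weight w (Poly_Mapping.single v k) = int k * w v"
  by (simp add: mon_weight_def)

lemma single_minus_plus:
  assumes "Poly_Mapping.lookup u v \<noteq> 0"
  shows "Poly_Mapping.single v (Suc 0) + (u - Poly_Mapping.single v (Suc 0)) = u"
  by (rule poly_mapping_eqI) (use assms in \<open>auto simp: lookup_add lookup_minus lookup_single when_def\<close>)

lemma mon_weight_minus:
  assumes "Poly_Mapping.lookup u v \<noteq> 0"
  shows "mon_weight w (u - Poly_Mapping.single v (Suc 0)) = mon_weight w u - w v"
proof -
  have "mon_weight w u = mon_weight w (Poly_Mapping.single v (Suc 0)) + mon_weight w (u - Poly_Mapping.single v (Suc 0))"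
    by (subst mon_weight_add[symmetric]) (simp only: single_minus_plus[OF assms])
  then show ?thesis by simp
qed

lemma wspan_0 [simp]: "0 \<in> wspan w E"
  and wspan_add: "X \<in> wspan w E \<Longrightarrow> Y \<in> wspan w E \<Longrightarrow> X + Y \<in> wspan w E"
  and wspan_diff: "X \<in> wspan w E \<Longrightarrow> Y \<in> wspan w E \<Longrightarrow> X - Y \<in> wspan w E"
  and wspan_uminus: "X \<in> wspan w E \<Longrightarrow> - X \<in> wspan w E"
  and wspan_gconst_mult: "X \<in> wspan w E \<Longrightarrow> gconst c * X \<in> wspan w E"
  unfolding wspan_def by (simp_all add: kspan_add kspan_diff kspan_uminus kspan_gconst_mult)

lemma wspan_sum: "(\<And>a. a \<in> A \<Longrightarrow> f a \<in> wspan w E) \<Longrightarrow> sum f A \<in> wspan w E"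
  unfolding wspan_def by (rule kspan_sum)

lemma wspan_mono: "X \<in> wspan w E \<Longrightarrow> E \<subseteq> F \<Longrightarrow> X \<in> wspan w F"
  unfolding wspan_def by (erule kspan_mono) auto

lemma wspan_mult:
  assumes "X \<in> wspan w E" "Y \<in> wspan w F" "\<And>e f. e \<in> E \<Longrightarrow> f \<in> F \<Longrightarrow> e + f \<in> G"
  shows "X * Y \<in> wspan w G"
  using assms unfolding wspan_def by (auto intro!: kspan_mult simp: mon_weight_add)

lemma subalg_0 [simp]: "0 \<in> subalg V"
  and subalg_add: "X \<in> subalg V \<Longrightarrow> Y \<in> subalg V \<Longrightarrow> X + Y \<in> subalg V"
  and subalg_diff: "X \<in> subalg V \<Longrightarrow> Y \<in> subalg V \<Longrightarrow> X - Y \<in> subalg V"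
  and subalg_uminus: "X \<in> subalg V \<Longrightarrow> - X \<in> subalg V"
  and subalg_gconst_mult: "X \<in> subalg V \<Longrightarrow> gconst c * X \<in> subalg V"
  unfolding subalg_kspan by (simp_all add: kspan_add kspan_diff kspan_uminus kspan_gconst_mult)

lemma subalg_sum: "(\<And>a. a \<in> A \<Longrightarrow> f a \<in> subalg V) \<Longrightarrow> sum f A \<in> subalg V"
  unfolding subalg_kspan by (rule kspan_sum)

lemma subalg_mono: "X \<in> subalg V \<Longrightarrow> V \<subseteq> W \<Longrightarrow> X \<in> subalg W"
  by (auto simp: subalg_def)

lemma subalg_mult: "X \<in> subalg V \<Longrightarrow> Y \<in> subalg V \<Longrightarrow> X * Y \<in> subalg V"
  unfolding subalg_kspan
  by (erule (1) kspan_mult) (use Poly_Mapping.keys_add in fastforce)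

lemma subalg_gmonom: "Poly_Mapping.keys u \<subseteq> V \<Longrightarrow> gmonom u c \<in> subalg V"
  unfolding subalg_kspan by (rule kspan_gmonom) simp

lemma subalg_gvar: "v \<in> V \<Longrightarrow> gvar v \<in> subalg V"
  unfolding gvar_def by (rule subalg_gmonom) simp

lemma subalg_gconst [simp]: "gconst c \<in> subalg V"
  unfolding gconst_def by (rule subalg_gmonom) simp

lemma subalg_1 [simp]: "1 \<in> subalg V"
  using subalg_gconst[of 1 V] by simp

lemma admissible_single: "admissible (Poly_Mapping.single v (Suc 0))"
  by (auto simp: admissible_def lookup_single when_def)

lemma odd_part_single: "odd_part (Poly_Mapping.single v (Suc 0)) = (if odd_var v then {v} else {})"
  by (auto simp: odd_part_def)

lemma admissible_minus: "admissible u \<Longrightarrow> admissible (u - v)"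
  by (auto simp: admissible_def lookup_minus intro: diff_le_self le_trans)

lemma koszul_sign_sq: "odd_part u \<inter> odd_part v = {} \<Longrightarrow> koszul_sign u v * koszul_sign u v = 1"
  by (simp add: koszul_sign_def flip: power_add)

lemma koszul_sign_sq_adm: "admissible u \<Longrightarrow> admissible v \<Longrightarrow> admissible (u + v) \<Longrightarrow> koszul_sign u v * koszul_sign u v = 1"
  by (simp add: admissible_add_iff koszul_sign_sq)

lemma gmonom_split:
  assumes "admissible (u + v)" "admissible u" "admissible v"
  shows "gmonom (u + v) c = gmonom u 1 * gmonom v (of_int (koszul_sign u v) * c :: 'k::comm_ring_1)"
proof -
  have "(of_int (koszul_sign u v) * of_int (koszul_sign u v) :: 'k) = 1"
    using koszul_sign_sq_adm[OF assms(2,3,1)] by (metis of_int_1 of_int_mult)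
  then show ?thesis by (simp add: gmonom_mult assms flip: mult.assoc)
qed

text \<open>A monomial is peeled from the left, the Koszul sign being absorbed into the scalar, so
  that identities for derivations have to be checked only against multiplication by one
  variable.\<close>

lemma subalg_induct [consumes 1, case_names add const mult]:
  fixes X :: "'k::comm_ring_1 galg"
  assumes "X \<in> subalg V"
    and add: "\<And>X Y. X \<in> subalg V \<Longrightarrow> Y \<in> subalg V \<Longrightarrow> P X \<Longrightarrow> P Y \<Longrightarrow> P (X + Y)"
    and const: "\<And>c. P (gconst c)"
    and mult: "\<And>v X. v \<in> V \<Longrightarrow> X \<in> subalg V \<Longrightarrow> P X \<Longrightarrow> P (gvar v * X)"
  shows "P X"
proof -
  have mon: "P (gmonom u c)" if "Poly_Mapping.keys u \<subseteq> V" "admissible u" for u and c :: 'k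
    using that
  proof (induction "nat (mon_weight (\<lambda>_. 1) u)" arbitrary: u c rule: less_induct)
    case less
    show ?case
    proof (cases "u = 0")
      case True then show ?thesis using const[of c] by (simp add: gconst_def)
    next
      case False
      then obtain v where v: "v \<in> Poly_Mapping.keys u" by (metis keys_eq_empty all_not_in_conv)
      then have v': "Poly_Mapping.lookup u v \<noteq> 0" by (simp add: in_keys_iff)
      let ?s = "Poly_Mapping.single v (Suc 0)"
      let ?u = "u - ?s"
      have k: "Poly_Mapping.keys ?u \<subseteq> V" using less.prems
        by (auto simp: in_keys_iff lookup_minus)
      have a: "admissible ?u" using less.prems by (simp add: admissible_minus)
      have nn: "mon_weight (\<lambda>_. 1) ?u \<ge> 0" unfolding mon_weight_def by (intro sum_nonneg) auto
      have "nat (mon_weight (\<lambda>_. 1) ?u) < nat (mon_weight (\<lambda>_. 1) u)"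
        using mon_weight_minus[OF v', of "\<lambda>_. 1"] nn by simp
      then have "P (gmonom ?u (of_int (koszul_sign ?s ?u) * c))" using less.hyps[OF _ k a] by blast
      then have "P (gvar v * gmonom ?u (of_int (koszul_sign ?s ?u) * c))"
        using v less.prems k by (intro mult) (auto intro: subalg_gmonom)
      moreover have "gmonom u c = gvar v * gmonom ?u (of_int (koszul_sign ?s ?u) * c)"
        using gmonom_split[of ?s ?u c] less.prems a
        by (simp add: single_minus_plus[OF v'] admissible_single gvar_def)
      ultimately show ?thesis by simp
    qed
  qed
  have P0: "P 0" using const[of 0] by simp
  have "X \<in> subalg V \<and> P X"
  proof (induction X rule: galg_induct)
    case (3 u)
    then have "Poly_Mapping.keys u \<subseteq> V" "admissible u"
      using assms(1) gkeys_admissible by (auto simp: subalg_def)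
    then show ?case by (auto intro: mon subalg_gmonom)
  qed (auto intro: P0 add subalg_add)
  then show ?thesis ..
qed

lemma subalg_UNIV [simp]: "X \<in> subalg UNIV"
  by (simp add: subalg_def)

lemmas galg_var_induct = subalg_induct[of _ UNIV, OF subalg_UNIV, simplified, case_names add const mult]

section \<open>Projections onto sets of monomials\<close>

definition gproj :: "(gmon \<Rightarrow> bool) \<Rightarrow> 'k::comm_ring_1 galg \<Rightarrow> 'k galg" where
  "gproj P X = (\<Sum>u\<in>{u \<in> gkeys X. P u}. gmonom u (gcoeff X u))"

lemma gcoeff_gproj [simp]: "gcoeff (gproj P X) u = (if P u then gcoeff X u else 0)"
proof -
  have "gcoeff (gproj P X) u = (\<Sum>v\<in>{v \<in> gkeys X. P v}. if v = u then (if admissible u then gcoeff X u else 0) else 0)"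
    unfolding gproj_def gcoeff_sum by (intro sum.cong) (auto simp: gcoeff_gmonom)
  also have "\<dots> = (if u \<in> {v \<in> gkeys X. P v} then (if admissible u then gcoeff X u else 0) else 0)"
    by (rule sum.delta) simp
  also have "\<dots> = (if P u then gcoeff X u else 0)"
    using gcoeff_nonadm[of u X] by (auto simp: in_gkeys_iff)
  finally show ?thesis .
qed

lemma gkeys_gproj: "gkeys (gproj P X) = {u \<in> gkeys X. P u}"
  by (auto simp: in_gkeys_iff split: if_splits)

lemma gproj_add: "gproj P (X + Y) = gproj P X + gproj P Y"
  and gproj_diff: "gproj P (X - Y) = gproj P X - gproj P Y"
  and gproj_0 [simp]: "gproj P 0 = 0"
  and gproj_gconst_mult: "gproj P (gconst c * X) = gconst c * gproj P X"
  by (rule galg_eqI; simp)+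

lemma gproj_sum: "gproj P (sum f A) = (\<Sum>a\<in>A. gproj P (f a))"
  by (induction A rule: infinite_finite_induct) (auto simp: gproj_add)

lemma gproj_kspan': "X \<in> kspan K \<Longrightarrow> gproj P X \<in> kspan K"
  by (auto simp: kspan_def gkeys_gproj)

lemma gproj_subalg: "X \<in> subalg V \<Longrightarrow> gproj P X \<in> subalg V"
  unfolding subalg_kspan by (rule gproj_kspan')

lemma gproj_id: "(\<And>u. u \<in> gkeys X \<Longrightarrow> P u) \<Longrightarrow> gproj P X = X"
  by (rule galg_eqI) (auto simp: in_gkeys_iff)

lemma gproj_none: "(\<And>u. u \<in> gkeys X \<Longrightarrow> \<not> P u) \<Longrightarrow> gproj P X = 0"
  by (rule galg_eqI) (auto simp: in_gkeys_iff)

lemma gproj_gmonom: "gproj P (gmonom u c) = (if P u then gmonom u c else 0)"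
  by (rule galg_eqI) (auto simp: gcoeff_gmonom)

text \<open>A homogeneous operator sends each monomial either into the selected part or into its
  complement, with \<open>P'\<close> the condition \<open>P\<close> shifted by the degree;
  additivity does the rest. This extracts homogeneous components from equations.\<close>

lemma gproj_commute:
  assumes "X \<in> kspan K"
    and add: "\<And>X Y. X \<in> kspan K \<Longrightarrow> Y \<in> kspan K \<Longrightarrow> F (X + Y) = F X + F Y"
    and keys: "\<And>u c v. u \<in> K \<Longrightarrow> v \<in> gkeys (F (gmonom u c)) \<Longrightarrow> P v \<longleftrightarrow> P' u"
  shows "gproj P (F X) = F (gproj P' X)"
proof -
  have F0: "F 0 = 0" using add[of 0 0] by simp
  have "X \<in> kspan K \<and> gproj P (F X) = F (gproj P' X)"
  proof (induction X rule: galg_induct)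
    case 1 then show ?case by (simp add: F0)
  next
    case (2 X Y)
    then show ?case by (simp add: gproj_add add kspan_add gproj_kspan')
  next
    case (3 u)
    then have u: "u \<in> K" using assms(1) by (auto simp: kspan_def)
    have "gproj P (F (gmonom u (gcoeff X u))) = F (gproj P' (gmonom u (gcoeff X u)))"
    proof (cases "P' u")
      case True
      then show ?thesis using keys[OF u] by (simp add: gproj_gmonom gproj_id)
    next
      case False
      then show ?thesis using keys[OF u] by (simp add: gproj_gmonom gproj_none F0)
    qed
    then show ?case using u by (simp add: kspan_gmonom)
  qed
  then show ?thesis ..
qed

lemma gproj_mult_left:
  assumes "\<And>u v. u \<in> gkeys X \<Longrightarrow> P (u + v) \<longleftrightarrow> P' v"
  shows "gproj P (X * Y) = X * gproj P' Y"
  by (rule gproj_commute[of _ UNIV])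
    (auto simp: kspan_def distrib_left distrib_right assms dest!: subsetD[OF gkeys_gmonom] elim!: gkeys_mult)

lemma gproj_mult_right:
  assumes "\<And>u v. u \<in> gkeys X \<Longrightarrow> P (v + u) \<longleftrightarrow> P' v"
  shows "gproj P (Y * X) = gproj P' Y * X"
  by (rule gproj_commute[of _ UNIV, where F = "\<lambda>Y. Y * X"])
    (auto simp: kspan_def distrib_left distrib_right assms dest!: subsetD[OF gkeys_gmonom] elim!: gkeys_mult)

text \<open>The parity automorphism. With it the Leibniz rules of odd derivations make sense for
  inhomogeneous elements as well.\<close>

definition gsgn :: "'k::comm_ring_1 galg \<Rightarrow> 'k galg" where
  "gsgn X = gproj (\<lambda>u. even (card (odd_part u))) X - gproj (\<lambda>u. odd (card (odd_part u))) X"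

lemma gcoeff_gsgn: "gcoeff (gsgn X) u = (if even (card (odd_part u)) then gcoeff X u else - gcoeff X u)"
  by (simp add: gsgn_def)

lemma gsgn_add: "gsgn (X + Y) = gsgn X + gsgn Y"
  and gsgn_uminus: "gsgn (- X) = - gsgn X"
  and gsgn_0 [simp]: "gsgn 0 = 0"
  and gsgn_gsgn [simp]: "gsgn (gsgn X) = X"
  and gsgn_gconst [simp]: "gsgn (gconst c) = gconst c"
  by (rule galg_eqI; auto simp: gcoeff_gsgn gcoeff_gconst)+

lemma gkeys_gsgn [simp]: "gkeys (gsgn X) = gkeys X"
  by (auto simp: in_gkeys_iff gcoeff_gsgn split: if_splits)

lemma gsgn_subalg: "X \<in> subalg V \<Longrightarrow> gsgn X \<in> subalg V"
  by (simp add: subalg_def)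

lemma gsgn_gmonom: "gsgn (gmonom u c) = (if even (card (odd_part u)) then gmonom u c else - gmonom u c)"
  by (rule galg_eqI) (auto simp: gcoeff_gsgn gcoeff_gmonom)

lemma gsgn_gvar: "gsgn (gvar v) = (if odd_var v then - gvar v else gvar v)"
  unfolding gvar_def by (simp add: gsgn_gmonom odd_part_single)

lemma card_odd_part_add:
  assumes "admissible (u + v)" "admissible u" "admissible v"
  shows "card (odd_part (u + v)) = card (odd_part u) + card (odd_part v)"
  using assms by (simp add: admissible_add_iff odd_part_add card_Un_disjoint)

lemma gsgn_mult: "gsgn (X * Y) = gsgn X * gsgn Y"
proof (induction X rule: galg_induct)
  case (3 u)
  let ?c = "gcoeff X u"
  show ?case
  proof (induction Y rule: galg_induct)
    case (3 v)
    then show ?case using \<open>u \<in> gkeys X\<close>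
      by (cases "admissible (u + v)")
        (auto simp: gsgn_gmonom gmonom_mult gkeys_admissible card_odd_part_add gmonom_not_admissible)
  qed (simp_all add: gsgn_add algebra_simps)
qed (simp_all add: gsgn_add algebra_simps)

text \<open>Each pair in \<open>odd_part u \<times> odd_part v\<close> is an inversion for exactly
  one of the two orders, as \<open>var_rank\<close> is injective and the sets are disjoint. The two
  inversion counts therefore add up to the product of the cardinalities.\<close>

lemma koszul_sign_swap:
  assumes "odd_part u \<inter> odd_part v = {}"
  shows "koszul_sign v u = koszul_sign u v * (-1) ^ (card (odd_part u) * card (odd_part v))"
proof -
  define A where "A = {(a, b). a \<in> odd_part u \<and> b \<in> odd_part v \<and> var_rank b < var_rank a}"
  define B where "B = {(a, b). a \<in> odd_part v \<and> b \<in> odd_part u \<and> var_rank b < var_rank a}"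
  define B' where "B' = {(b, a). a \<in> odd_part v \<and> b \<in> odd_part u \<and> var_rank b < var_rank a}"
  have B: "card B = card B'"
    by (rule bij_betw_same_card[of prod.swap]) (auto simp: B_def B'_def bij_betw_def inj_on_def image_iff)
  have "A \<union> B' = odd_part u \<times> odd_part v"
  proof
    show "odd_part u \<times> odd_part v \<subseteq> A \<union> B'"
    proof safe
      fix a b assume ab: "a \<in> odd_part u" "b \<in> odd_part v" "(a, b) \<notin> B'"
      then have "a \<noteq> b" using assms by blast
      then have "var_rank a \<noteq> var_rank b" by simp
      with ab show "(a, b) \<in> A" unfolding A_def B'_def by (simp del: var_rank_eq_iff)
    qed
  qed (auto simp: A_def B'_def)
  moreover have "A \<inter> B' = {}" by (auto simp: A_def B'_def)
  moreover have "finite A" unfolding A_def by (rule finite_inversions)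
  moreover have "finite B'" unfolding B'_def by (rule finite_subset[of _ "odd_part u \<times> odd_part v"]) auto
  ultimately have c: "card A + card B = card (odd_part u) * card (odd_part v)"
    unfolding B by (metis card_Un_disjoint card_cartesian_product)
  have "odd_part v \<inter> odd_part u = {}" using assms by auto
  then have "koszul_sign v u = (-1) ^ card B" "koszul_sign u v = (-1) ^ card A"
    using assms by (simp_all add: koszul_sign_def A_def B_def)
  then show ?thesis by (simp flip: c add: power_add)
qed

lemma gmonom_commute:
  "gmonom u a * Y = (if even (card (odd_part u)) then Y else gsgn Y) * gmonom u (a :: 'k::comm_ring_1)"
proof (induction Y rule: galg_induct)
  case (3 v)
  show ?case
  proof (cases "admissible u \<and> odd_part u \<inter> odd_part v = {}")
    case True
    with 3 have "admissible u" "admissible v" by (auto simp: gkeys_admissible)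
    define s where "s = (of_int (koszul_sign u v) :: 'k)"
    have d: "odd_part u \<inter> odd_part v = {}" using True by simp
    have 1: "gmonom u a * gmonom v (gcoeff Y v) = gmonom (u + v) (s * a * gcoeff Y v)"
      using \<open>admissible u\<close> \<open>admissible v\<close> by (simp add: gmonom_mult s_def)
    have 2: "gmonom v (gcoeff Y v) * gmonom u a
        = gmonom (u + v) (s * (-1) ^ (card (odd_part u) * card (odd_part v)) * a * gcoeff Y v)"
      using \<open>admissible u\<close> \<open>admissible v\<close>
      by (simp add: gmonom_mult s_def koszul_sign_swap[OF d] add.commute mult_ac)
    show ?thesis
      by (cases "even (card (odd_part u))"; cases "even (card (odd_part v))")
        (simp_all add: 1 2 gsgn_gmonom gmonom_uminus)
  next
    case False
    then have "\<not> admissible u \<or> koszul_sign u v = 0 \<and> koszul_sign v u = 0"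
      by (auto simp: koszul_sign_def)
    then show ?thesis by (auto simp: gmonom_mult_if gsgn_gmonom gmonom_not_admissible)
  qed
qed (simp_all add: gsgn_add algebra_simps)

definition gpar :: "bool \<Rightarrow> 'k::comm_ring_1 galg \<Rightarrow> bool" where
  "gpar q X \<longleftrightarrow> (\<forall>u\<in>gkeys X. odd (card (odd_part u)) = q)"

lemma gpar_even_commute: "gpar False X \<Longrightarrow> X * Y = Y * X"
proof (rule galg_induct[where P = "\<lambda>Z. Z * Y = Y * Z" and X = X])
  fix u assume "gpar False X" "u \<in> gkeys X"
  then show "gmonom u (gcoeff X u) * Y = Y * gmonom u (gcoeff X u)"
    using gmonom_commute[of u _ Y] by (simp add: gpar_def)
qed (simp_all add: algebra_simps)

lemma gpar_odd_commute: "gpar True X \<Longrightarrow> X * Y = gsgn Y * X"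
proof (rule galg_induct[where P = "\<lambda>Z. Z * Y = gsgn Y * Z" and X = X])
  fix u assume "gpar True X" "u \<in> gkeys X"
  then show "gmonom u (gcoeff X u) * Y = gsgn Y * gmonom u (gcoeff X u)"
    using gmonom_commute[of u _ Y] by (simp add: gpar_def)
qed (simp_all add: algebra_simps)

lemma gpar_gsgn: "gpar q X \<Longrightarrow> gsgn X = (if q then - X else X)"
  by (rule galg_eqI) (auto simp: gpar_def gcoeff_gsgn in_gkeys_iff)

lemma gpar_odd_odd: "gpar True X \<Longrightarrow> gpar True Y \<Longrightarrow> X * Y = - (Y * X)"
  using gpar_odd_commute[of X Y] gpar_gsgn[of True Y] by simp

lemma gpar_0 [simp]: "gpar q 0" by (simp add: gpar_def)

lemma gpar_add: "gpar q X \<Longrightarrow> gpar q Y \<Longrightarrow> gpar q (X + Y)"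
  and gpar_uminus: "gpar q X \<Longrightarrow> gpar q (- X)"
  and gpar_gconst_mult: "gpar q X \<Longrightarrow> gpar q (gconst c * X)"
  using gkeys_add_subset[of X Y] gkeys_gconst_mult[of c X]
  by (auto simp: gpar_def)

lemma gpar_sum: "(\<And>a. a \<in> A \<Longrightarrow> gpar q (f a)) \<Longrightarrow> gpar q (sum f A)"
  by (induction A rule: infinite_finite_induct) (auto intro: gpar_add)

lemma gpar_mult:
  assumes "gpar q X" "gpar r Y" shows "gpar (q \<noteq> r) (X * Y)"
  unfolding gpar_def
proof
  fix w assume w: "w \<in> gkeys (X * Y)"
  then obtain u v where uv: "u \<in> gkeys X" "v \<in> gkeys Y" "w = u + v" by (rule gkeys_mult)
  then have "card (odd_part w) = card (odd_part u) + card (odd_part v)"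
    using gkeys_admissible[OF w] gkeys_admissible card_odd_part_add by blast
  then show "odd (card (odd_part w)) = (q \<noteq> r)" using assms uv by (auto simp: gpar_def)
qed

lemma gpar_gvar: "gpar (odd_var v) (gvar v)"
proof -
  have "gkeys (gvar v) \<subseteq> {Poly_Mapping.single v (Suc 0)}" unfolding gvar_def using gkeys_gmonom by simp
  then show ?thesis by (auto simp: gpar_def odd_part_single split: if_splits dest!: subsetD)
qed

text \<open>Stated for every weight of the right parities because it serves two gradings,
  \<open>cdeg_var\<close> and the grading \<open>cT\<close> of the acyclic closure.\<close>

lemma even_mon_weight_cdeg:
  assumes "admissible u" "\<And>v. even (w v) \<longleftrightarrow> \<not> odd_var v"
  shows "even (mon_weight w u) \<longleftrightarrow> even (card (odd_part u))"
proof -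
  have "even (\<Sum>v\<in>A. int (Poly_Mapping.lookup u v) * w v) \<longleftrightarrow> even (card {v \<in> A. odd_var v})"
    if "finite A" "A \<subseteq> Poly_Mapping.keys u" for A
    using that
  proof (induction A)
    case (insert v A)
    have eq: "{x \<in> insert v A. odd_var x} = (if odd_var v then insert v {x \<in> A. odd_var x} else {x \<in> A. odd_var x})"
      by auto
    show ?case
    proof (cases "odd_var v")
      case True
      then have "Poly_Mapping.lookup u v \<le> 1" using assms(1) by (simp add: admissible_def)
      moreover have "Poly_Mapping.lookup u v \<noteq> 0" using insert.prems by (auto simp: in_keys_iff)
      ultimately have "Poly_Mapping.lookup u v = 1" by simp
      moreover have "card {x \<in> insert v A. odd_var x} = Suc (card {x \<in> A. odd_var x})"
        unfolding eq using insert.hyps True by simp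
      ultimately show ?thesis using insert True assms(2) by simp
    next
      case False
      then show ?thesis using insert assms(2) eq by simp
    qed
  qed simp
  from this[of "Poly_Mapping.keys u"] show ?thesis by (simp add: mon_weight_def odd_part_def)
qed

lemma homogeneous_gpar:
  assumes "X \<in> wspan w {e}" "\<And>v. even (w v) \<longleftrightarrow> \<not> odd_var v"
  shows "gpar (odd e) X"
  unfolding gpar_def
proof
  fix u assume u: "u \<in> gkeys X"
  then have "mon_weight w u = e" using assms(1) by (auto simp: wspan_def kspan_def)
  then show "odd (card (odd_part u)) = odd e"
    using even_mon_weight_cdeg[OF gkeys_admissible[OF u] assms(2)] by auto
qed

subsection \<open>Derivatives and derivations\<close>

definition left_sign :: "gvariable \<Rightarrow> gmon \<Rightarrow> int" where
  "left_sign v u = (if odd_var v then (- 1) ^ card {w \<in> odd_part u. var_rank w < var_rank v} else 1)"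

lemma lderiv_superset:
  assumes "finite U" "gkeys X \<subseteq> U"
  shows "lderiv v X = (\<Sum>u\<in>U. gmonom (u - Poly_Mapping.single v (Suc 0))
      (of_int (left_sign v u) * of_nat (Poly_Mapping.lookup u v) * gcoeff X u :: 'k::comm_ring_1))"
proof -
  have "lderiv v X = (\<Sum>u\<in>gkeys X. gmonom (u - Poly_Mapping.single v (Suc 0))
      (of_int (left_sign v u) * of_nat (Poly_Mapping.lookup u v) * gcoeff X u :: 'k))"
    by (simp add: lderiv_def left_sign_def if_distrib cong: if_cong)
  also have "\<dots> = (\<Sum>u\<in>U. gmonom (u - Poly_Mapping.single v (Suc 0))
      (of_int (left_sign v u) * of_nat (Poly_Mapping.lookup u v) * gcoeff X u :: 'k))"
    by (rule sum.mono_neutral_left) (use assms in \<open>auto simp: in_gkeys_iff\<close>)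
  finally show ?thesis .
qed

lemma lderiv_add: "lderiv v (X + Y) = lderiv v X + lderiv v (Y :: 'k::comm_ring_1 galg)"
proof -
  let ?U = "gkeys X \<union> gkeys Y"
  have 0: "finite ?U" "gkeys (X + Y) \<subseteq> ?U" "gkeys X \<subseteq> ?U" "gkeys Y \<subseteq> ?U"
    using gkeys_add_subset[of X Y] by auto
  show ?thesis
    unfolding lderiv_superset[OF 0(1,2)] lderiv_superset[OF 0(1,3)] lderiv_superset[OF 0(1,4)]
    by (simp add: sum.distrib[symmetric] gmonom_add[symmetric] algebra_simps)
qed

lemma lderiv_0 [simp]: "lderiv v 0 = (0 :: 'k::comm_ring_1 galg)"
  by (simp add: lderiv_def)

lemma lderiv_sum: "lderiv v (sum f A) = (\<Sum>a\<in>A. lderiv v (f a :: 'k::comm_ring_1 galg))"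
  by (induction A rule: infinite_finite_induct) (auto simp: lderiv_add)

lemma lderiv_uminus: "lderiv v (- X) = - lderiv v (X :: 'k::comm_ring_1 galg)"
  using lderiv_add[of v X "- X"] by (simp add: eq_neg_iff_add_eq_0 add.commute)

lemma lderiv_gmonom: "lderiv v (gmonom u c) = (if admissible u then
    gmonom (u - Poly_Mapping.single v (Suc 0))
      (of_int (left_sign v u) * of_nat (Poly_Mapping.lookup u v) * c :: 'k::comm_ring_1) else 0)"
  using lderiv_superset[of "{u}" "gmonom u c" v] gkeys_gmonom[of u c]
  by (auto simp: gcoeff_gmonom gmonom_not_admissible)

lemma lderiv_gconst [simp]: "lderiv v (gconst c) = (0 :: 'k::comm_ring_1 galg)"
  by (simp add: gconst_def lderiv_gmonom)

lemma lderiv_1 [simp]: "lderiv v 1 = (0 :: 'k::comm_ring_1 galg)"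
  using lderiv_gconst[of v "1 :: 'k"] by simp

lemma gsgn_1 [simp]: "gsgn 1 = (1 :: 'k::comm_ring_1 galg)"
  using gsgn_gconst[of "1 :: 'k"] by simp

lemma lderiv_gconst_mult: "lderiv v (gconst c * X) = gconst c * lderiv v (X :: 'k::comm_ring_1 galg)"
proof (induction X rule: galg_induct)
  case (3 u)
  then show ?case by (simp add: gconst_mult_gmonom lderiv_gmonom gkeys_admissible mult_ac)
qed (simp_all add: lderiv_add algebra_simps)

lemma gkeys_lderiv:
  assumes "w \<in> gkeys (lderiv v X :: 'k::comm_ring_1 galg)"
  obtains u where "u \<in> gkeys X" "Poly_Mapping.lookup u v \<noteq> 0" "w = u - Poly_Mapping.single v (Suc 0)"
proof -
  from assms have "w \<in> (\<Union>u\<in>gkeys X. gkeys (gmonom (u - Poly_Mapping.single v (Suc 0))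
      (of_int (left_sign v u) * of_nat (Poly_Mapping.lookup u v) * gcoeff X u)))"
    unfolding lderiv_superset[OF finite_gkeys order_refl] by (rule subsetD[OF gkeys_sum_subset])
  then obtain u where u: "u \<in> gkeys X" "w \<in> gkeys (gmonom (u - Poly_Mapping.single v (Suc 0))
      (of_int (left_sign v u) * of_nat (Poly_Mapping.lookup u v) * gcoeff X u))" by (rule UN_E)
  from u(2) have "w = u - Poly_Mapping.single v (Suc 0)" by (rule subsetD[OF gkeys_gmonom, THEN singletonD])
  moreover have "Poly_Mapping.lookup u v \<noteq> 0"
  proof
    assume "Poly_Mapping.lookup u v = 0" with u(2) show False by simp
  qed
  ultimately show thesis using u(1) that by blast
qed

lemma koszul_sign_single:
  "koszul_sign (Poly_Mapping.single w (Suc 0)) u = (if odd_var w \<and> w \<in> odd_part u then 0 else left_sign w u)"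
proof -
  have "{(a, b). a = w \<and> b \<in> odd_part u \<and> var_rank b < var_rank a}
     = Pair w ` {b \<in> odd_part u. var_rank b < var_rank w}" by auto
  then have "card {(a, b). a = w \<and> b \<in> odd_part u \<and> var_rank b < var_rank a}
     = card {b \<in> odd_part u. var_rank b < var_rank w}" by (simp add: card_image inj_on_def)
  then show ?thesis by (auto simp: koszul_sign_def odd_part_single left_sign_def)
qed

lemma gvar_mult_gmonom:
  assumes "admissible u"
  shows "gvar w * gmonom u c = (if odd_var w \<and> w \<in> odd_part u then 0
    else gmonom (Poly_Mapping.single w (Suc 0) + u) (of_int (left_sign w u) * c :: 'k::comm_ring_1))"
  unfolding gvar_def using assms by (simp add: gmonom_mult admissible_single koszul_sign_single)

lemma left_sign_sq [simp]: "left_sign v u * left_sign v u = 1"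
  by (simp add: left_sign_def flip: power_add)

lemma left_sign_sq' [simp]: "of_int (left_sign v u) * (of_int (left_sign v u) * c) = (c :: 'k::comm_ring_1)"
  by (metis left_sign_sq mult.assoc mult_1 of_int_1 of_int_mult)

lemma left_sign_add:
  assumes "admissible (u + v)" "admissible u" "admissible v"
  shows "left_sign w (u + v) = left_sign w u * left_sign w v"
proof -
  have d: "odd_part u \<inter> odd_part v = {}" using assms by (simp add: admissible_add_iff)
  have "{x \<in> odd_part (u + v). var_rank x < var_rank w}
    = {x \<in> odd_part u. var_rank x < var_rank w} \<union> {x \<in> odd_part v. var_rank x < var_rank w}"
    by (auto simp: odd_part_add)
  moreover have "{x \<in> odd_part u. var_rank x < var_rank w} \<inter> {x \<in> odd_part v. var_rank x < var_rank w} = {}"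
    using d by auto
  ultimately show ?thesis by (simp add: left_sign_def card_Un_disjoint power_add)
qed

lemma left_sign_single:
  "left_sign w (Poly_Mapping.single v (Suc 0)) = (if odd_var w \<and> odd_var v \<and> var_rank v < var_rank w then - 1 else 1)"
proof -
  have "{x \<in> {v}. var_rank x < var_rank w} = (if var_rank v < var_rank w then {v} else {})" by auto
  then show ?thesis by (auto simp: left_sign_def odd_part_single)
qed

lemma admissible_single_add:
  "admissible u \<Longrightarrow> \<not> (odd_var w \<and> w \<in> odd_part u) \<Longrightarrow> admissible (Poly_Mapping.single w (Suc 0) + u)"
  by (subst admissible_add_iff) (auto simp: admissible_single odd_part_single)

text \<open>The reordering signs are settled here, on a monomial; the general product rule and the
  commutation of derivatives follow by induction on variables.\<close>

lemma lderiv_gvar_mult_gmonom: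
  assumes "admissible u"
  shows "lderiv v (gvar w * gmonom u c) = (if v = w then gmonom u c else 0) +
     (if odd_var v \<and> odd_var w then - 1 else 1) * (gvar w * lderiv v (gmonom u (c :: 'k::comm_ring_1)))"
proof (cases "Poly_Mapping.lookup u v = 0")
  case True
  show ?thesis
  proof (cases "v = w")
    case v: True
    then have "\<not> (odd_var w \<and> w \<in> odd_part u)" using True by (auto simp: odd_part_def in_keys_iff)
    then show ?thesis using True v assms
      by (auto simp: gvar_mult_gmonom lderiv_gmonom admissible_single_add left_sign_add admissible_single
          left_sign_single lookup_add lookup_single mult.assoc)
  next
    case False
    then show ?thesis using True assms
      by (auto simp: gvar_mult_gmonom lderiv_gmonom lookup_add lookup_single when_def)
  qed
next
  case False
  define u' where "u' = u - Poly_Mapping.single v (Suc 0)"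
  have u: "u = Poly_Mapping.single v (Suc 0) + u'" unfolding u'_def using False by (simp add: single_minus_plus)
  have a': "admissible u'" unfolding u'_def using assms by (simp add: admissible_minus)
  have vu: "odd_var v \<Longrightarrow> v \<in> odd_part u \<and> v \<notin> odd_part u'"
    using False assms by (auto simp: odd_part_def in_keys_iff u'_def lookup_minus admissible_def)
  have op: "odd_part u = odd_part u' \<union> (if odd_var v then {v} else {})"
    unfolding u by (auto simp: odd_part_add odd_part_single)
  have ls: "left_sign x u = left_sign x (Poly_Mapping.single v (Suc 0)) * left_sign x u'" for x
    unfolding u by (rule left_sign_add) (use a' assms u in \<open>auto simp: admissible_single\<close>)
  have R: "lderiv v (gmonom u c) = gmonom u' (of_int (left_sign v u) * of_nat (Poly_Mapping.lookup u v) * c)"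
    using assms by (simp add: lderiv_gmonom u'_def)
  show ?thesis
  proof (cases "v = w")
    case True
    show ?thesis
    proof (cases "odd_var v")
      case odd: True
      \<comment> \<open>An odd \<open>v\<close> already present in \<open>u\<close> kills the
        product, and the two summands on the right cancel: multiplying the derivative by
        \<open>v\<close> restores the monomial.\<close>
      then have l: "Poly_Mapping.lookup u v = 1" using assms False by (force simp: admissible_def)
      have "gvar v * gmonom u' (of_int (left_sign v u) * c) = gmonom u c"
        using vu odd a' by (simp add: gvar_mult_gmonom ls left_sign_single flip: u)
      moreover have "gvar v * gmonom u c = 0" using vu odd assms by (simp add: gvar_mult_gmonom)
      ultimately show ?thesis using True odd unfolding R l by simp
    next
      case even: False
      have a: "admissible (Poly_Mapping.single v (Suc 0) + u)" using assms even by (simp add: admissible_single_add)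
      have ls1: "left_sign v x = 1" for x using even by (simp add: left_sign_def)
      have "gvar v * gmonom u' b = gmonom u b" for b :: 'k
        using even by (simp add: gvar_mult_gmonom[OF a'] ls1 flip: u)
      then have 1: "gvar v * lderiv v (gmonom u c) = gmonom u (of_nat (Poly_Mapping.lookup u v) * c)"
        unfolding R ls1 by simp
      have "gvar v * gmonom u c = gmonom (Poly_Mapping.single v (Suc 0) + u) c"
        using even by (simp add: gvar_mult_gmonom[OF assms] ls1)
      then have 2: "lderiv v (gvar v * gmonom u c) = gmonom u (of_nat (Suc (Poly_Mapping.lookup u v)) * c)"
        using a by (simp add: lderiv_gmonom ls1 lookup_add)
      have "lderiv v (gvar v * gmonom u c) = gmonom u c + gvar v * lderiv v (gmonom u c)"
        unfolding 1 2 by (simp add: distrib_right gmonom_add)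
      then show ?thesis using True even by simp
    qed
  next
    case vw: False
    show ?thesis
    proof (cases "odd_var w \<and> w \<in> odd_part u")
      case True
      then have "w \<in> odd_part u'" using op vw by (auto split: if_splits)
      then show ?thesis using True vw assms a' by (simp add: R gvar_mult_gmonom)
    next
      case nw: False
      then have nw': "\<not> (odd_var w \<and> w \<in> odd_part u')" using op by auto
      have a: "admissible (Poly_Mapping.single w (Suc 0) + u)" using assms nw by (simp add: admissible_single_add)
      have e: "Poly_Mapping.single w (Suc 0) + u - Poly_Mapping.single v (Suc 0) = Poly_Mapping.single w (Suc 0) + u'"
        unfolding u'_def by (rule poly_mapping_eqI) (use False in \<open>auto simp: lookup_add lookup_minus lookup_single when_def\<close>)
      have r: "var_rank v \<noteq> var_rank w" using vw by simp
      \<comment> \<open>Exactly one of \<open>v\<close> and \<open>w\<close> has the smaller rank,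
        so when both are odd exactly one of the two reorderings contributes a sign.\<close>
      have "left_sign v (Poly_Mapping.single w (Suc 0) + u) * left_sign w u
         = (if odd_var v \<and> odd_var w then - 1 else 1) * (left_sign w u' * left_sign v u)"
        using r by (auto simp: left_sign_add[OF a admissible_single assms] ls[of w] left_sign_single simp del: var_rank_eq_iff)
      then have s: "of_int (left_sign v (Poly_Mapping.single w (Suc 0) + u)) * of_int (left_sign w u)
         = (if odd_var v \<and> odd_var w then - 1 else 1) * (of_int (left_sign w u') * of_int (left_sign v u) :: 'k)"
        by (auto split: if_splits simp flip: of_int_mult)
      let ?l = "of_nat (Poly_Mapping.lookup u v) :: 'k"
      have "lderiv v (gvar w * gmonom u c) = gmonom (Poly_Mapping.single w (Suc 0) + u')
          ((of_int (left_sign v (Poly_Mapping.single w (Suc 0) + u)) * of_int (left_sign w u)) * (?l * c))"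
        using nw assms a vw e by (auto simp: gvar_mult_gmonom lderiv_gmonom lookup_add lookup_single mult_ac)
      also have "\<dots> = (if odd_var v \<and> odd_var w then - 1 else 1) * gmonom (Poly_Mapping.single w (Suc 0) + u')
          (of_int (left_sign w u') * (of_int (left_sign v u) * ?l * c))"
        unfolding s by (auto simp: gmonom_uminus mult_ac)
      also have "gmonom (Poly_Mapping.single w (Suc 0) + u')
          (of_int (left_sign w u') * (of_int (left_sign v u) * ?l * c)) = gvar w * lderiv v (gmonom u c)"
        unfolding R using nw' a' by (auto simp: gvar_mult_gmonom)
      finally show ?thesis using vw by simp
    qed
  qed
qed

definition gsgn_if :: "bool \<Rightarrow> 'k::comm_ring_1 galg \<Rightarrow> 'k galg" where
  "gsgn_if q X = (if q then gsgn X else X)"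

lemma lderiv_gvar_mult: "lderiv v (gvar w * X) = (if v = w then X else 0) +
     gsgn_if (odd_var v) (gvar w) * lderiv v (X :: 'k::comm_ring_1 galg)"
proof (induction X rule: galg_induct)
  case (3 u)
  then show ?case
    by (simp add: lderiv_gvar_mult_gmonom[OF gkeys_admissible] gsgn_if_def gsgn_gvar)
qed (simp_all add: lderiv_add algebra_simps)

lemma lderiv_mult:
  "lderiv v (X * Y) = lderiv v X * Y + gsgn_if (odd_var v) X * lderiv v (Y :: 'k::comm_ring_1 galg)"
proof (induction X rule: galg_var_induct)
  case (mult w X)
  then show ?case
    by (simp add: lderiv_gvar_mult mult.assoc algebra_simps gsgn_if_def gsgn_mult)
qed (simp_all add: lderiv_add gsgn_if_def gsgn_add algebra_simps lderiv_gconst_mult)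

lemma lderiv_gvar: "lderiv v (gvar w) = (if v = w then 1 else (0 :: 'k::comm_ring_1 galg))"
  using lderiv_gvar_mult[of v w "1 :: 'k galg"] by simp

lemma gpar_lderiv: "gpar q X \<Longrightarrow> gpar (q \<noteq> odd_var v) (lderiv v (X :: 'k::comm_ring_1 galg))"
  unfolding gpar_def
proof
  fix w assume q: "\<forall>u\<in>gkeys X. odd (card (odd_part u)) = q" and w: "w \<in> gkeys (lderiv v X)"
  from w obtain u where u: "u \<in> gkeys X" "Poly_Mapping.lookup u v \<noteq> 0" "w = u - Poly_Mapping.single v (Suc 0)"
    by (rule gkeys_lderiv)
  have e: "Poly_Mapping.single v (Suc 0) + w = u" using u by (simp add: single_minus_plus)
  have "card (odd_part u) = card (odd_part (Poly_Mapping.single v (Suc 0))) + card (odd_part w)"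
    unfolding e[symmetric]
    by (rule card_odd_part_add)
      (use gkeys_admissible[OF u(1)] gkeys_admissible[OF w] in \<open>simp_all add: admissible_single e\<close>)
  then show "odd (card (odd_part w)) = (q \<noteq> odd_var v)" using q u(1) by (auto simp: odd_part_single split: if_splits)
qed

lemma lderiv_lderiv:
  "lderiv v (lderiv w X) = (if odd_var v \<and> odd_var w then - lderiv w (lderiv v X)
     else lderiv w (lderiv v (X :: 'k::comm_ring_1 galg)))"
proof (induction X rule: galg_var_induct)
  case (mult z X)
  then show ?case
    by (auto simp: lderiv_gvar_mult lderiv_add lderiv_mult gsgn_if_def gsgn_gvar lderiv_uminus lderiv_gvar algebra_simps)
qed (simp_all add: lderiv_add)

text \<open>Moving an odd \<open>v\<close> to the right instead of the left end costs one sign for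
  each remaining odd variable, that is, the parity of the derivative.\<close>

lemma rderiv_lderiv: "rderiv v X = (if odd_var v then gsgn (lderiv v X) else lderiv v (X :: 'k::comm_ring_1 galg))"
proof (cases "odd_var v")
  case False
  then show ?thesis by (simp add: rderiv_def lderiv_def)
next
  case True
  have s: "gsgn (sum f A) = (\<Sum>a\<in>A. gsgn (f a))" for f :: "gmon \<Rightarrow> 'k galg" and A
    by (induction A rule: infinite_finite_induct) (auto simp: gsgn_add)
  have "gmonom (u - Poly_Mapping.single v 1)
       ((- 1) ^ card {w \<in> odd_part u. var_rank v < var_rank w} * of_nat (Poly_Mapping.lookup u v) * gcoeff X u)
     = gsgn (gmonom (u - Poly_Mapping.single v 1)
       ((- 1) ^ card {w \<in> odd_part u. var_rank w < var_rank v} * of_nat (Poly_Mapping.lookup u v) * gcoeff X u))"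
    if "u \<in> gkeys X" for u
  proof (cases "Poly_Mapping.lookup u v = 0")
    case False
    let ?w = "u - Poly_Mapping.single v (Suc 0)"
    let ?A = "{w \<in> odd_part u. var_rank v < var_rank w}" and ?B = "{w \<in> odd_part u. var_rank w < var_rank v}"
    have lk: "Poly_Mapping.lookup u v = 1"
      using gkeys_admissible[OF that] True False by (force simp: admissible_def)
    have "odd_part ?w = odd_part u - {v}" using lk
      by (auto simp: odd_part_def in_keys_iff lookup_minus lookup_single when_def split: if_splits)
    moreover have "odd_part u - {v} = ?A \<union> ?B"
      by auto (metis linorder_neqE_nat var_rank_eq_iff)
    moreover have "card (?A \<union> ?B) = card ?A + card ?B" by (rule card_Un_disjoint) auto
    ultimately have c: "card (odd_part ?w) = card ?A + card ?B" by simp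
    show ?thesis by (simp add: gsgn_gmonom c lk minus_one_power_iff gmonom_uminus)
  qed simp
  then show ?thesis using True by (simp add: rderiv_def lderiv_def s)
qed

section \<open>Derivations with prescribed values on the variables\<close>

definition gvars :: "'k::comm_ring_1 galg \<Rightarrow> gvariable set" where
  "gvars X = (\<Union>u\<in>gkeys X. Poly_Mapping.keys u)"

lemma finite_gvars [simp]: "finite (gvars X)"
  by (simp add: gvars_def)

lemma subalg_gvars: "X \<in> subalg V \<longleftrightarrow> gvars X \<subseteq> V"
  by (auto simp: subalg_def gvars_def)

lemma lderiv_eq_0: "v \<notin> gvars X \<Longrightarrow> lderiv v X = 0"
  unfolding lderiv_def by (intro sum.neutral) (auto simp: gvars_def in_keys_iff)

lemma lderiv_subalg_0: "X \<in> subalg V \<Longrightarrow> v \<notin> V \<Longrightarrow> lderiv v X = 0"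
  by (rule lderiv_eq_0) (auto simp: subalg_gvars)

text \<open>Summing over the variables of \<open>X\<close> keeps the sum finite;
  \<open>der_superset\<close> enlarges the index set when two elements have to share one.\<close>

definition der :: "(gvariable \<Rightarrow> 'k galg) \<Rightarrow> 'k::comm_ring_1 galg \<Rightarrow> 'k galg" where
  "der g X = (\<Sum>v\<in>gvars X. g v * lderiv v X)"

lemma der_superset:
  assumes "finite V" "X \<in> subalg V"
  shows "der g X = (\<Sum>v\<in>V. g v * lderiv v X)"
  unfolding der_def
  by (rule sum.mono_neutral_left) (use assms in \<open>auto simp: subalg_gvars lderiv_eq_0\<close>)

lemma subalg_gvars_self: "gvars X \<subseteq> V \<Longrightarrow> X \<in> subalg V"
  by (simp add: subalg_gvars)

lemma der_add: "der g (X + Y) = der g X + der g (Y :: 'k::comm_ring_1 galg)"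
proof -
  let ?V = "gvars X \<union> gvars Y"
  have "X \<in> subalg ?V" "Y \<in> subalg ?V" by (auto intro: subalg_gvars_self)
  moreover from this have "X + Y \<in> subalg ?V" by (rule subalg_add)
  ultimately show ?thesis by (simp add: der_superset[of ?V] lderiv_add algebra_simps sum.distrib)
qed

lemma der_0 [simp]: "der g 0 = (0 :: 'k::comm_ring_1 galg)"
  by (simp add: der_def)

lemma der_gconst [simp]: "der g (gconst c) = (0 :: 'k::comm_ring_1 galg)"
  by (simp add: der_def)

lemma der_sum: "der g (sum f A) = (\<Sum>a\<in>A. der g (f a :: 'k::comm_ring_1 galg))"
  by (induction A rule: infinite_finite_induct) (auto simp: der_add)

lemma der_uminus: "der g (- X) = - der g (X :: 'k::comm_ring_1 galg)"
  using der_add[of g X "- X"] by (simp add: eq_neg_iff_add_eq_0 add.commute)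

lemma der_diff: "der g (X - Y) = der g X - der g (Y :: 'k::comm_ring_1 galg)"
  using der_add[of g X "- Y"] by (simp add: der_uminus)

lemma der_gvar [simp]: "der g (gvar v) = (g v :: 'k::comm_ring_1 galg)"
  using der_superset[of "{v}" "gvar v" g] by (simp add: subalg_gvar lderiv_gvar)

lemma der_gconst_mult: "der g (gconst c * X) = gconst c * der g (X :: 'k::comm_ring_1 galg)"
proof -
  have "gconst c * X \<in> subalg (gvars X)" by (intro subalg_gconst_mult subalg_gvars_self) simp
  then have "der g (gconst c * X) = (\<Sum>v\<in>gvars X. g v * lderiv v (gconst c * X))"
    by (intro der_superset) auto
  also have "\<dots> = (\<Sum>v\<in>gvars X. gconst c * (g v * lderiv v X))"
    by (intro sum.cong refl) (metis gconst_commute lderiv_gconst_mult mult.assoc)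
  finally show ?thesis by (simp add: der_def sum_distrib_left)
qed

lemma der_cong: "(\<And>v. v \<in> V \<Longrightarrow> g v = h v) \<Longrightarrow> X \<in> subalg V \<Longrightarrow> der g X = der h (X :: 'k::comm_ring_1 galg)"
  unfolding der_def by (intro sum.cong) (auto simp: subalg_gvars)

text \<open>The values of an odd derivation have the parity opposite to the variable. If
  \<open>v\<close> is odd, the sign comes from the derivative and \<open>g v\<close> commutes; if
  \<open>v\<close> is even, it comes from moving \<open>g v\<close> past \<open>X\<close>. Either
  way the result is \<open>gsgn X\<close>.\<close>

lemma der_mult_odd:
  assumes "X \<in> subalg V" "Y \<in> subalg V" "\<And>v. v \<in> V \<Longrightarrow> gpar (\<not> odd_var v) (g v)"
  shows "der g (X * Y) = der g X * Y + gsgn X * der g (Y :: 'k::comm_ring_1 galg)"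
proof -
  let ?V = "gvars X \<union> gvars Y"
  have V: "?V \<subseteq> V" using assms by (auto simp: subalg_gvars)
  have s: "X \<in> subalg ?V" "Y \<in> subalg ?V" by (auto intro: subalg_gvars_self)
  have "g v * gsgn_if (odd_var v) X = gsgn X * g v" if "v \<in> ?V" for v
  proof (cases "odd_var v")
    case True
    then have "gpar False (g v)" using assms(3)[of v] that V by auto
    with True show ?thesis by (simp add: gsgn_if_def gpar_even_commute)
  next
    case False
    then have "gpar True (g v)" using assms(3)[of v] that V by auto
    with False show ?thesis by (simp add: gsgn_if_def gpar_odd_commute)
  qed
  then have "g v * lderiv v (X * Y) = g v * lderiv v X * Y + gsgn X * (g v * lderiv v Y)" if "v \<in> ?V" for v
    using that by (metis (no_types, lifting) distrib_left lderiv_mult mult.assoc)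
  moreover have "X * Y \<in> subalg ?V" using s by (rule subalg_mult)
  ultimately show ?thesis using s
    by (simp add: der_superset[of ?V] sum.distrib sum_distrib_left sum_distrib_right)
qed

lemma der_mult_even:
  assumes "X \<in> subalg V" "Y \<in> subalg V" "\<And>v. v \<in> V \<Longrightarrow> gpar (odd_var v) (g v)"
  shows "der g (X * Y) = der g X * Y + X * der g (Y :: 'k::comm_ring_1 galg)"
proof -
  let ?V = "gvars X \<union> gvars Y"
  have V: "?V \<subseteq> V" using assms by (auto simp: subalg_gvars)
  have s: "X \<in> subalg ?V" "Y \<in> subalg ?V" by (auto intro: subalg_gvars_self)
  have "g v * gsgn_if (odd_var v) X = X * g v" if "v \<in> ?V" for v
  proof (cases "odd_var v")
    case False
    then have "gpar False (g v)" using assms(3)[of v] that V by auto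
    with False show ?thesis by (simp add: gsgn_if_def gpar_even_commute)
  next
    case True
    then have "gpar True (g v)" using assms(3)[of v] that V by auto
    with True show ?thesis by (simp add: gsgn_if_def gpar_odd_commute)
  qed
  then have "g v * lderiv v (X * Y) = g v * lderiv v X * Y + X * (g v * lderiv v Y)" if "v \<in> ?V" for v
    using that by (metis (no_types, lifting) distrib_left lderiv_mult mult.assoc)
  moreover have "X * Y \<in> subalg ?V" using s by (rule subalg_mult)
  ultimately show ?thesis using s
    by (simp add: der_superset[of ?V] sum.distrib sum_distrib_left sum_distrib_right)
qed

lemma gkeys_der:
  assumes "k \<in> gkeys (der g X :: 'k::comm_ring_1 galg)"
  obtains u v z where "u \<in> gkeys X" "Poly_Mapping.lookup u v \<noteq> 0" "z \<in> gkeys (g v)"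
    "k = z + (u - Poly_Mapping.single v (Suc 0))"
proof -
  from assms have "k \<in> (\<Union>v\<in>gvars X. gkeys (g v * lderiv v X))"
    unfolding der_def by (rule subsetD[OF gkeys_sum_subset])
  then obtain v where v: "k \<in> gkeys (g v * lderiv v X)" by blast
  then obtain z w where zw: "z \<in> gkeys (g v)" "w \<in> gkeys (lderiv v X)" "k = z + w" by (rule gkeys_mult)
  from zw(2) obtain u where "u \<in> gkeys X" "Poly_Mapping.lookup u v \<noteq> 0" "w = u - Poly_Mapping.single v (Suc 0)"
    by (rule gkeys_lderiv)
  then show thesis using zw that by blast
qed

lemma keys_minus_subset: "Poly_Mapping.keys (u - v :: gmon) \<subseteq> Poly_Mapping.keys u"
  by (auto simp: in_keys_iff lookup_minus)

lemma lderiv_subalg: "X \<in> subalg V \<Longrightarrow> lderiv v X \<in> subalg V"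
  unfolding subalg_def using keys_minus_subset by (fastforce elim!: gkeys_lderiv)

lemma lderiv_wspan:
  assumes "X \<in> wspan w E" "\<And>e. e \<in> E \<Longrightarrow> e - w v \<in> F"
  shows "lderiv v (X :: 'k::comm_ring_1 galg) \<in> wspan w F"
  using assms by (auto simp: wspan_def kspan_def mon_weight_minus elim!: gkeys_lderiv)

lemma der_subalg:
  assumes "X \<in> subalg V" "\<And>v. v \<in> V \<Longrightarrow> g v \<in> subalg W" "V \<subseteq> W"
  shows "der g X \<in> subalg W"
proof -
  have "X \<in> subalg W" using assms by (blast intro: subalg_mono)
  moreover have "gvars X \<subseteq> V" using assms(1) by (simp add: subalg_gvars)
  ultimately show ?thesis unfolding der_def using assms(2)
    by (intro subalg_sum subalg_mult lderiv_subalg) auto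
qed

lemma der_wspan:
  assumes "X \<in> subalg V" "X \<in> wspan w E" "\<And>v e. v \<in> V \<Longrightarrow> e \<in> E \<Longrightarrow> g v \<in> wspan w (G v)"
    and "\<And>v e f. v \<in> V \<Longrightarrow> e \<in> E \<Longrightarrow> f \<in> G v \<Longrightarrow> f + (e - w v) \<in> F"
  shows "der g X \<in> wspan w F"
  unfolding wspan_def kspan_def
proof safe
  fix k assume "k \<in> gkeys (der g X)"
  then obtain u v z where u: "u \<in> gkeys X" "Poly_Mapping.lookup u v \<noteq> 0" "z \<in> gkeys (g v)"
    "k = z + (u - Poly_Mapping.single v (Suc 0))" by (rule gkeys_der)
  then have "v \<in> V" using assms(1) by (auto simp: subalg_def subset_iff in_keys_iff)
  moreover have e: "mon_weight w u \<in> E" using u assms(2) by (auto simp: wspan_def kspan_def)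
  moreover have "mon_weight w z \<in> G v" using assms(3)[OF \<open>v \<in> V\<close> e] u by (auto simp: wspan_def kspan_def)
  ultimately show "mon_weight w k \<in> F" using assms(4) u by (auto simp: mon_weight_add mon_weight_minus)
qed

text \<open>Differentiating by \<open>v\<close> and multiplying back scales a monomial by its
  exponent at \<open>v\<close>, and the signs cancel. This is the main term of the contracting
  homotopy below, and it ties \<open>x_homogeneous\<close> to weights of monomials.\<close>

lemma der_euler:
  "der (\<lambda>v. gconst (of_int (c v)) * gvar v) (gmonom u a) = gconst (of_int (mon_weight c u)) * gmonom u (a :: 'k::comm_ring_1)"
proof (cases "admissible u")
  case True
  have 1: "gvar v * lderiv v (gmonom u a) = gmonom u (of_nat (Poly_Mapping.lookup u v) * a)" for v
  proof (cases "Poly_Mapping.lookup u v = 0")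
    case False
    let ?u = "u - Poly_Mapping.single v (Suc 0)"
    have "\<not> (odd_var v \<and> v \<in> odd_part ?u)" using True False
      by (auto simp: odd_part_def in_keys_iff lookup_minus admissible_def)
    moreover have "admissible ?u" using True by (simp add: admissible_minus)
    moreover have "left_sign v u = left_sign v ?u"
    proof -
      have "left_sign v (Poly_Mapping.single v (Suc 0) + ?u) = left_sign v (Poly_Mapping.single v (Suc 0)) * left_sign v ?u"
        by (rule left_sign_add) (use True \<open>admissible ?u\<close> in \<open>simp_all add: single_minus_plus[OF False] admissible_single\<close>)
      then show ?thesis by (simp add: single_minus_plus[OF False] left_sign_single)
    qed
    ultimately show ?thesis using True
      by (auto simp: lderiv_gmonom gvar_mult_gmonom single_minus_plus[OF False] mult.assoc)
  qed (use True in \<open>simp add: lderiv_gmonom\<close>)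
  have "gmonom u a \<in> subalg (Poly_Mapping.keys u)" by (simp add: subalg_gmonom)
  then have "der (\<lambda>v. gconst (of_int (c v)) * gvar v) (gmonom u a)
      = (\<Sum>v\<in>Poly_Mapping.keys u. gconst (of_int (c v)) * (gvar v * lderiv v (gmonom u a)))"
    by (simp add: der_superset[of "Poly_Mapping.keys u"] mult.assoc)
  also have "\<dots> = (\<Sum>v\<in>Poly_Mapping.keys u. gmonom u (of_int (int (Poly_Mapping.lookup u v) * c v) * a))"
    by (simp add: 1 gconst_mult_gmonom mult_ac)
  also have "\<dots> = gmonom u (of_int (mon_weight c u) * a)"
  proof -
    have "(\<Sum>v\<in>A. gmonom u (f v)) = gmonom u (sum f A)" for A and f :: "gvariable \<Rightarrow> 'k"
      by (induction A rule: infinite_finite_induct) (auto simp: gmonom_add)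
    then show ?thesis by (simp add: mon_weight_def flip: sum_distrib_right)
  qed
  finally show ?thesis by (simp add: gconst_mult_gmonom)
qed (simp add: gmonom_not_admissible)

lemma der_euler_homogeneous:
  assumes "X \<in> wspan c {e}"
  shows "der (\<lambda>v. gconst (of_int (c v)) * gvar v) X = gconst (of_int e) * (X :: 'k::comm_ring_1 galg)"
proof (rule galg_induct[where X = X and P = "\<lambda>Z. der (\<lambda>v. gconst (of_int (c v)) * gvar v) Z = gconst (of_int e) * Z"])
  fix u assume "u \<in> gkeys X"
  then have "mon_weight c u = e" using assms by (auto simp: wspan_def kspan_def)
  then show "der (\<lambda>v. gconst (of_int (c v)) * gvar v) (gmonom u (gcoeff X u)) = gconst (of_int e) * gmonom u (gcoeff X u)"
    by (simp add: der_euler)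
qed (simp_all add: der_add algebra_simps)

lemma x_homogeneousI:
  assumes "X \<in> wspan (\<lambda>v. case v of Xvar m i \<Rightarrow> 1 | Xivar m i \<Rightarrow> 0) {e}"
  shows "x_homogeneous e (X :: 'k::comm_ring_1 galg)"
proof -
  let ?c = "\<lambda>v. case v of Xvar m i \<Rightarrow> 1 | Xivar m i \<Rightarrow> (0 :: int)"
  have "euler_x X = (\<Sum>v\<in>gvars X. (gconst (of_int (?c v)) * gvar v) * lderiv v X)"
    unfolding euler_x_def gvars_def[symmetric]
    by (rule sum.mono_neutral_cong_left) (auto split: gvariable.splits)
  also have "\<dots> = gconst (of_int e) * X" using der_euler_homogeneous[OF assms] by (simp add: der_def)
  finally show ?thesis by (simp add: x_homogeneous_def)
qed

subsection \<open>Coefficients with respect to the variables \<open>\<xi>\<close>\<close>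

definition mon_restr :: "gvariable set \<Rightarrow> gmon \<Rightarrow> gmon" where
  "mon_restr V u = (\<Sum>v\<in>Poly_Mapping.keys u \<inter> V. Poly_Mapping.single v (Poly_Mapping.lookup u v))"

lemma lookup_mon_restr [simp]:
  "Poly_Mapping.lookup (mon_restr V u) v = (if v \<in> V then Poly_Mapping.lookup u v else 0)"
proof -
  have "Poly_Mapping.lookup (mon_restr V u) v
      = (\<Sum>x\<in>Poly_Mapping.keys u \<inter> V. if x = v then Poly_Mapping.lookup u v else 0)"
    unfolding mon_restr_def lookup_sum by (intro sum.cong) (auto simp: lookup_single when_def)
  also have "\<dots> = (if v \<in> V then Poly_Mapping.lookup u v else 0)" by (auto simp: in_keys_iff)
  finally show ?thesis .
qed

definition XV :: "gvariable set" where "XV = {Xvar m i | m i. True}"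

lemma XV_simps [simp]: "Xvar m i \<in> XV" "Xivar m i \<notin> XV"
  by (auto simp: XV_def)

definition xi_only :: "gmon \<Rightarrow> bool" where "xi_only u \<longleftrightarrow> Poly_Mapping.keys u \<inter> XV = {}"
definition x_only :: "gmon \<Rightarrow> bool" where "x_only u \<longleftrightarrow> Poly_Mapping.keys u \<subseteq> XV"

lemma x_only_lookup: "x_only u \<Longrightarrow> v \<notin> XV \<Longrightarrow> Poly_Mapping.lookup u v = 0"
  and xi_only_lookup: "xi_only u \<Longrightarrow> v \<in> XV \<Longrightarrow> Poly_Mapping.lookup u v = 0"
  by (auto simp: x_only_def xi_only_def in_keys_iff)

lemma x_only_restr [simp]: "x_only (mon_restr XV u)"
  and xi_only_restr [simp]: "xi_only (mon_restr (- XV) u)"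
  by (auto simp: x_only_def xi_only_def in_keys_iff split: if_splits)

lemma mon_restr_add: "mon_restr XV u + mon_restr (- XV) u = u"
  by (rule poly_mapping_eqI) (simp add: lookup_add)

lemma x_xi_eq:
  assumes "x_only a" "xi_only \<nu>"
  shows "mon_restr XV (a + \<nu>) = a" "mon_restr (- XV) (a + \<nu>) = \<nu>"
  by (rule poly_mapping_eqI; use assms in \<open>auto simp: lookup_add x_only_lookup xi_only_lookup\<close>)+

lemma x_xi_add_eq_iff:
  assumes "x_only a" "xi_only \<nu>" "x_only b" "xi_only \<mu>"
  shows "a + \<nu> = b + \<mu> \<longleftrightarrow> a = b \<and> \<nu> = \<mu>"
  using x_xi_eq[OF assms(1,2)] x_xi_eq[OF assms(3,4)] by metis

lemma x_xi_odd_disjoint: "x_only a \<Longrightarrow> xi_only \<nu> \<Longrightarrow> odd_part a \<inter> odd_part \<nu> = {}"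
  by (auto simp: x_only_def xi_only_def odd_part_def)

lemma x_xi_admissible: "x_only a \<Longrightarrow> xi_only \<nu> \<Longrightarrow> admissible (a + \<nu>) \<longleftrightarrow> admissible a \<and> admissible \<nu>"
  by (metis admissible_add_iff x_xi_odd_disjoint admissible_minus add_diff_cancel_left' add_diff_cancel_right')

lemma admissible_restr: "admissible u \<Longrightarrow> admissible (mon_restr V u)"
  by (auto simp: admissible_def)

text \<open>The sign undoes a reordering: \<open>var_rank\<close> interleaves the two kinds of
  variables, whereas here the \<xi>-monomial is to stand to the right of its coefficient, so that
  \<open>X\<close> is the sum of all \<open>xi_coeff \<nu> X * gmonom \<nu> 1\<close>.\<close>

definition xi_coeff :: "gmon \<Rightarrow> 'k::comm_ring_1 galg \<Rightarrow> 'k galg" where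
  "xi_coeff \<nu> X = (\<Sum>u\<in>{u \<in> gkeys X. mon_restr (- XV) u = \<nu>}.
     gmonom (mon_restr XV u) (of_int (koszul_sign (mon_restr XV u) \<nu>) * gcoeff X u))"

lemma gcoeff_xi_coeff:
  assumes "xi_only \<nu>"
  shows "gcoeff (xi_coeff \<nu> X) a = (if x_only a then of_int (koszul_sign a \<nu>) * gcoeff X (a + \<nu>) else 0)"
proof -
  have "gcoeff (xi_coeff \<nu> X) a = (\<Sum>u\<in>{u \<in> gkeys X. mon_restr (- XV) u = \<nu>}.
     if u = a + \<nu> then (if x_only a then of_int (koszul_sign a \<nu>) * gcoeff X (a + \<nu>) else 0) else 0)"
    unfolding xi_coeff_def gcoeff_sum
  proof (intro sum.cong refl)
    fix u assume "u \<in> {u \<in> gkeys X. mon_restr (- XV) u = \<nu>}"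
    then have u: "admissible u" "u = mon_restr XV u + \<nu>" using gkeys_admissible mon_restr_add by auto
    show "gcoeff (gmonom (mon_restr XV u) (of_int (koszul_sign (mon_restr XV u) \<nu>) * gcoeff X u)) a
      = (if u = a + \<nu> then (if x_only a then of_int (koszul_sign a \<nu>) * gcoeff X (a + \<nu>) else 0) else 0)"
    proof (cases "a = mon_restr XV u")
      case True
      then show ?thesis using u by (simp add: gcoeff_gmonom admissible_restr)
    next
      case False
      then have "u \<noteq> a + \<nu>" using u(2) by auto
      with False show ?thesis by (simp add: gcoeff_gmonom)
    qed
  qed
  also have "\<dots> = (if a + \<nu> \<in> {u \<in> gkeys X. mon_restr (- XV) u = \<nu>}
      then (if x_only a then of_int (koszul_sign a \<nu>) * gcoeff X (a + \<nu>) else 0) else 0)"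
    by (rule sum.delta) simp
  also have "\<dots> = (if x_only a then of_int (koszul_sign a \<nu>) * gcoeff X (a + \<nu>) else 0)"
    using assms by (auto simp: x_xi_eq in_gkeys_iff)
  finally show ?thesis .
qed

lemma xi_coeff_add: "xi_only \<nu> \<Longrightarrow> xi_coeff \<nu> (X + Y) = xi_coeff \<nu> X + xi_coeff \<nu> Y"
  and xi_coeff_diff: "xi_only \<nu> \<Longrightarrow> xi_coeff \<nu> (X - Y) = xi_coeff \<nu> X - xi_coeff \<nu> Y"
  and xi_coeff_0 [simp]: "xi_only \<nu> \<Longrightarrow> xi_coeff \<nu> 0 = 0"
  by (rule galg_eqI; simp add: gcoeff_xi_coeff algebra_simps)+

lemma xi_coeff_sum: "xi_only \<nu> \<Longrightarrow> xi_coeff \<nu> (sum f A) = (\<Sum>a\<in>A. xi_coeff \<nu> (f a))"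
  by (induction A rule: infinite_finite_induct) (auto simp: xi_coeff_add)

lemma gkeys_xi_coeff:
  assumes "xi_only \<nu>" "a \<in> gkeys (xi_coeff \<nu> X)"
  shows "x_only a" "a + \<nu> \<in> gkeys X"
  using assms by (auto simp: in_gkeys_iff gcoeff_xi_coeff split: if_splits)

lemma xi_coeff_subalg:
  assumes "xi_only \<nu>" "X \<in> subalg V"
  shows "xi_coeff \<nu> X \<in> subalg (V \<inter> XV)"
  unfolding subalg_def
proof safe
  fix u v assume u: "u \<in> gkeys (xi_coeff \<nu> X)" and v: "v \<in> Poly_Mapping.keys u"
  from gkeys_xi_coeff[OF assms(1) u] v show "v \<in> XV" by (auto simp: x_only_def)
  from v have "v \<in> Poly_Mapping.keys (u + \<nu>)" by (simp add: in_keys_iff lookup_add)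
  with gkeys_xi_coeff[OF assms(1) u] assms(2) show "v \<in> V" by (auto simp: subalg_def)
qed

lemma xi_coeff_wspan:
  assumes "xi_only \<nu>" "X \<in> wspan w E" "\<And>e. e \<in> E \<Longrightarrow> e - mon_weight w \<nu> \<in> F"
  shows "xi_coeff \<nu> X \<in> wspan w F"
  unfolding wspan_def kspan_def
proof safe
  fix u assume u: "u \<in> gkeys (xi_coeff \<nu> X)"
  from gkeys_xi_coeff[OF assms(1) u] assms(2) have "mon_weight w (u + \<nu>) \<in> E"
    by (auto simp: wspan_def kspan_def)
  from assms(3)[OF this] show "mon_weight w u \<in> F" by (simp add: mon_weight_add)
qed

text \<open>An exponent splits uniquely into its x-part and its \<xi>-part. This is the independence
  of the \<xi>-monomials over the polynomials in the x; \<open>xi_coeff_expand\<close> shows that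
  they generate.\<close>

lemma xi_coeff_basis:
  assumes "xi_only \<nu>" "xi_only \<mu>" "admissible \<mu>" "s \<in> subalg XV"
  shows "xi_coeff \<nu> (s * gmonom \<mu> 1) = (if \<nu> = \<mu> then s else 0)"
proof (rule galg_induct[where X = s and P = "\<lambda>s. xi_coeff \<nu> (s * gmonom \<mu> 1) = (if \<nu> = \<mu> then s else 0)"])
  fix u assume u: "u \<in> gkeys s"
  then have a: "admissible u" "x_only u" using assms(4) gkeys_admissible by (auto simp: subalg_def x_only_def)
  let ?k = "of_int (koszul_sign u \<mu>) :: 'a"
  have k: "?k * ?k = 1"
    using koszul_sign_sq[OF x_xi_odd_disjoint[OF a(2) assms(2)]] by (metis of_int_1 of_int_mult)
  show "xi_coeff \<nu> (gmonom u (gcoeff s u) * gmonom \<mu> 1) = (if \<nu> = \<mu> then gmonom u (gcoeff s u) else 0)"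
  proof (rule galg_eqI)
    fix b
    show "gcoeff (xi_coeff \<nu> (gmonom u (gcoeff s u) * gmonom \<mu> 1)) b
        = gcoeff (if \<nu> = \<mu> then gmonom u (gcoeff s u) else 0) b"
    proof (cases "x_only b \<and> b + \<nu> = u + \<mu>")
      case True
      then have "b = u" "\<nu> = \<mu>" using x_xi_add_eq_iff assms a by metis+
      then show ?thesis using a assms k
        by (simp add: gmonom_mult gcoeff_xi_coeff gcoeff_gmonom x_xi_admissible flip: mult.assoc)
    next
      case False
      then show ?thesis using a assms
        by (auto simp: gmonom_mult gcoeff_xi_coeff gcoeff_gmonom)
    qed
  qed
qed (use assms in \<open>auto simp: distrib_right xi_coeff_add\<close>)

lemma xi_coeff_expand:
  assumes "finite N" "mon_restr (- XV) ` gkeys X \<subseteq> N" "\<And>\<nu>. \<nu> \<in> N \<Longrightarrow> xi_only \<nu>"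
  shows "(\<Sum>\<nu>\<in>N. xi_coeff \<nu> X * gmonom \<nu> 1) = (X :: 'k::comm_ring_1 galg)"
proof (rule galg_induct[where X = X and P = "\<lambda>X. (\<Sum>\<nu>\<in>N. xi_coeff \<nu> X * gmonom \<nu> 1) = X"])
  fix u assume u: "u \<in> gkeys X"
  let ?a = "mon_restr XV u" and ?m = "mon_restr (- XV) u"
  have a: "admissible ?a" "admissible ?m" "admissible (?a + ?m)"
    using gkeys_admissible[OF u] by (simp_all add: admissible_restr mon_restr_add)
  have eq: "gmonom u (gcoeff X u) = gmonom ?a (of_int (koszul_sign ?a ?m) * gcoeff X u) * gmonom ?m 1"
  proof -
    let ?k = "of_int (koszul_sign ?a ?m) :: 'k"
    have k: "?k * ?k = 1"
      using koszul_sign_sq_adm[OF a] by (metis of_int_1 of_int_mult)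
    show ?thesis using a by (simp add: gmonom_mult mon_restr_add k flip: mult.assoc)
  qed
  have "gmonom ?a (of_int (koszul_sign ?a ?m) * gcoeff X u) \<in> subalg XV"
    using x_only_restr by (intro subalg_gmonom) (simp add: x_only_def)
  then have "xi_coeff \<nu> (gmonom u (gcoeff X u)) * gmonom \<nu> 1 = (if \<nu> = ?m then gmonom u (gcoeff X u) else 0)"
    if "\<nu> \<in> N" for \<nu>
    using that assms(3) a by (subst eq, subst xi_coeff_basis) (auto simp: eq)
  then show "(\<Sum>\<nu>\<in>N. xi_coeff \<nu> (gmonom u (gcoeff X u)) * gmonom \<nu> 1) = gmonom u (gcoeff X u)"
    using assms u by auto
qed (use assms in \<open>auto simp: xi_coeff_add distrib_right sum.distrib\<close>)

lemma xi_coeff_expand_self: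
  "(\<Sum>\<nu>\<in>mon_restr (- XV) ` gkeys X. xi_coeff \<nu> X * gmonom \<nu> 1) = X"
  by (rule xi_coeff_expand) auto

lemma xi_coeff_outside: "xi_only \<nu> \<Longrightarrow> \<nu> \<notin> mon_restr (- XV) ` gkeys X \<Longrightarrow> xi_coeff \<nu> X = 0"
  unfolding xi_coeff_def by (intro sum.neutral) auto

lemma gkeys_restr_admissible: "\<nu> \<in> mon_restr V ` gkeys X \<Longrightarrow> admissible \<nu>"
  by (auto simp: admissible_restr gkeys_admissible)

lemma xi_coeff_mult_left:
  assumes "xi_only \<nu>" "r \<in> subalg XV"
  shows "xi_coeff \<nu> (r * X) = r * xi_coeff \<nu> X"
proof -
  let ?N = "mon_restr (- XV) ` gkeys X"
  have N: "xi_only \<mu>" "admissible \<mu>" if "\<mu> \<in> ?N" for \<mu> using that gkeys_restr_admissible by auto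
  have cX: "xi_coeff \<mu> X \<in> subalg XV" if "\<mu> \<in> ?N" for \<mu>
    using xi_coeff_subalg[of \<mu> X UNIV] N that by simp
  have *: "xi_coeff \<nu> (r * X) = (\<Sum>\<mu>\<in>?N. if \<nu> = \<mu> then r * xi_coeff \<mu> X else 0)"
  proof -
    have "r * X = (\<Sum>\<mu>\<in>?N. (r * xi_coeff \<mu> X) * gmonom \<mu> 1)"
      by (subst (1) xi_coeff_expand_self[of X, symmetric]) (simp add: sum_distrib_left mult.assoc)
    then have "xi_coeff \<nu> (r * X) = (\<Sum>\<mu>\<in>?N. xi_coeff \<nu> ((r * xi_coeff \<mu> X) * gmonom \<mu> 1))"
      using assms by (simp add: xi_coeff_sum)
    also have "\<dots> = (\<Sum>\<mu>\<in>?N. if \<nu> = \<mu> then r * xi_coeff \<mu> X else 0)"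
      using assms N cX by (intro sum.cong refl xi_coeff_basis) (auto intro: subalg_mult)
    finally show ?thesis .
  qed
  show ?thesis
  proof (cases "\<nu> \<in> ?N")
    case True then show ?thesis unfolding * by simp
  next
    case False
    then show ?thesis unfolding * using assms xi_coeff_outside[of \<nu> X] by simp
  qed
qed

section \<open>Constant and linear coefficients\<close>

lemma gproj_hom:
  assumes "\<And>u v. P (u + v) \<longleftrightarrow> P u \<and> P v"
  shows "gproj P (X * Y) = gproj P X * gproj P (Y :: 'k::comm_ring_1 galg)"
proof (induction X rule: galg_induct)
  case (3 u)
  let ?M = "gmonom u (gcoeff X u)"
  show ?case
  proof (cases "P u")
    case True
    then have "gproj P (?M * Y) = ?M * gproj P Y"
      using gkeys_gmonom[of u "gcoeff X u"] by (intro gproj_mult_left) (auto simp: assms)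
    then show ?thesis using True by (simp add: gproj_gmonom)
  next
    case False
    have "gproj P (?M * Y) = 0"
      using False gkeys_gmonom[of u "gcoeff X u"] by (intro gproj_none) (auto simp: assms elim!: gkeys_mult)
    then show ?thesis using False by (simp add: gproj_gmonom)
  qed
qed (auto simp: gproj_add distrib_right)

lemma gcoeff_mult_0: "gcoeff (X * Y) 0 = gcoeff X 0 * (gcoeff Y 0 :: 'k::comm_ring_1)"
proof -
  have add0: "u + v = 0 \<longleftrightarrow> u = 0 \<and> v = 0" for u v :: gmon
    by (auto simp: poly_mapping_eq_iff fun_eq_iff lookup_add)
  have "gproj ((=) 0) Z = gconst (gcoeff Z 0)" for Z :: "'k galg"
    by (rule galg_eqI) (auto simp: gcoeff_gconst)
  then have "gconst (gcoeff (X * Y) 0) = gconst (gcoeff X 0) * gconst (gcoeff Y 0)"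
    using gproj_hom[of "(=) 0" X Y] add0 by (metis (no_types, lifting))
  then have "gcoeff (gconst (gcoeff (X * Y) 0)) 0 = gcoeff (gconst (gcoeff X 0) * gconst (gcoeff Y 0)) 0" by simp
  then show ?thesis by (simp add: gcoeff_gconst)
qed

lemma gcoeff_gsgn_0 [simp]: "gcoeff (gsgn X) 0 = gcoeff X 0"
  by (simp add: gcoeff_gsgn)

lemma single_Suc_neq_0: "Poly_Mapping.single v (Suc 0) \<noteq> (0 :: gmon)"
  by (metis lookup_single_eq lookup_zero nat.simps(3))

lemma gcoeff_gvar: "gcoeff (gvar v) u = (if u = Poly_Mapping.single v (Suc 0) then 1 else (0 :: 'k::comm_ring_1))"
  by (simp add: gvar_def gcoeff_gmonom admissible_single)

lemma gcoeff_gvar_0 [simp]: "gcoeff (gvar v) 0 = (0 :: 'k::comm_ring_1)"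
  using single_Suc_neq_0[of v] by (auto simp: gcoeff_gvar)

text \<open>Reading linear coefficients as constant terms of derivatives turns the product rule and
  the multiplicativity of constant terms into a rule for linear coefficients of products.\<close>

lemma gcoeff_lderiv_0: "gcoeff (lderiv v X) 0 = (gcoeff X (Poly_Mapping.single v (Suc 0)) :: 'k::comm_ring_1)"
proof (induction X rule: galg_induct)
  case (3 u)
  show ?case
  proof (cases "u = Poly_Mapping.single v (Suc 0)")
    case True
    then show ?thesis by (simp add: lderiv_gmonom gcoeff_gmonom admissible_single left_sign_single admissible_0)
  next
    case False
    then have "\<not> (Poly_Mapping.lookup u v \<noteq> 0 \<and> u - Poly_Mapping.single v (Suc 0) = 0)"
      using single_minus_plus[of u v] by auto
    then show ?thesis using False 3 by (auto simp: lderiv_gmonom gcoeff_gmonom gkeys_admissible)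
  qed
qed (simp_all add: lderiv_add)

lemma gcoeff_mult_single: "gcoeff (X * Y) (Poly_Mapping.single v (Suc 0))
   = gcoeff X (Poly_Mapping.single v (Suc 0)) * gcoeff Y 0 + gcoeff X 0 * (gcoeff Y (Poly_Mapping.single v (Suc 0)) :: 'k::comm_ring_1)"
  by (simp add: lderiv_mult gcoeff_mult_0 gsgn_if_def flip: gcoeff_lderiv_0)

lemma subalg_gcoeff_single: "X \<in> subalg V \<Longrightarrow> v \<notin> V \<Longrightarrow> gcoeff X (Poly_Mapping.single v (Suc 0)) = 0"
  by (metis gcoeff_lderiv_0 lderiv_subalg_0 gcoeff_0)

lemma gcoeff_der_0:
  assumes "X \<in> subalg V" "\<And>v. v \<in> V \<Longrightarrow> gcoeff (g v) 0 = 0"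
  shows "gcoeff (der g X) 0 = (0 :: 'k::comm_ring_1)"
  unfolding der_def gcoeff_sum gcoeff_mult_0 using assms by (auto simp: subalg_gvars intro!: sum.neutral)

text \<open>A chain rule at the origin: when the values have no constant term, the linear part of
  \<open>der g X\<close> depends only on the linear parts of \<open>X\<close> and of the values. The
  minimality arguments compare these linear parts.\<close>

lemma gcoeff_der_single:
  assumes "X \<in> subalg V" "finite V" "\<And>v. v \<in> V \<Longrightarrow> gcoeff (g v) 0 = 0"
  shows "gcoeff (der g X) (Poly_Mapping.single w (Suc 0)) =
     (\<Sum>v\<in>V. gcoeff (g v) (Poly_Mapping.single w (Suc 0)) * (gcoeff X (Poly_Mapping.single v (Suc 0)) :: 'k::comm_ring_1))"
  unfolding der_superset[OF assms(2,1)] gcoeff_sum gcoeff_mult_single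
  using assms(3) by (intro sum.cong) (auto simp: gcoeff_lderiv_0)

lemma even_cdeg_iff: "even (cdeg_var v) \<longleftrightarrow> \<not> odd_var v"
  by (simp add: odd_var_def)

subsection \<open>Minimal models\<close>

lemma gproj_cong: "(\<And>u. u \<in> gkeys X \<Longrightarrow> P u \<longleftrightarrow> Q u) \<Longrightarrow> gproj P X = gproj Q X"
  by (rule galg_eqI) (auto simp: in_gkeys_iff)

lemma mon_weight_nonneg: "(\<And>v. v \<in> Poly_Mapping.keys u \<Longrightarrow> w v \<ge> 0) \<Longrightarrow> mon_weight w u \<ge> 0"
  unfolding mon_weight_def by (intro sum_nonneg) auto

locale minimal_model =
  fixes n :: nat and J :: "nat \<Rightarrow> nat set" and wt :: "nat \<Rightarrow> nat \<Rightarrow> int"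
    and d :: "'k::field_char_0 galg \<Rightarrow> 'k galg" and I :: "'k galg set"
  assumes mm: "is_minimal_model n J wt d I"
    and ideal: "is_S_ideal n I"
    and quad: "generated_by_quadrics n I"
begin

definition Rv :: "gvariable set" where "Rv = {Xvar m i | m i. i \<in> J m}"
definition Sv :: "gvariable set" where "Sv = {Xvar 0 i | i. i \<in> {1..n}}"

lemma R_alg_eq: "R_alg J = subalg Rv"
  by (simp add: R_alg_def Rv_def)

lemma S_alg_eq: "S_alg n = subalg Sv"
  by (simp add: S_alg_def Sv_def)

lemma res: "is_resolvent n J wt d I"
  using mm by (simp add: is_minimal_model_def)

lemma sf: "is_semifree_dga n J wt d"
  using res by (simp add: is_resolvent_def)

lemma J0: "J 0 = {1..n}" and finite_J [simp]: "finite (J m)" and wt0: "i \<in> J 0 \<Longrightarrow> wt 0 i = 1"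
  using sf unfolding is_semifree_dga_def by auto

lemma d_R: "a \<in> R_alg J \<Longrightarrow> d a \<in> R_alg J"
  and d_add: "a \<in> R_alg J \<Longrightarrow> b \<in> R_alg J \<Longrightarrow> d (a + b) = d a + d b"
  and d_S_mult: "s \<in> S_alg n \<Longrightarrow> a \<in> R_alg J \<Longrightarrow> d (s * a) = s * d a"
  and d_coh: "a \<in> R_alg J \<Longrightarrow> homogeneous cdeg_var e a \<Longrightarrow> homogeneous cdeg_var (e + 1) (d a)"
  and d_leibniz: "a \<in> R_alg J \<Longrightarrow> b \<in> R_alg J \<Longrightarrow> homogeneous cdeg_var e a \<Longrightarrow>
        d (a * b) = d a * b + (if even e then a * d b else - (a * d b))"
  and d_d: "a \<in> R_alg J \<Longrightarrow> d (d a) = 0"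
  and d_level: "m \<ge> 1 \<Longrightarrow> i \<in> J m \<Longrightarrow> d (gvar (Xvar m i)) \<in> R_le J (m - 1)"
  and d_int: "a \<in> R_alg J \<Longrightarrow> homogeneous (int_weight wt) e' a \<Longrightarrow> homogeneous (int_weight wt) e' (d a)"
  using sf unfolding is_semifree_dga_def by blast+

lemma proj_d_I: "X \<in> R_alg J \<Longrightarrow> proj_S n (d X) \<in> I"
  and R_exact: "X \<in> R_alg J \<Longrightarrow> d X = 0 \<Longrightarrow> proj_S n X \<in> I \<Longrightarrow> \<exists>Y\<in>R_alg J. d Y = X"
  using res unfolding is_resolvent_def by blast+

lemma Sv_Rv: "Sv \<subseteq> Rv" by (auto simp: Sv_def Rv_def J0)
lemma Rv_XV: "Rv \<subseteq> XV" by (auto simp: Rv_def XV_def)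
lemma S_R: "s \<in> S_alg n \<Longrightarrow> s \<in> R_alg J"
  unfolding S_alg_eq R_alg_eq using Sv_Rv by (blast intro: subalg_mono)

lemma d_0 [simp]: "d 0 = 0"
  using d_add[of 0 0] by (simp add: R_alg_eq)

lemma d_1 [simp]: "d 1 = 0"
proof -
  have "homogeneous cdeg_var 0 (1 :: 'k galg)"
    using gkeys_gmonom[of 0 "1 :: 'k"] by (auto simp: homogeneous_def one_galg_def)
  then have "d (1 * 1) = d 1 * 1 + 1 * d 1" using d_leibniz[of 1 1 0] by (simp add: R_alg_eq)
  then show ?thesis by simp
qed

lemma d_S: "s \<in> S_alg n \<Longrightarrow> d s = 0"
  using d_S_mult[of s 1] by (simp add: R_alg_eq)

text \<open>The Leibniz rule of the definition asks for a homogeneous left factor; monomials are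
  homogeneous, and \<open>gsgn\<close> absorbs the sign.\<close>

lemma d_mult: "a \<in> R_alg J \<Longrightarrow> b \<in> R_alg J \<Longrightarrow> d (a * b) = d a * b + gsgn a * d b"
proof -
  assume a: "a \<in> R_alg J" and b: "b \<in> R_alg J"
  have "a \<in> R_alg J \<and> d (a * b) = d a * b + gsgn a * d b"
  proof (rule galg_induct[where X = a and P = "\<lambda>a. a \<in> R_alg J \<and> d (a * b) = d a * b + gsgn a * d b"])
    fix u assume u: "u \<in> gkeys a"
    then have R: "gmonom u (gcoeff a u) \<in> R_alg J"
      using a by (auto simp: R_alg_eq subalg_def intro!: subalg_gmonom[unfolded subalg_def, simplified])
    have "homogeneous cdeg_var (mon_weight cdeg_var u) (gmonom u (gcoeff a u))"
      using gkeys_gmonom[of u "gcoeff a u"] by (auto simp: homogeneous_def)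
    from d_leibniz[OF R b this] R show "gmonom u (gcoeff a u) \<in> R_alg J \<and>
       d (gmonom u (gcoeff a u) * b) = d (gmonom u (gcoeff a u)) * b + gsgn (gmonom u (gcoeff a u)) * d b"
      using even_mon_weight_cdeg[OF gkeys_admissible[OF u] even_cdeg_iff] by (simp add: gsgn_gmonom)
  next
    fix X Y assume "X \<in> R_alg J \<and> d (X * b) = d X * b + gsgn X * d b" "Y \<in> R_alg J \<and> d (Y * b) = d Y * b + gsgn Y * d b"
    then show "X + Y \<in> R_alg J \<and> d ((X + Y) * b) = d (X + Y) * b + gsgn (X + Y) * d b"
      using b by (auto simp: distrib_right d_add R_alg_eq subalg_add subalg_mult gsgn_add distrib_left)
  qed (simp_all add: R_alg_eq)
  then show ?thesis ..
qed

text \<open>Being zero outside \<open>Rv\<close>, in particular on every \<xi>, lets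
  \<open>der gd\<close> serve both as \<partial> on R and as its extension to
  multiderivations.\<close>

definition gd :: "gvariable \<Rightarrow> 'k galg" where
  "gd v = (if v \<in> Rv then d (gvar v) else 0)"

lemma gd_Xvar: "i \<in> J m \<Longrightarrow> gd (Xvar m i) = d (gvar (Xvar m i))"
  by (auto simp: gd_def Rv_def)

lemma gd_not_R: "v \<notin> Rv \<Longrightarrow> gd v = 0"
  by (simp add: gd_def)

lemma gd_Xivar [simp]: "gd (Xivar m i) = 0"
  by (auto simp: gd_def Rv_def)

lemma gd_R: "gd v \<in> R_alg J"
  by (auto simp: gd_def R_alg_eq[symmetric] intro!: d_R) (auto simp: R_alg_eq subalg_gvar)

lemma homogeneous_gvar: "homogeneous w (w v) (gvar v :: 'k galg)"
  using gkeys_gmonom[of "Poly_Mapping.single v (Suc 0)" "1 :: 'k"]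
  by (fastforce simp: homogeneous_def gvar_def dest: subsetD)

lemma gd_cdeg: "gd v \<in> wspan cdeg_var {cdeg_var v + 1}"
  using d_coh[OF _ homogeneous_gvar, of v] by (auto simp: gd_def homogeneous_wspan R_alg_eq subalg_gvar)

lemma gd_int: "gd v \<in> wspan (int_weight wt) {int_weight wt v}"
  using d_int[OF _ homogeneous_gvar, of v] by (auto simp: gd_def homogeneous_wspan R_alg_eq subalg_gvar)

lemma gpar_gd: "gpar (\<not> odd_var v) (gd v)"
  using homogeneous_gpar[OF gd_cdeg even_cdeg_iff, of v] by (simp add: even_cdeg_iff)

lemma gd_Xvar_0 [simp]: "gd (Xvar 0 i) = 0"
  by (auto simp: gd_def Rv_def J0 S_alg_eq Sv_def subalg_gvar intro!: d_S)

definition Rlv :: "nat \<Rightarrow> gvariable set" where "Rlv r = {Xvar m i | m i. m < r \<and> i \<in> J m}"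

lemma R_le_eq: "R_le J r = subalg (Rlv (Suc r))"
  by (simp add: R_le_def Rlv_def less_Suc_eq_le)

lemma gd_level: "gd (Xvar m i) \<in> subalg (Rlv m)"
proof (cases "m = 0")
  case False
  then show ?thesis using d_level[of m i] by (auto simp: gd_def Rv_def R_le_eq)
qed simp

lemma d_eq_der: "X \<in> R_alg J \<Longrightarrow> d X = der gd X"
  unfolding R_alg_eq
proof (induction X rule: subalg_induct)
  case (add X Y)
  then show ?case by (simp add: d_add R_alg_eq der_add)
next
  case (const c)
  then show ?case by (simp add: d_S S_alg_eq)
next
  case (mult v X)
  then have "(gvar v :: 'k galg) \<in> subalg Rv" by (simp add: subalg_gvar)
  moreover from this mult have "der gd (gvar v * X) = der gd (gvar v) * X + gsgn (gvar v) * der gd X"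
    by (intro der_mult_odd[of _ Rv] gpar_gd)
  moreover have "gd v = d (gvar v)" using mult by (simp add: gd_def)
  ultimately show ?case using mult by (simp add: d_mult R_alg_eq)
qed

lemma gcoeff_aug_ideal_sq:
  assumes "X \<in> aug_ideal_sq J"
  shows "gcoeff X 0 = 0" "gcoeff X (Poly_Mapping.single v (Suc 0)) = 0"
  using assms by (auto simp: aug_ideal_sq_def aug_ideal_def gcoeff_sum gcoeff_mult_0 gcoeff_mult_single intro!: sum.neutral)

lemma gd_eps [simp]: "gcoeff (gd v) 0 = 0"
proof (cases "v \<in> Rv")
  case True
  then obtain m i where v: "v = Xvar m i" "i \<in> J m" by (auto simp: Rv_def)
  consider "m = 0" | "m = 1" | "m \<ge> 2" by linarith
  then show ?thesis
  proof cases
    case 2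
    then have "gd v \<in> S_ideal_gen n {gvar (Xvar 0 i) | i. i \<in> {1..n}}"
      using mm v by (auto simp: is_minimal_model_def gd_Xvar)
    then obtain Q c where "gd v = (\<Sum>q\<in>Q. c q * q)" "Q \<subseteq> {gvar (Xvar 0 i) | i. i \<in> {1..n}}"
      by (auto simp: S_ideal_gen_def)
    moreover from this have "gcoeff q 0 = 0" if "q \<in> Q" for q using that by auto
    ultimately show ?thesis by (simp add: gcoeff_sum gcoeff_mult_0)
  next
    case 3
    then have "gd v \<in> aug_ideal_sq J" using mm v by (auto simp: is_minimal_model_def gd_Xvar)
    then show ?thesis by (rule gcoeff_aug_ideal_sq)
  qed (simp add: v)
qed (simp add: gd_not_R)

text \<open>From level 2 on \<partial>x is decomposable, and on level 1 it lies in S. Level 0 is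
  excluded because minimality puts \<partial> of a level 1 variable only into the maximal ideal of
  S, which contains linear forms.\<close>

lemma gd_lin: "m \<ge> 1 \<Longrightarrow> gcoeff (gd v) (Poly_Mapping.single (Xvar m i) (Suc 0)) = 0"
proof (cases "v \<in> Rv")
  case True
  assume m: "m \<ge> 1"
  from True obtain r j where v: "v = Xvar r j" "j \<in> J r" by (auto simp: Rv_def)
  show ?thesis
  proof (cases "r \<ge> 2")
    case True
    then have "gd v \<in> aug_ideal_sq J" using mm v by (auto simp: is_minimal_model_def gd_Xvar)
    then show ?thesis by (rule gcoeff_aug_ideal_sq)
  next
    case False
    have "gd v \<in> subalg (Rlv r)" unfolding v by (rule gd_level)
    then show ?thesis by (rule subalg_gcoeff_single) (use False m in \<open>auto simp: Rlv_def\<close>)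
  qed
qed (simp add: gd_not_R)

lemma d_lin: "m \<ge> 1 \<Longrightarrow> X \<in> R_alg J \<Longrightarrow> gcoeff (d X) (Poly_Mapping.single (Xvar m i) (Suc 0)) = 0"
  using gcoeff_der_single[of X "gvars X" gd "Xvar m i"] by (simp add: d_eq_der gd_lin subalg_gvars)

section \<open>The projection to S and the ideal I\<close>

lemma proj_S_gproj: "proj_S n = gproj (\<lambda>u. Poly_Mapping.keys u \<subseteq> Sv)"
  by (simp add: fun_eq_iff proj_S_def gproj_def Sv_def)

lemma proj_S_mult: "proj_S n (X * Y) = proj_S n X * proj_S n (Y :: 'k galg)"
proof -
  have "Poly_Mapping.keys (u + v) \<subseteq> Sv \<longleftrightarrow> Poly_Mapping.keys u \<subseteq> Sv \<and> Poly_Mapping.keys v \<subseteq> Sv" for u v :: gmon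
    by (auto simp: in_keys_iff lookup_add subset_iff)
  then show ?thesis unfolding proj_S_gproj by (rule gproj_hom)
qed

lemma proj_S_S: "proj_S n X \<in> S_alg n"
  by (auto simp: proj_S_gproj S_alg_eq subalg_def gkeys_gproj)

lemma proj_S_id: "s \<in> S_alg n \<Longrightarrow> proj_S n s = s"
  unfolding proj_S_gproj by (rule gproj_id) (auto simp: S_alg_eq subalg_def)

lemmas proj_S_linear = gproj_add[of "\<lambda>u. Poly_Mapping.keys u \<subseteq> Sv", folded proj_S_gproj]
  gproj_diff[of "\<lambda>u. Poly_Mapping.keys u \<subseteq> Sv", folded proj_S_gproj]
  gproj_sum[of "\<lambda>u. Poly_Mapping.keys u \<subseteq> Sv", folded proj_S_gproj]
  gproj_gconst_mult[of "\<lambda>u. Poly_Mapping.keys u \<subseteq> Sv", folded proj_S_gproj]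

lemma proj_S_0 [simp]: "proj_S n 0 = (0 :: 'k galg)"
  by (simp add: proj_S_gproj)

lemma odd_part_Sv: "Poly_Mapping.keys u \<subseteq> Sv \<Longrightarrow> odd_part u = {}"
  by (auto simp: odd_part_def Sv_def odd_var_def)

lemma proj_S_gsgn: "proj_S n (gsgn X) = proj_S n (X :: 'k galg)"
  by (rule galg_eqI) (auto simp: proj_S_gproj gcoeff_gsgn odd_part_Sv)

lemma I_S: "s \<in> I \<Longrightarrow> s \<in> S_alg n"
  and I_0 [simp]: "0 \<in> I"
  and I_add: "s \<in> I \<Longrightarrow> t \<in> I \<Longrightarrow> s + t \<in> I"
  and I_mult: "x \<in> S_alg n \<Longrightarrow> s \<in> I \<Longrightarrow> x * s \<in> I"
  using ideal by (auto simp: is_S_ideal_def)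

lemma I_uminus: "s \<in> I \<Longrightarrow> - s \<in> I"
  using I_mult[of "gconst (-1)" s] subalg_gconst[of "-1" Sv] by (simp add: S_alg_eq gconst_uminus del: subalg_gconst)

lemma I_diff: "s \<in> I \<Longrightarrow> t \<in> I \<Longrightarrow> s - t \<in> I"
  using I_add[of s "- t"] I_uminus[of t] by simp

lemma S_commute: "s \<in> S_alg n \<Longrightarrow> s * X = X * (s :: 'k galg)"
  by (rule gpar_even_commute) (auto simp: gpar_def S_alg_eq subalg_def odd_part_Sv)

lemma I_deg: assumes "s \<in> I" "u \<in> gkeys s" shows "mon_weight (\<lambda>_. 1) u \<ge> 2"
proof -
  obtain Q where Q: "Q \<subseteq> S_deg n 2" "I = S_ideal_gen n Q" using quad by (auto simp: generated_by_quadrics_def)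
  then obtain Q' c where s: "s = (\<Sum>q\<in>Q'. c q * q)" "Q' \<subseteq> Q" using assms by (auto simp: S_ideal_gen_def)
  then obtain q where q: "q \<in> Q'" "u \<in> gkeys (c q * q)" using assms(2) gkeys_sum_subset by blast
  then obtain a b where ab: "b \<in> gkeys q" "u = a + b" by (auto elim: gkeys_mult)
  have "mon_weight (\<lambda>_. 1) b = 2" using ab q s Q by (auto simp: S_deg_def homogeneous_def)
  moreover have "mon_weight (\<lambda>_. 1) a \<ge> 0" by (rule mon_weight_nonneg) simp
  ultimately show ?thesis using ab by (simp add: mon_weight_add)
qed

lemma I_gproj: assumes "s \<in> I" shows "gproj (\<lambda>u. mon_weight (\<lambda>_. 1) u = f) s \<in> I"
proof -
  obtain Q where Q: "Q \<subseteq> S_deg n 2" "I = S_ideal_gen n Q" using quad by (auto simp: generated_by_quadrics_def)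
  then obtain Q' c where s: "s = (\<Sum>q\<in>Q'. c q * q)" "Q' \<subseteq> Q" "finite Q'" "\<forall>q\<in>Q'. c q \<in> S_alg n"
    using assms by (auto simp: S_ideal_gen_def)
  have "gproj (\<lambda>u. mon_weight (\<lambda>_. 1) u = f) (c q * q) = gproj (\<lambda>u. mon_weight (\<lambda>_. 1) u = f - 2) (c q) * q"
    if "q \<in> Q'" for q
    using that s Q by (intro gproj_mult_right) (auto simp: mon_weight_add S_deg_def homogeneous_def)
  then have e: "gproj (\<lambda>u. mon_weight (\<lambda>_. 1) u = f) s
     = (\<Sum>q\<in>Q'. gproj (\<lambda>u. mon_weight (\<lambda>_. 1) u = f - 2) (c q) * q)"
    unfolding s gproj_sum by (intro sum.cong) auto
  show ?thesis unfolding e Q(2) S_ideal_gen_def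
    using s by (auto simp: S_alg_eq intro!: exI[of _ Q'] exI[of _ "\<lambda>q. gproj (\<lambda>u. mon_weight (\<lambda>_. 1) u = f - 2) (c q)"] gproj_subalg)
qed

text \<open>The S-part of a primitive is closed and can be subtracted. The normalised primitive lies
  in the kernel of the projection to S, which will place it in \<open>NN\<close>.\<close>

lemma R_exact':
  assumes "X \<in> R_alg J" "d X = 0" "proj_S n X \<in> I"
  shows "\<exists>Y\<in>R_alg J. d Y = X \<and> proj_S n Y = 0"
proof -
  obtain Y where Y: "Y \<in> R_alg J" "d Y = X" using R_exact assms by blast
  have S: "proj_S n Y \<in> R_alg J" by (intro S_R proj_S_S)
  have "Y - proj_S n Y \<in> R_alg J" using Y S by (simp add: R_alg_eq subalg_diff)
  moreover have "d (Y - proj_S n Y) = X"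
    using d_add[OF calculation S] Y d_S[OF proj_S_S] by simp
  moreover have "proj_S n (Y - proj_S n Y) = 0" by (simp add: proj_S_linear proj_S_id proj_S_S)
  ultimately show ?thesis by blast
qed

end

subsection \<open>The acyclic closure\<close>

text \<open>\<open>P m\<close> looks only at the values up to \<open>m\<close>, so the tentative
  values beyond \<open>m\<close> during the construction do no harm. Both the lifts
  \<open>yy\<close> and the sequence \<pi> refer to all earlier choices.\<close>

lemma dependent_choice_below:
  fixes P :: "nat \<Rightarrow> (nat \<Rightarrow> 'a) \<Rightarrow> bool"
  assumes step: "\<And>m f. (\<And>l. l < m \<Longrightarrow> P l f) \<Longrightarrow> \<exists>x. P m (f(m := x))"
    and local: "\<And>m f g. (\<And>l. l \<le> m \<Longrightarrow> f l = g l) \<Longrightarrow> P m f \<Longrightarrow> P m g"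
  shows "\<exists>f. \<forall>m. P m f"
proof -
  define F where "F = rec_nat (\<lambda>_. undefined) (\<lambda>m f. f(m := SOME x. P m (f(m := x))))"
  have F: "F (Suc m) = (F m)(m := SOME x. P m ((F m)(m := x)))" for m by (simp add: F_def)
  have stable: "F (k + Suc l) l = F (Suc l) l" for k l
    by (induction k) (simp_all add: F)
  have P: "\<forall>l<m. P l (F m)" for m
  proof (induction m)
    case (Suc m)
    then have "\<exists>x. P m ((F m)(m := x))" using step[of m "F m"] by blast
    then have "P m (F (Suc m))" unfolding F by (rule someI_ex)
    moreover have "P l (F (Suc m))" if "l < m" for l
      by (rule local[of l "F m"]) (use that Suc F in auto)
    ultimately show ?case by (auto simp: less_Suc_eq)
  qed simp
  have "P m (\<lambda>l. F (Suc l) l)" for m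
  proof (rule local[of m "F (Suc m)"])
    show "P m (F (Suc m))" using P[of "Suc m"] by simp
    show "F (Suc m) l = F (Suc l) l" if "l \<le> m" for l
      using stable[of "m - l" l] that by simp
  qed
  then show ?thesis by blast
qed

lemma wspan_cong: "X \<in> subalg V \<Longrightarrow> (\<And>v. v \<in> V \<Longrightarrow> w v = w' v) \<Longrightarrow> X \<in> wspan w E \<Longrightarrow> X \<in> wspan w' E"
proof -
  assume X: "X \<in> subalg V" "X \<in> wspan w E" and e: "\<And>v. v \<in> V \<Longrightarrow> w v = w' v"
  have "mon_weight w u = mon_weight w' u" if "u \<in> gkeys X" for u
    unfolding mon_weight_def using that X e by (intro sum.cong) (auto simp: subalg_def)
  then show ?thesis using X by (auto simp: wspan_def kspan_def)
qed

lemma gmonom_wspan: "mon_weight w u \<in> E \<Longrightarrow> gmonom u c \<in> wspan w E"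
  unfolding wspan_def by (rule kspan_gmonom) simp

lemma gvar_wspan: "w v \<in> E \<Longrightarrow> gvar v \<in> wspan w E"
  unfolding gvar_def by (rule gmonom_wspan) simp

lemma der_add_fun: "der (\<lambda>v. g v + h v) X = der g X + der h (X :: 'k::comm_ring_1 galg)"
  by (simp add: der_def distrib_right sum.distrib)

lemma der_zero_fun: "X \<in> subalg V \<Longrightarrow> (\<And>v. v \<in> V \<Longrightarrow> g v = 0) \<Longrightarrow> der g X = (0 :: 'k::comm_ring_1 galg)"
  unfolding der_def by (rule sum.neutral) (auto simp: subalg_gvars)

lemma subalg_empty: "X \<in> subalg {} \<Longrightarrow> X = gconst (gcoeff X 0)"
  by (rule galg_eqI) (auto simp: gcoeff_gconst subalg_def in_gkeys_iff)

text \<open>The anticommutator of two odd derivations is an even derivation, hence determined by its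
  values on the variables. For \<open>g = h\<close> it is twice the square.\<close>

lemma der_anticommutator:
  fixes X :: "'k::comm_ring_1 galg"
  assumes X: "X \<in> subalg V"
    and g: "\<And>v. v \<in> V \<Longrightarrow> gpar (\<not> odd_var v) (g v)" "\<And>v. v \<in> V \<Longrightarrow> g v \<in> subalg V"
    and h: "\<And>v. v \<in> V \<Longrightarrow> gpar (\<not> odd_var v) (h v)" "\<And>v. v \<in> V \<Longrightarrow> h v \<in> subalg V"
    and k: "\<And>v. v \<in> V \<Longrightarrow> gpar (odd_var v) (k v)"
    and gen: "\<And>v. v \<in> V \<Longrightarrow> der g (h v) + der h (g v) = k v"
  shows "der g (der h X) + der h (der g X) = der k X"
  using X
proof (induction X rule: subalg_induct)
  case (add X Y)
  have "der g (der h (X + Y)) + der h (der g (X + Y))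
      = (der g (der h X) + der h (der g X)) + (der g (der h Y) + der h (der g Y))"
    by (simp add: der_add algebra_simps)
  then show ?case unfolding add by (simp add: der_add)
next
  case (mult v X)
  let ?v = "gvar v :: 'k galg"
  have s: "?v \<in> subalg V" "X \<in> subalg V" "g v \<in> subalg V" "h v \<in> subalg V"
    using mult g h by (auto simp: subalg_gvar)
  have sX: "der g X \<in> subalg V" "der h X \<in> subalg V"
    using s g h by (auto intro: der_subalg)
  have sv: "gsgn ?v \<in> subalg V" using s by (simp add: gsgn_subalg)
  note g_mult = der_mult_odd[where g = g and V = V, OF _ _ g(1)]
  note h_mult = der_mult_odd[where g = h and V = V, OF _ _ h(1)]
  have par: "gsgn (g v) = (if odd_var v then g v else - g v)" "gsgn (h v) = (if odd_var v then h v else - h v)"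
    using gpar_gsgn[OF g(1)] gpar_gsgn[OF h(1)] mult by auto
  have dh: "der h (?v * X) = h v * X + gsgn ?v * der h X" using s by (simp add: h_mult)
  have dg: "der g (?v * X) = g v * X + gsgn ?v * der g X" using s by (simp add: g_mult)
  have 1: "der g (der h (?v * X)) = der g (h v) * X + gsgn (h v) * der g X + der g (gsgn ?v) * der h X + ?v * der g (der h X)"
    unfolding dh der_add using s sX sv by (simp add: g_mult add.assoc)
  have 2: "der h (der g (?v * X)) = der h (g v) * X + gsgn (g v) * der h X + der h (gsgn ?v) * der g X + ?v * der h (der g X)"
    unfolding dg der_add using s sX sv by (simp add: h_mult add.assoc)
  \<comment> \<open>The cross terms cancel: \<open>h v\<close> and \<open>g v\<close> have the
    parity opposite to \<open>v\<close>, so \<open>gsgn\<close> gives the two terms opposite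
    signs.\<close>
  have "gsgn (h v) * der g X + der h (gsgn ?v) * der g X = 0" "gsgn (g v) * der h X + der g (gsgn ?v) * der h X = 0"
    by (auto simp: par gsgn_gvar der_uminus)
  then have "der g (der h (?v * X)) + der h (der g (?v * X))
      = (der g (h v) + der h (g v)) * X + ?v * (der g (der h X) + der h (der g X))"
    unfolding 1 2 by (simp add: algebra_simps add_eq_0_iff)
  also have "\<dots> = k v * X + ?v * der k X" using gen mult by simp
  also have "\<dots> = der k (?v * X)"
    using der_mult_even[of ?v V X k, OF s(1,2) k] by simp
  finally show ?case .
qed simp

context minimal_model begin

definition Tlv :: "nat \<Rightarrow> gvariable set" where
  "Tlv r = {Xvar m i | m i. m < r \<and> i \<in> J m} \<union> {Xivar m i | m i. m < r \<and> i \<in> J m}"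

definition TV :: "gvariable set" where
  "TV = {Xvar m i | m i. i \<in> J m} \<union> {Xivar m i | m i. i \<in> J m}"

text \<open>The variables \<open>Xivar m i\<close> also serve as the variables of the acyclic closure that kill the
  \<open>Xvar m i\<close>.  In this role their cohomological degree is \<open>- m - 1\<close>, of the same parity as the degree
  \<open>m + 1\<close> of $\xi^i_{(m)}$.\<close>

fun cT :: "gvariable \<Rightarrow> int" where
  "cT (Xvar m i) = - int m"
| "cT (Xivar m i) = - int m - 1"

text \<open>A killing variable inherits the internal degree of the variable it kills, so that the
  differential of the closure preserves internal degree.\<close>

fun iT :: "gvariable \<Rightarrow> int" where
  "iT (Xvar m i) = wt m i"
| "iT (Xivar m i) = wt m i"

text \<open>The differential of Tate's acyclic closure on variables. Sending \<xi> to x alone would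
  not square to zero when \<partial>x is nonzero; hence the correction \<open>y\<close>.\<close>

definition gD :: "(nat \<Rightarrow> nat \<Rightarrow> 'k galg) \<Rightarrow> gvariable \<Rightarrow> 'k galg" where
  "gD y v = (case v of Xvar m i \<Rightarrow> gd v | Xivar m i \<Rightarrow> gvar (Xvar m i) - y m i)"

lemma gD_simps [simp]: "gD y (Xvar m i) = gd (Xvar m i)" "gD y (Xivar m i) = gvar (Xvar m i) - y m i"
  by (simp_all add: gD_def)

text \<open>The last clause makes x minus its correction a cycle; the others keep the correction in
  lower levels and in the bidegree of x.\<close>

definition lift_ok :: "(nat \<Rightarrow> nat \<Rightarrow> 'k galg) \<Rightarrow> nat \<Rightarrow> bool" where
  "lift_ok y m \<longleftrightarrow> (\<forall>i\<in>J m. y m i \<in> subalg (Tlv m) \<and> y m i \<in> wspan cT {- int m}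
      \<and> y m i \<in> wspan iT {wt m i} \<and> der (gD y) (y m i) = gd (Xvar m i))"

lemma finite_Tlv [simp]: "finite (Tlv r)"
proof -
  have "Tlv r = (\<Union>m<r. Xvar m ` J m \<union> Xivar m ` J m)" by (auto simp: Tlv_def)
  then show ?thesis by simp
qed

lemma even_cT: "even (cT v) \<longleftrightarrow> \<not> odd_var v"
  by (cases v) (auto simp: odd_var_def)

lemma Rlv_Tlv: "Rlv r \<subseteq> Tlv r" by (auto simp: Rlv_def Tlv_def)

lemma Tlv_mono: "r \<le> s \<Longrightarrow> Tlv r \<subseteq> Tlv s" by (auto simp: Tlv_def)

lemma Tlv_TV: "Tlv r \<subseteq> TV" by (auto simp: Tlv_def TV_def)

lemma gd_cT: "gd (Xvar m i) \<in> wspan cT {1 - int m}"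
proof (rule wspan_cong[of _ Rv cdeg_var])
  show "gd (Xvar m i) \<in> subalg Rv" using gd_R by (simp add: R_alg_eq)
  show "gd (Xvar m i) \<in> wspan cdeg_var {1 - int m}" using gd_cdeg[of "Xvar m i"] by simp
qed (auto simp: Rv_def)

lemma gd_iT: "gd (Xvar m i) \<in> wspan iT {wt m i}"
proof (rule wspan_cong[of _ Rv "int_weight wt"])
  show "gd (Xvar m i) \<in> subalg Rv" using gd_R by (simp add: R_alg_eq)
  show "gd (Xvar m i) \<in> wspan (int_weight wt) {wt m i}" using gd_int[of "Xvar m i"] by simp
qed (auto simp: Rv_def)

lemma der_gD_R: "X \<in> R_alg J \<Longrightarrow> der (gD y) X = d X"
  unfolding d_eq_der by (rule der_cong[of Rv]) (auto simp: Rv_def R_alg_eq)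

lemma gD_cT: "lift_ok y m \<Longrightarrow> v \<in> {Xvar m i, Xivar m i} \<Longrightarrow> i \<in> J m \<Longrightarrow> gD y v \<in> wspan cT {cT v + 1}"
  using gd_cT[of m i] by (auto simp: lift_ok_def intro!: wspan_diff gvar_wspan)

lemma gD_iT: "lift_ok y m \<Longrightarrow> v \<in> {Xvar m i, Xivar m i} \<Longrightarrow> i \<in> J m \<Longrightarrow> gD y v \<in> wspan iT {iT v}"
  using gd_iT[of m i] by (auto simp: lift_ok_def intro!: wspan_diff gvar_wspan)

lemma TlvE:
  assumes "v \<in> Tlv r" obtains m i where "m < r" "i \<in> J m" "v \<in> {Xvar m i, Xivar m i}"
  using assms by (auto simp: Tlv_def)

text \<open>A constant has both degrees 0, which leaves only level 0, and there the internal degree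
  is 1.\<close>

lemma y_eps: "lift_ok y m \<Longrightarrow> i \<in> J m \<Longrightarrow> gcoeff (y m i) 0 = 0"
proof -
  assume "lift_ok y m" "i \<in> J m"
  then have y: "y m i \<in> wspan cT {- int m}" "y m i \<in> wspan iT {wt m i}" by (auto simp: lift_ok_def)
  show ?thesis
  proof (rule ccontr)
    assume "gcoeff (y m i) 0 \<noteq> 0"
    then have "0 \<in> gkeys (y m i)" by (simp add: in_gkeys_iff)
    then have "m = 0" "wt m i = 0" using y by (auto simp: wspan_def kspan_def)
    then show False using wt0 \<open>i \<in> J m\<close> by auto
  qed
qed

context
  fixes y r assumes ok: "\<And>l. l < r \<Longrightarrow> lift_ok y l"
begin

lemma gD_par: "v \<in> Tlv r \<Longrightarrow> gpar (\<not> odd_var v) (gD y v)"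
proof -
  assume "v \<in> Tlv r"
  then obtain m i where "m < r" "i \<in> J m" "v \<in> {Xvar m i, Xivar m i}" by (rule TlvE)
  then have "gpar (odd (cT v + 1)) (gD y v)" by (intro homogeneous_gpar[OF gD_cT even_cT] ok)
  then show ?thesis by (simp add: even_cT)
qed

lemma gD_subalg:
  assumes "v \<in> Tlv r" "r \<le> s" shows "gD y v \<in> subalg (Tlv s)"
proof -
  from assms(1) obtain m i where m: "m < r" "i \<in> J m" "v \<in> {Xvar m i, Xivar m i}" by (rule TlvE)
  have "gd (Xvar m i) \<in> subalg (Tlv s)"
    using gd_level[of m i] Rlv_Tlv[of m] Tlv_mono[of m s] m assms by (auto intro: subalg_mono)
  moreover have "y m i \<in> subalg (Tlv s)" using ok[OF m(1)] m assms Tlv_mono[of m s]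
    by (auto simp: lift_ok_def intro: subalg_mono)
  moreover have "gvar (Xvar m i) \<in> subalg (Tlv s)" using m assms by (auto intro!: subalg_gvar simp: Tlv_def)
  ultimately show ?thesis using m(3) by (auto intro: subalg_diff)
qed

lemma gD_eps: "v \<in> Tlv r \<Longrightarrow> gcoeff (gD y v) 0 = 0"
  using ok y_eps by (elim TlvE) auto

lemma D_subalg: "X \<in> subalg (Tlv r) \<Longrightarrow> der (gD y) X \<in> subalg (Tlv r)"
  by (rule der_subalg[of _ "Tlv r"]) (auto intro: gD_subalg)

lemma D_cT: "X \<in> subalg (Tlv r) \<Longrightarrow> X \<in> wspan cT {e} \<Longrightarrow> der (gD y) X \<in> wspan cT {e + 1}"
  by (rule der_wspan[of _ "Tlv r" _ _ _ "\<lambda>v. {cT v + 1}"]) (auto elim!: TlvE intro!: gD_cT ok)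

lemma D_iT: "X \<in> subalg (Tlv r) \<Longrightarrow> X \<in> wspan iT {e} \<Longrightarrow> der (gD y) X \<in> wspan iT {e}"
  by (rule der_wspan[of _ "Tlv r" _ _ _ "\<lambda>v. {iT v}"]) (auto elim!: TlvE intro!: gD_iT ok)

lemma D_D: assumes "X \<in> subalg (Tlv r)" shows "der (gD y) (der (gD y) X) = 0"
proof -
  have "der (gD y) (der (gD y) X) + der (gD y) (der (gD y) X) = der (\<lambda>_. 0) X"
  proof (rule der_anticommutator[OF assms])
    fix v assume v: "v \<in> Tlv r"
    then obtain m i where m: "m < r" "i \<in> J m" "v \<in> {Xvar m i, Xivar m i}" by (rule TlvE)
    have 1: "der (gD y) (gd (Xvar m i)) = 0" using m gd_R[of "Xvar m i"] d_d[of "gvar (Xvar m i)"]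
      by (simp add: der_gD_R gd_Xvar R_alg_eq subalg_gvar Rv_def)
    have 2: "der (gD y) (gvar (Xvar m i) - y m i) = 0"
      using ok[OF m(1)] m by (simp add: der_diff lift_ok_def)
    show "der (gD y) (gD y v) + der (gD y) (gD y v) = 0" using m 1 2 by auto
  qed (auto intro: gD_par gD_subalg)
  then have "gconst 2 * der (gD y) (der (gD y) X) = 0"
    by (simp add: gconst_numeral mult_2 der_def[of "\<lambda>_. 0"])
  then have "gconst (1/2) * (gconst 2 * der (gD y) (der (gD y) X)) = 0" by simp
  then show ?thesis by (simp flip: mult.assoc gconst_mult)
qed

end

section \<open>Acyclicity of the closure\<close>

fun level_weight :: "nat \<Rightarrow> gvariable \<Rightarrow> int" where
  "level_weight r (Xvar m i) = (if m = r then 1 else 0)"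
| "level_weight r (Xivar m i) = (if m = r then 1 else 0)"

lemma level_weight_nonneg: "level_weight r v \<ge> 0"
  by (cases v) auto

lemma subalg_level_0:
  assumes "X \<in> subalg (Tlv (Suc r))" "X \<in> wspan (level_weight r) {..0}"
  shows "X \<in> subalg (Tlv r)"
  unfolding subalg_def
proof safe
  fix u v assume u: "u \<in> gkeys X" and v: "v \<in> Poly_Mapping.keys u"
  have "mon_weight (level_weight r) u \<le> 0" using u assms(2) by (auto simp: wspan_def kspan_def)
  then have "(\<Sum>v\<in>Poly_Mapping.keys u. int (Poly_Mapping.lookup u v) * level_weight r v) = 0"
    using mon_weight_nonneg[of u "level_weight r"] level_weight_nonneg by (simp add: mon_weight_def)
  then have "int (Poly_Mapping.lookup u v) * level_weight r v = 0"
    using v by (subst (asm) sum_nonneg_eq_0_iff) (auto simp: level_weight_nonneg)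
  then have "level_weight r v = 0" using v by (simp add: in_keys_iff)
  moreover have "v \<in> Tlv (Suc r)" using assms(1) u v by (auto simp: subalg_def)
  ultimately show "v \<in> Tlv r" by (auto simp: Tlv_def less_Suc_eq split: if_splits)
qed

lemma level_0_wspan: "X \<in> subalg (Tlv r) \<Longrightarrow> X \<in> wspan (level_weight r) {0}"
proof (rule wspan_cong[of X "Tlv r" "\<lambda>_. 0"])
  show "X \<in> wspan (\<lambda>_. 0) {0}" by (auto simp: wspan_def kspan_def mon_weight_def)
qed (auto simp: Tlv_def)

definition gS :: "nat \<Rightarrow> gvariable \<Rightarrow> 'k galg" where
  "gS r v = (case v of Xvar m i \<Rightarrow> if m = r then gvar (Xivar r i) else 0 | Xivar m i \<Rightarrow> 0)"

lemma gS_simps [simp]: "gS r (Xvar m i) = (if m = r then gvar (Xivar r i) else 0)" "gS r (Xivar m i) = 0"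
  by (simp_all add: gS_def)

definition gE :: "(nat \<Rightarrow> nat \<Rightarrow> 'k galg) \<Rightarrow> nat \<Rightarrow> gvariable \<Rightarrow> 'k galg" where
  "gE y r v = (case v of Xvar m i \<Rightarrow> if m = r then - y r i else 0 | Xivar m i \<Rightarrow> 0)"

lemma gE_simps [simp]: "gE y r (Xvar m i) = (if m = r then - y r i else 0)" "gE y r (Xivar m i) = 0"
  by (simp_all add: gE_def)

lemma der_gS_0: "X \<in> subalg (Tlv r) \<Longrightarrow> der (gS r) X = 0"
  by (rule der_zero_fun[of _ "Tlv r"]) (auto elim!: TlvE)

text \<open>The derivation \<open>gS r\<close>, which sends the \<open>x\<close> of level \<open>r\<close> to the \<open>\<xi>\<close>, is a contracting homotopy up to
  the term \<open>gE y r\<close>, which lowers the degree in the variables of level \<open>r\<close>.\<close>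

lemma D_homotopy:
  assumes ok: "\<And>l. l < Suc r \<Longrightarrow> lift_ok y l" and X: "X \<in> subalg (Tlv (Suc r))"
  shows "der (gS r) (der (gD y) X) + der (gD y) (der (gS r) X)
     = der (\<lambda>v. gconst (of_int (level_weight r v)) * gvar v + gE y r v) X"
proof (rule der_anticommutator[OF X])
  fix v assume v: "v \<in> Tlv (Suc r)"
  then obtain m i where m: "m < Suc r" "i \<in> J m" "v \<in> {Xvar m i, Xivar m i}" by (rule TlvE)
  show "gpar (\<not> odd_var v) (gD y v)" by (rule gD_par[OF ok v])
  show "gD y v \<in> subalg (Tlv (Suc r))" by (rule gD_subalg[OF ok v]) auto
  have o: "odd_var (Xivar r i) \<longleftrightarrow> \<not> odd_var (Xvar r i)" by (simp add: odd_var_def)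
  have "gpar (\<not> odd_var (Xvar r i)) (gvar (Xivar r i) :: 'k galg)" unfolding o[symmetric] by (rule gpar_gvar)
  then show "gpar (\<not> odd_var v) (gS r v)" using m(3) by auto
  show "gS r v \<in> subalg (Tlv (Suc r))" using m by (auto intro!: subalg_gvar simp: Tlv_def)
  have ym: "y m i \<in> subalg (Tlv m)" "y m i \<in> wspan cT {- int m}" using ok[OF m(1)] m by (auto simp: lift_ok_def)
  have py: "gpar (odd_var (Xvar m i)) (y m i)"
    using homogeneous_gpar[OF ym(2) even_cT] even_cT[of "Xvar m i"] by simp
  have "gpar (odd_var v) (gE y r v)" using m(3) py by (auto intro: gpar_uminus)
  then show "gpar (odd_var v) (gconst (of_int (level_weight r v)) * gvar v + gE y r v)"
    by (intro gpar_add gpar_gconst_mult gpar_gvar)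
  have yr: "der (gS r) (y m i) = 0" using ym m Tlv_mono[of m r] by (auto intro!: der_gS_0 intro: subalg_mono)
  have gdr: "der (gS r) (gd (Xvar m i)) = 0" using m gd_level[of m i] Rlv_Tlv[of m] Tlv_mono[of m r]
    by (intro der_gS_0) (auto intro: subalg_mono)
  show "der (gS r) (gD y v) + der (gD y) (gS r v) = gconst (of_int (level_weight r v)) * gvar v + gE y r v"
    using m(3) by (auto simp: yr gdr der_diff)
qed

text \<open>The outer induction is on the levels, the inner one on the degree in the variables of
  the top level. By the homotopy, a cycle agrees in its top degree with a multiple of the boundary
  of its image under \<open>gS r\<close>. In degree 0 the level has disappeared, and without levels
  only constants remain.\<close>

lemma T_acyclic_level:
  assumes "\<And>l. l < r \<Longrightarrow> lift_ok y l" "X \<in> subalg (Tlv r)" "der (gD y) X = 0" "gcoeff X 0 = 0"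
  shows "\<exists>Y\<in>subalg (Tlv r). der (gD y) Y = X"
  using assms
proof (induction r arbitrary: X)
  case 0
  then have "X = gconst (gcoeff X 0)" by (intro subalg_empty) (simp add: Tlv_def)
  then have "X = 0" using 0 by (metis gconst_0)
  then show ?case by (intro bexI[of _ 0]) auto
next
  case (Suc r)
  have "X \<in> wspan (level_weight r) {..int N} \<Longrightarrow> X \<in> subalg (Tlv (Suc r)) \<Longrightarrow> der (gD y) X = 0
      \<Longrightarrow> gcoeff X 0 = 0 \<Longrightarrow> \<exists>Y\<in>subalg (Tlv (Suc r)). der (gD y) Y = X" for N X
  proof (induction N arbitrary: X)
    case 0
    have "X \<in> wspan (level_weight r) {..0}" using 0(1) by (simp only: of_nat_0)
    with 0(2) have "X \<in> subalg (Tlv r)" by (rule subalg_level_0)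
    then obtain Y where "Y \<in> subalg (Tlv r)" "der (gD y) Y = X" using Suc.IH[of X] Suc.prems(1) 0 by auto
    then show ?case using Tlv_mono[of r "Suc r"] by (auto intro: subalg_mono)
  next
    case (Suc N)
    note ok = \<open>\<And>l. l < Suc r \<Longrightarrow> lift_ok y l\<close>
    \<comment> \<open>The top degree, invertible in characteristic 0.\<close>
    define c where "c = (of_int (int (Suc N)) :: 'k)"
    have c0: "c \<noteq> 0" unfolding c_def of_int_eq_0_iff by simp
    define A where "A = der (\<lambda>v. gconst (of_int (level_weight r v)) * gvar v :: 'k galg)"
    have A_add: "A (X + Y) = A X + A Y" for X Y by (simp add: A_def der_add)
    let ?sX = "der (gS r) X"
    have sX: "?sX \<in> subalg (Tlv (Suc r))"
      by (rule der_subalg[OF Suc.prems(2)]) (auto elim!: TlvE intro!: subalg_gvar simp: Tlv_def)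
    have DsX: "der (gD y) ?sX = A X + der (gE y r) X"
      using D_homotopy[OF ok Suc.prems(2)] Suc.prems(3) by (simp add: der_add_fun A_def)
    have E1: "A X - gconst c * X
        \<in> wspan (level_weight r) {..int N}"
    proof (rule galg_induct[where X = X and P = "\<lambda>X. A X - gconst c * X
        \<in> wspan (level_weight r) {..int N}"])
      fix u assume u: "u \<in> gkeys X"
      then have le: "mon_weight (level_weight r) u \<le> int (Suc N)"
        using Suc.prems(1) by (auto simp: wspan_def kspan_def)
      have eq: "A (gmonom u (gcoeff X u)) - gconst c * gmonom u (gcoeff X u)
        = gconst (of_int (mon_weight (level_weight r) u) - c) * gmonom u (gcoeff X u)"
        unfolding A_def der_euler by (rule galg_eqI) (simp add: algebra_simps)
      show "A (gmonom u (gcoeff X u)) - gconst c * gmonom u (gcoeff X u)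
        \<in> wspan (level_weight r) {..int N}"
      proof (cases "mon_weight (level_weight r) u = int (Suc N)")
        case True
        then have "of_int (mon_weight (level_weight r) u) = c" unfolding c_def by simp
        then show ?thesis unfolding eq by simp
      next
        case False
        then show ?thesis unfolding eq using le by (intro wspan_gconst_mult gmonom_wspan) simp
      qed
    next
      fix X Y
      assume "A X - gconst c * X \<in> wspan (level_weight r) {..int N}"
        "A Y - gconst c * Y \<in> wspan (level_weight r) {..int N}"
      from wspan_add[OF this] show "A (X + Y) - gconst c * (X + Y)
        \<in> wspan (level_weight r) {..int N}"
        unfolding A_add distrib_left by (simp add: algebra_simps)
    qed (simp add: A_def)
    have E2: "der (gE y r) X \<in> wspan (level_weight r) {..int N}"
    \<comment> \<open>The empty set of weights on lower levels encodes that \<open>gE y r\<close>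
      vanishes there; on level \<open>r\<close> a variable is traded for an element of lower
      level.\<close>
    proof (rule der_wspan[OF Suc.prems(2,1), where G = "\<lambda>v. if level_weight r v = 1 then {0} else {}"])
      fix v assume "v \<in> Tlv (Suc r)"
      then obtain m i where m: "m < Suc r" "i \<in> J m" "v \<in> {Xvar m i, Xivar m i}" by (rule TlvE)
      show "gE y r v \<in> wspan (level_weight r) (if level_weight r v = 1 then {0} else {})"
        using m ok[of r] by (auto simp: lift_ok_def intro!: level_0_wspan subalg_uminus)
    qed (auto split: if_splits)
    \<comment> \<open>\<open>Z\<close> differs from \<open>X\<close> by a boundary and has lost the
      part of top degree.\<close>
    define Z where "Z = X - gconst (1 / c) * der (gD y) ?sX"
    have "gconst (1 / c) * (gconst c * X) = X"
      using c0 by (simp flip: mult.assoc gconst_mult)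
    then have "Z = - (gconst (1 / c) * ((A X - gconst c * X) + der (gE y r) X))"
      unfolding Z_def DsX by (simp add: distrib_left right_diff_distrib)
    then have Z1: "Z \<in> wspan (level_weight r) {..int N}"
      by (simp only:) (intro wspan_uminus wspan_gconst_mult wspan_add E1 E2)
    have Z2: "Z \<in> subalg (Tlv (Suc r))" unfolding Z_def
      using Suc.prems sX by (intro subalg_diff subalg_gconst_mult D_subalg[OF ok])
    have Z3: "der (gD y) Z = 0"
      unfolding Z_def using Suc.prems D_D[OF ok sX] by (simp add: der_diff der_gconst_mult)
    have Z4: "gcoeff Z 0 = 0"
      unfolding Z_def using Suc.prems gcoeff_der_0[OF sX gD_eps[OF ok]] by simp
    obtain Y where Y: "Y \<in> subalg (Tlv (Suc r))" "der (gD y) Y = Z" using Suc.IH[OF Z1 Z2 Z3 Z4] by blast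
    show ?case
    proof (intro bexI[of _ "Y + gconst (1 / c) * ?sX"])
      show "der (gD y) (Y + gconst (1 / c) * ?sX) = X" by (simp add: der_add der_gconst_mult Y Z_def)
      show "Y + gconst (1 / c) * ?sX \<in> subalg (Tlv (Suc r))" using Y sX by (intro subalg_add subalg_gconst_mult)
    qed
  qed
  moreover have "\<exists>N::nat. X \<in> wspan (level_weight r) {..int N}"
  proof -
    have "mon_weight (level_weight r) u \<le> int (nat (Max (insert 0 (mon_weight (level_weight r) ` gkeys X))))"
      if "u \<in> gkeys X" for u
      using Max_ge[of "insert 0 (mon_weight (level_weight r) ` gkeys X)" "mon_weight (level_weight r) u"] that by simp
    then have "X \<in> wspan (level_weight r) {..int (nat (Max (insert 0 (mon_weight (level_weight r) ` gkeys X))))}"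
      by (auto simp: wspan_def kspan_def)
    then show ?thesis ..
  qed
  ultimately show ?case using Suc.prems by blast
qed

lemma D_gproj:
  assumes "\<And>l. l < r \<Longrightarrow> lift_ok y l" "X \<in> subalg (Tlv r)"
  shows "gproj (\<lambda>u. mon_weight cT u = e + 1 \<and> mon_weight iT u = f) (der (gD y) X)
    = der (gD y) (gproj (\<lambda>u. mon_weight cT u = e \<and> mon_weight iT u = f) X)"
proof (rule gproj_commute[OF assms(2)[unfolded subalg_kspan]])
  fix u v and c :: 'k assume u: "u \<in> {u. Poly_Mapping.keys u \<subseteq> Tlv r}" and v: "v \<in> gkeys (der (gD y) (gmonom u c))"
  have s: "gmonom u c \<in> subalg (Tlv r)" using u by (simp add: subalg_gmonom)
  have "mon_weight cT v = mon_weight cT u + 1"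
    using D_cT[OF assms(1) s, of "mon_weight cT u"] v by (auto simp: gmonom_wspan) (auto simp: wspan_def kspan_def)
  moreover have "mon_weight iT v = mon_weight iT u"
    using D_iT[OF assms(1) s, of "mon_weight iT u"] v by (auto simp: gmonom_wspan) (auto simp: wspan_def kspan_def)
  ultimately show "(mon_weight cT v = e + 1 \<and> mon_weight iT v = f) \<longleftrightarrow> (mon_weight cT u = e \<and> mon_weight iT u = f)"
    by simp
qed (simp add: der_add)

text \<open>Each \<partial>x is a cycle without constant term in the closure of the lower levels,
  which is already acyclic. The component of a primitive in the right bidegree is again a
  primitive.\<close>

lemma lift_ok_ex: "\<exists>y. \<forall>m. lift_ok y m"
proof (rule dependent_choice_below)
  fix m and f :: "nat \<Rightarrow> nat \<Rightarrow> 'k galg" assume ok: "\<And>l. l < m \<Longrightarrow> lift_ok f l"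
  have "\<exists>Y. Y \<in> subalg (Tlv m) \<and> Y \<in> wspan cT {- int m} \<and> Y \<in> wspan iT {wt m i} \<and> der (gD f) Y = gd (Xvar m i)"
    if i: "i \<in> J m" for i
  proof -
    let ?X = "gd (Xvar m i)"
    let ?P = "\<lambda>u. mon_weight cT u = - int m \<and> mon_weight iT u = wt m i"
    have "der (gD f) ?X = 0" using gd_R[of "Xvar m i"] d_d[of "gvar (Xvar m i)"] i
      by (simp add: der_gD_R gd_Xvar R_alg_eq subalg_gvar Rv_def)
    then obtain Y where Y: "Y \<in> subalg (Tlv m)" "der (gD f) Y = ?X"
      using T_acyclic_level[OF ok, where X = ?X] gd_level[of m i] Rlv_Tlv[of m] by (auto intro: subalg_mono)
    have "gproj (\<lambda>u. mon_weight cT u = - int m + 1 \<and> mon_weight iT u = wt m i) ?X = ?X"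
      using gd_cT[of m i] gd_iT[of m i] by (intro gproj_id) (auto simp: wspan_def kspan_def)
    then have "der (gD f) (gproj ?P Y) = ?X" using D_gproj[OF ok Y(1), of "- int m" "wt m i"] Y by simp
    moreover have "gproj ?P Y \<in> wspan cT {- int m}" "gproj ?P Y \<in> wspan iT {wt m i}"
      by (auto simp: wspan_def kspan_def gkeys_gproj)
    ultimately show ?thesis using Y by (auto intro: gproj_subalg)
  qed
  then obtain z where z: "\<And>i. i \<in> J m \<Longrightarrow> z i \<in> subalg (Tlv m) \<and> z i \<in> wspan cT {- int m} \<and>
      z i \<in> wspan iT {wt m i} \<and> der (gD f) (z i) = gd (Xvar m i)" by metis
  \<comment> \<open>The new values sit on level \<open>m\<close>, whereas \<open>z i\<close>
    involves only lower levels.\<close>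
  have "der (gD (f(m := z))) (z i) = der (gD f) (z i)" if "i \<in> J m" for i
    using z[OF that] by (intro der_cong[of "Tlv m"]) (auto simp: Tlv_def)
  with z show "\<exists>x. lift_ok (f(m := x)) m" by (intro exI[of _ z]) (auto simp: lift_ok_def)
next
  fix m and f g :: "nat \<Rightarrow> nat \<Rightarrow> 'k galg" assume eq: "\<And>l. l \<le> m \<Longrightarrow> f l = g l" and f: "lift_ok f m"
  have "der (gD g) (f m i) = der (gD f) (f m i)" if "i \<in> J m" for i
    by (rule der_cong[of "Tlv m"]) (use that f eq in \<open>auto simp: lift_ok_def Tlv_def\<close>)
  then show "lift_ok g m" using f eq by (auto simp: lift_ok_def)
qed

definition yy :: "nat \<Rightarrow> nat \<Rightarrow> 'k galg" where "yy = (SOME y. \<forall>m. lift_ok y m)"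

lemma yy: "lift_ok yy m"
  using someI_ex[OF lift_ok_ex] by (simp add: yy_def)

abbreviation D :: "'k galg \<Rightarrow> 'k galg" where "D \<equiv> der (gD yy)"

lemma TV_Tlv:
  assumes "X \<in> subalg TV" obtains r where "X \<in> subalg (Tlv r)"
proof -
  let ?l = "\<lambda>v. case v of Xvar m i \<Rightarrow> m | Xivar m i \<Rightarrow> m"
  have "gvars X \<subseteq> TV" using assms by (simp add: subalg_gvars)
  then have "gvars X \<subseteq> Tlv (Suc (Max (insert 0 (?l ` gvars X))))"
  proof -
    have "?l v < Suc (Max (insert 0 (?l ` gvars X)))" if "v \<in> gvars X" for v
      using that by (simp add: less_Suc_eq_le)
    then show ?thesis using \<open>gvars X \<subseteq> TV\<close> unfolding TV_def Tlv_def by fastforce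
  qed
  then show thesis using that by (simp add: subalg_gvars)
qed

lemma T_acyclic: "X \<in> subalg TV \<Longrightarrow> D X = 0 \<Longrightarrow> gcoeff X 0 = 0 \<Longrightarrow> \<exists>Y\<in>subalg TV. D Y = X"
  using T_acyclic_level[OF yy] Tlv_TV by (metis TV_Tlv subalg_mono)

end

subsection \<open>Reduction modulo \<open>I\<close>\<close>

lemma mon_weight_ge_2:
  assumes "u \<noteq> 0" "\<And>v. u \<noteq> Poly_Mapping.single v (Suc 0)"
  shows "mon_weight (\<lambda>_. 1) u \<ge> 2"
proof -
  obtain v where v: "Poly_Mapping.lookup u v \<noteq> 0" using assms(1) by (metis poly_mapping_eqI lookup_zero)
  let ?u = "u - Poly_Mapping.single v (Suc 0)"
  have "?u \<noteq> 0" using single_minus_plus[OF v] assms(2)[of v] by auto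
  then obtain v' where v': "Poly_Mapping.lookup ?u v' \<noteq> 0" by (metis poly_mapping_eqI lookup_zero)
  have "mon_weight (\<lambda>_. 1) (?u - Poly_Mapping.single v' (Suc 0)) \<ge> 0" by (rule mon_weight_nonneg) simp
  then show ?thesis using mon_weight_minus[OF v, of "\<lambda>_. 1"] mon_weight_minus[OF v', of "\<lambda>_. 1"] by simp
qed

lemma xi_only_0 [simp]: "xi_only 0" and x_only_0 [simp]: "x_only 0"
  by (simp_all add: xi_only_def x_only_def)

lemma xi_only_single: "v \<notin> XV \<Longrightarrow> xi_only (Poly_Mapping.single v (Suc 0))"
  by (auto simp: xi_only_def)

lemma gcoeff_xi_coeff_0: "xi_only \<nu> \<Longrightarrow> gcoeff (xi_coeff \<nu> X) 0 = gcoeff X \<nu>"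
  by (simp add: gcoeff_xi_coeff)

lemma mon_weight_x_zero:
  assumes "x_only a" "\<And>v. v \<in> XV \<Longrightarrow> w v = 0" shows "mon_weight w a = 0"
  unfolding mon_weight_def using assms by (intro sum.neutral) (auto simp: x_only_def)

lemma fdeg_XV: "v \<in> XV \<Longrightarrow> fdeg_var v = 0"
  by (auto simp: XV_def)

lemma fdeg_nonneg: "mon_weight fdeg_var u \<ge> 0"
proof (rule mon_weight_nonneg)
  fix v show "fdeg_var v \<ge> 0" by (cases v) auto
qed

lemma fdeg_restr: "mon_weight fdeg_var (mon_restr (- XV) u) = mon_weight fdeg_var u"
proof -
  have "mon_weight fdeg_var (mon_restr XV u) = 0"
    by (rule mon_weight_x_zero[OF x_only_restr fdeg_XV])
  then show ?thesis using mon_weight_add[of fdeg_var "mon_restr XV u" "mon_restr (- XV) u"] mon_restr_add[of u] by simp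
qed

text \<open>Up to a sign of square 1 the coefficients of \<open>X\<close> are those of its
  \<xi>-coefficients, and the filtration degree does not see the x. Filtration conditions can thus
  be checked one \<xi>-monomial at a time.\<close>

lemma wspan_fdeg_iff:
  "X \<in> wspan fdeg_var E \<longleftrightarrow> (\<forall>\<nu>. xi_only \<nu> \<longrightarrow> mon_weight fdeg_var \<nu> \<notin> E \<longrightarrow> xi_coeff \<nu> (X :: 'k::comm_ring_1 galg) = 0)"
proof
  assume X: "X \<in> wspan fdeg_var E"
  show "\<forall>\<nu>. xi_only \<nu> \<longrightarrow> mon_weight fdeg_var \<nu> \<notin> E \<longrightarrow> xi_coeff \<nu> X = 0"
  proof (intro allI impI)
    fix \<nu> assume n: "xi_only \<nu>" "mon_weight fdeg_var \<nu> \<notin> E"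
    have "\<nu> \<notin> mon_restr (- XV) ` gkeys X" using X n fdeg_restr by (auto simp: wspan_def kspan_def)
    with n(1) show "xi_coeff \<nu> X = 0" by (rule xi_coeff_outside)
  qed
next
  assume *: "\<forall>\<nu>. xi_only \<nu> \<longrightarrow> mon_weight fdeg_var \<nu> \<notin> E \<longrightarrow> xi_coeff \<nu> X = 0"
  show "X \<in> wspan fdeg_var E" unfolding wspan_def kspan_def
  proof safe
    fix u assume u: "u \<in> gkeys X"
    let ?a = "mon_restr XV u" and ?n = "mon_restr (- XV) u"
    have k: "koszul_sign ?a ?n * koszul_sign ?a ?n = 1"
      by (rule koszul_sign_sq[OF x_xi_odd_disjoint]) auto
    have kk: "(of_int (koszul_sign ?a ?n) * of_int (koszul_sign ?a ?n) :: 'k) = 1"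
      using arg_cong[OF k, of "of_int :: int \<Rightarrow> 'k"] by simp
    have "gcoeff (xi_coeff ?n X) ?a = of_int (koszul_sign ?a ?n) * gcoeff X u"
      by (simp add: gcoeff_xi_coeff mon_restr_add)
    moreover have "of_int (koszul_sign ?a ?n) * gcoeff X u \<noteq> 0"
    proof
      assume "of_int (koszul_sign ?a ?n) * gcoeff X u = 0"
      then have "of_int (koszul_sign ?a ?n) * of_int (koszul_sign ?a ?n) * gcoeff X u = 0"
        by (simp add: mult.assoc)
      then show False using u kk by (simp add: in_gkeys_iff)
    qed
    ultimately have "xi_coeff ?n X \<noteq> 0" by auto
    then have "mon_weight fdeg_var ?n \<in> E" using * xi_only_restr by blast
    then show "mon_weight fdeg_var u \<in> E" by (simp add: fdeg_restr)
  qed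
qed

context minimal_model begin

lemma Rv_TV: "Rv \<subseteq> TV" by (auto simp: Rv_def TV_def)
lemma TV_XV: "TV \<inter> XV = Rv" by (auto simp: Rv_def TV_def XV_def)

lemma R_T: "X \<in> R_alg J \<Longrightarrow> X \<in> subalg TV"
  unfolding R_alg_eq using Rv_TV by (blast intro: subalg_mono)

lemma R_XV: "X \<in> R_alg J \<Longrightarrow> X \<in> subalg XV"
  unfolding R_alg_eq using Rv_XV by (blast intro: subalg_mono)

lemma xi_coeff_R: "xi_only \<nu> \<Longrightarrow> X \<in> subalg TV \<Longrightarrow> xi_coeff \<nu> X \<in> R_alg J"
  using xi_coeff_subalg[of \<nu> X TV] by (simp add: TV_XV R_alg_eq)

lemma gmonom_T: "\<nu> \<in> mon_restr V ` gkeys X \<Longrightarrow> X \<in> subalg TV \<Longrightarrow> gmonom \<nu> 1 \<in> subalg TV"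
  by (intro subalg_gmonom) (fastforce simp: subalg_def in_keys_iff subset_iff split: if_splits)

text \<open>The kernel of the map applying the augmentation from R to A in every \<xi>-coefficient;
  congruence modulo it replaces computation in a quotient.\<close>

definition NN :: "'k galg set" where
  "NN = {X \<in> subalg TV. \<forall>\<nu>. xi_only \<nu> \<longrightarrow> proj_S n (xi_coeff \<nu> X) \<in> I}"

lemma NN_T: "X \<in> NN \<Longrightarrow> X \<in> subalg TV" by (simp add: NN_def)

lemma NN_0 [simp]: "0 \<in> NN" by (simp add: NN_def)

lemma NN_add: "X \<in> NN \<Longrightarrow> Y \<in> NN \<Longrightarrow> X + Y \<in> NN"
  and NN_diff: "X \<in> NN \<Longrightarrow> Y \<in> NN \<Longrightarrow> X - Y \<in> NN"
  by (auto simp: NN_def subalg_add subalg_diff xi_coeff_add xi_coeff_diff proj_S_linear I_add I_diff)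

lemma NN_sum: "(\<And>a. a \<in> A \<Longrightarrow> f a \<in> NN) \<Longrightarrow> sum f A \<in> NN"
  by (induction A rule: infinite_finite_induct) (auto intro: NN_add)

lemma NN_mult: "r \<in> R_alg J \<Longrightarrow> X \<in> NN \<Longrightarrow> r * X \<in> NN"
proof -
  assume r: "r \<in> R_alg J" and X: "X \<in> NN"
  have "r * X \<in> subalg TV" using R_T[OF r] NN_T[OF X] by (rule subalg_mult)
  then show ?thesis using r X by (simp add: NN_def xi_coeff_mult_left R_XV proj_S_mult proj_S_S I_mult)
qed

lemma NN_I_mult: "r \<in> R_alg J \<Longrightarrow> proj_S n r \<in> I \<Longrightarrow> X \<in> subalg TV \<Longrightarrow> r * X \<in> NN"
proof -
  assume r: "r \<in> R_alg J" "proj_S n r \<in> I" and X: "X \<in> subalg TV"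
  have "r * X \<in> subalg TV" using R_T[OF r(1)] X by (rule subalg_mult)
  then show ?thesis using r X S_commute[OF I_S[OF r(2)]]
    by (simp add: NN_def xi_coeff_mult_left R_XV proj_S_mult proj_S_S I_mult)
qed

text \<open>Elements of I start in degree 2, so their constant terms vanish. The contradiction in
  \<open>koszul_weight\<close> is read off from this.\<close>

lemma NN_eps: "X \<in> NN \<Longrightarrow> xi_only \<nu> \<Longrightarrow> gcoeff X \<nu> = 0"
proof -
  assume "X \<in> NN" "xi_only \<nu>"
  then have "proj_S n (xi_coeff \<nu> X) \<in> I" by (simp add: NN_def)
  then have "0 \<notin> gkeys (proj_S n (xi_coeff \<nu> X))" using I_deg by force
  then have "gcoeff (xi_coeff \<nu> X) 0 = 0" by (simp add: in_gkeys_iff proj_S_gproj)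
  then show ?thesis using \<open>xi_only \<nu>\<close> by (simp add: gcoeff_xi_coeff_0)
qed

lemma D_T: "X \<in> subalg TV \<Longrightarrow> D X \<in> subalg TV"
  by (meson D_subalg Tlv_TV TV_Tlv subalg_mono yy)

lemma D_D_T: "X \<in> subalg TV \<Longrightarrow> D (D X) = 0"
  by (meson D_D TV_Tlv yy)

lemma D_R: "X \<in> R_alg J \<Longrightarrow> D X = d X"
  by (rule der_gD_R)

lemma gD_par_T: "v \<in> TV \<Longrightarrow> gpar (\<not> odd_var v) (gD yy v)"
proof -
  assume "v \<in> TV"
  then obtain r where "(gvar v :: 'k galg) \<in> subalg (Tlv r)" by (meson TV_Tlv subalg_gvar)
  moreover have "Poly_Mapping.single v (Suc 0) \<in> gkeys (gvar v :: 'k galg)"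
    by (simp add: in_gkeys_iff gcoeff_gvar)
  ultimately have "v \<in> Tlv r" by (auto simp: subalg_def)
  then show ?thesis by (rule gD_par[OF yy])
qed

lemma D_mult: "X \<in> subalg TV \<Longrightarrow> Y \<in> subalg TV \<Longrightarrow> D (X * Y) = D X * Y + gsgn X * D Y"
  by (rule der_mult_odd[OF _ _ gD_par_T])

lemma D_S_mult: "s \<in> S_alg n \<Longrightarrow> X \<in> subalg TV \<Longrightarrow> D (s * X) = s * D X"
proof -
  assume s: "s \<in> S_alg n" and X: "X \<in> subalg TV"
  have "gpar False s" using s by (auto simp: gpar_def S_alg_eq subalg_def odd_part_Sv)
  then have "gsgn s = s" by (simp add: gpar_gsgn)
  then show ?thesis using s X by (simp add: D_mult R_T S_R D_R d_S)
qed

text \<open>After the product rule both summands have a coefficient that maps into I: a boundary of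
  R by the chain map property, and the given coefficient up to parity.\<close>

lemma NN_D: assumes "X \<in> NN" shows "D X \<in> NN"
proof -
  have X: "X \<in> subalg TV" using assms by (rule NN_T)
  let ?N = "mon_restr (- XV) ` gkeys X"
  have "D (xi_coeff \<nu> X * gmonom \<nu> 1) \<in> NN" if \<nu>: "\<nu> \<in> ?N" for \<nu>
  proof -
    have xi: "xi_only \<nu>" using \<nu> by auto
    have r: "xi_coeff \<nu> X \<in> R_alg J" using xi X by (rule xi_coeff_R)
    have g: "(gmonom \<nu> 1 :: 'k galg) \<in> subalg TV" using \<nu> X by (rule gmonom_T)
    have p: "proj_S n (xi_coeff \<nu> X) \<in> I" using assms xi by (simp add: NN_def)
    have "D (xi_coeff \<nu> X * gmonom \<nu> 1) = d (xi_coeff \<nu> X) * gmonom \<nu> 1 + gsgn (xi_coeff \<nu> X) * D (gmonom \<nu> 1)"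
      using r g by (simp add: D_mult R_T D_R)
    moreover have "gsgn (xi_coeff \<nu> X) \<in> R_alg J" using r by (simp add: R_alg_eq gsgn_subalg)
    ultimately show ?thesis using r g p
      by (auto intro!: NN_add NN_I_mult d_R proj_d_I D_T simp: proj_S_gsgn)
  qed
  then have "D (\<Sum>\<nu>\<in>?N. xi_coeff \<nu> X * gmonom \<nu> 1) \<in> NN" unfolding der_sum by (rule NN_sum)
  then show ?thesis by (simp add: xi_coeff_expand_self)
qed

lemma fdeg_le_cT: "mon_weight fdeg_var u \<le> - mon_weight cT u"
proof -
  have "mon_weight fdeg_var u + mon_weight cT u \<le> 0"
    unfolding mon_weight_def sum.distrib[symmetric] distrib_left[symmetric]
  proof (rule sum_nonpos)
    fix v show "int (Poly_Mapping.lookup u v) * (fdeg_var v + cT v) \<le> 0"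
      by (cases v) (auto intro: mult_nonneg_nonpos)
  qed
  then show ?thesis by simp
qed

text \<open>A \<xi> of level m has filtration degree m + 1. It is replaced by x, of degree 0, and by
  a correction of degree at most m, because the correction has cohomological degree -m.\<close>

lemma D_basis_fdeg:
  assumes "xi_only \<mu>" "gmonom \<mu> (1 :: 'k) \<in> subalg TV" "admissible \<mu>"
  shows "D (gmonom \<mu> 1) \<in> wspan fdeg_var {..<mon_weight fdeg_var \<mu>}"
proof (rule der_wspan[where V = "TV - XV" and E = "{mon_weight fdeg_var \<mu>}" and G = "\<lambda>v. {..fdeg_var v - 1}"])
  have "\<mu> \<in> gkeys (gmonom \<mu> (1 :: 'k))" using assms(3) by (simp add: in_gkeys_iff gcoeff_gmonom)
  then show "gmonom \<mu> (1 :: 'k) \<in> subalg (TV - XV)"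
    using assms by (intro subalg_gmonom) (auto simp: subalg_def xi_only_def)
  show "gmonom \<mu> (1 :: 'k) \<in> wspan fdeg_var {mon_weight fdeg_var \<mu>}" by (rule gmonom_wspan) simp
  fix v assume "v \<in> TV - XV"
  then obtain m i where v: "v = Xivar m i" "i \<in> J m" by (auto simp: TV_def)
  have "yy m i \<in> wspan cT {- int m}" using yy[of m] v by (simp add: lift_ok_def)
  then have "yy m i \<in> wspan fdeg_var {..int m}"
  proof -
    have "mon_weight fdeg_var u \<le> int m" if "mon_weight cT u = - int m" for u
      using fdeg_le_cT[of u] that by simp
    then show ?thesis using \<open>yy m i \<in> wspan cT {- int m}\<close> by (auto simp: wspan_def kspan_def)
  qed
  then show "gD yy v \<in> wspan fdeg_var {..fdeg_var v - 1}" using v by (auto intro!: wspan_diff gvar_wspan)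
qed auto

text \<open>Differentiating a \<xi>-monomial lowers the filtration degree, so in top degree only the
  differential of the coefficients survives.\<close>

lemma xi_coeff_D_top:
  assumes X: "X \<in> subalg TV" "X \<in> wspan fdeg_var {..N}" and \<nu>: "xi_only \<nu>" "N \<le> mon_weight fdeg_var \<nu>"
  shows "xi_coeff \<nu> (D X) = d (xi_coeff \<nu> X)"
proof -
  let ?N = "mon_restr (- XV) ` gkeys X"
  have "xi_coeff \<nu> (D (xi_coeff \<mu> X * gmonom \<mu> 1)) = (if \<nu> = \<mu> then d (xi_coeff \<nu> X) else 0)" if \<mu>: "\<mu> \<in> ?N" for \<mu>
  proof -
    have xi: "xi_only \<mu>" using \<mu> by auto
    have adm: "admissible \<mu>" using \<mu> by (rule gkeys_restr_admissible)
    have r: "xi_coeff \<mu> X \<in> R_alg J" using xi X(1) by (rule xi_coeff_R)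
    have g: "(gmonom \<mu> 1 :: 'k galg) \<in> subalg TV" using \<mu> X(1) by (rule gmonom_T)
    have le: "mon_weight fdeg_var \<mu> \<le> N" using \<mu> X(2) by (auto simp: fdeg_restr wspan_def kspan_def)
    have s: "gsgn (xi_coeff \<mu> X) \<in> R_alg J" using r by (simp add: R_alg_eq gsgn_subalg)
    have "xi_coeff \<nu> (D (gmonom \<mu> 1)) = 0"
      using D_basis_fdeg[OF xi g adm] \<nu> le unfolding wspan_fdeg_iff by auto
    then have "xi_coeff \<nu> (gsgn (xi_coeff \<mu> X) * D (gmonom \<mu> 1)) = 0"
      using s \<nu> by (simp add: xi_coeff_mult_left R_XV)
    moreover have "D (xi_coeff \<mu> X * gmonom \<mu> 1) = d (xi_coeff \<mu> X) * gmonom \<mu> 1 + gsgn (xi_coeff \<mu> X) * D (gmonom \<mu> 1)"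
      using r g by (simp add: D_mult R_T D_R)
    moreover have "xi_coeff \<nu> (d (xi_coeff \<mu> X) * gmonom \<mu> 1) = (if \<nu> = \<mu> then d (xi_coeff \<mu> X) else 0)"
      using r d_R by (intro xi_coeff_basis \<nu> xi adm R_XV)
    ultimately show ?thesis using \<nu> by (auto simp: xi_coeff_add)
  qed
  then have "xi_coeff \<nu> (D (\<Sum>\<mu>\<in>?N. xi_coeff \<mu> X * gmonom \<mu> 1)) = (\<Sum>\<mu>\<in>?N. if \<nu> = \<mu> then d (xi_coeff \<nu> X) else 0)"
    unfolding der_sum xi_coeff_sum[OF \<nu>(1)] by (rule sum.cong[OF refl])
  also have "\<dots> = d (xi_coeff \<nu> X)" using xi_coeff_outside[OF \<nu>(1), of X] by auto
  finally show ?thesis by (simp add: xi_coeff_expand_self)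
qed

text \<open>The kernel of \<open>T \<rightarrow> A \<otimes> k[\<xi>]\<close> is acyclic, because the kernel of \<open>R \<rightarrow> A\<close> is and the rest of the
  differential lowers the degree in the \<open>\<xi>\<close>.\<close>

lemma NN_acyclic:
  assumes "X \<in> NN" "D X = 0" shows "\<exists>Y\<in>NN. D Y = X"
proof -
  have "X \<in> NN \<Longrightarrow> D X = 0 \<Longrightarrow> X \<in> wspan fdeg_var {..<int N} \<Longrightarrow> \<exists>Y\<in>NN. D Y = X" for N
  proof (induction N arbitrary: X)
    case 0
    have False if "u \<in> gkeys X" for u
      using 0(3) that fdeg_nonneg[of u] by (auto simp: wspan_def kspan_def)
    then have "gkeys X = {}" by blast
    then have "X = 0" by simp
    then show ?case by (intro bexI[of _ 0]) auto
  next
    case (Suc N)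
    have XT: "X \<in> subalg TV" using Suc.prems(1) by (rule NN_T)
    have Xle: "X \<in> wspan fdeg_var {..int N}" using Suc.prems(3) by (rule wspan_mono) auto
    let ?N = "{\<nu> \<in> mon_restr (- XV) ` gkeys X. mon_weight fdeg_var \<nu> = int N}"
    have "\<exists>Y. Y \<in> R_alg J \<and> d Y = xi_coeff \<nu> X \<and> proj_S n Y = 0" if \<nu>: "\<nu> \<in> ?N" for \<nu>
    proof -
      have xi: "xi_only \<nu>" using \<nu> by auto
      have "d (xi_coeff \<nu> X) = 0" using xi_coeff_D_top[OF XT Xle xi] \<nu> Suc.prems(2) xi by simp
      moreover have "proj_S n (xi_coeff \<nu> X) \<in> I" using Suc.prems(1) xi by (simp add: NN_def)
      ultimately show ?thesis using R_exact'[OF xi_coeff_R[OF xi XT]] by blast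
    qed
    then have "\<exists>Y. \<forall>\<nu>\<in>?N. Y \<nu> \<in> R_alg J \<and> d (Y \<nu>) = xi_coeff \<nu> X \<and> proj_S n (Y \<nu>) = 0"
      by (intro bchoice ballI)
    then obtain Y where Y: "\<And>\<nu>. \<nu> \<in> ?N \<Longrightarrow> Y \<nu> \<in> R_alg J \<and> d (Y \<nu>) = xi_coeff \<nu> X \<and> proj_S n (Y \<nu>) = 0"
      by blast
    \<comment> \<open>Primitives of the top coefficients, normalised to project to 0 in S so that
      \<open>Z\<close> lies in \<open>NN\<close> again.\<close>
    define Z where "Z = (\<Sum>\<nu>\<in>?N. Y \<nu> * gmonom \<nu> 1)"
    have ZNN: "Z \<in> NN" unfolding Z_def
      by (intro NN_sum NN_I_mult) (use Y gmonom_T[OF _ XT] in auto)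
    then have ZT: "Z \<in> subalg TV" by (rule NN_T)
    have Zxi: "xi_coeff \<nu> Z = (if \<nu> \<in> ?N then Y \<nu> else 0)" if xi: "xi_only \<nu>" for \<nu>
    proof -
      have "xi_coeff \<nu> Z = (\<Sum>\<mu>\<in>?N. if \<nu> = \<mu> then Y \<mu> else 0)"
        unfolding Z_def xi_coeff_sum[OF xi]
        by (intro sum.cong refl xi_coeff_basis xi) (use Y R_XV in \<open>auto simp: admissible_restr gkeys_admissible\<close>)
      then show ?thesis by simp
    qed
    have Zle: "Z \<in> wspan fdeg_var {..int N}" unfolding wspan_fdeg_iff using Zxi by auto
    have "X - D Z \<in> wspan fdeg_var {..<int N}" unfolding wspan_fdeg_iff
    proof (intro allI impI)
      fix \<nu> assume xi: "xi_only \<nu>" and "mon_weight fdeg_var \<nu> \<notin> {..<int N}"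
      then have ge: "int N \<le> mon_weight fdeg_var \<nu>" by simp
      have e: "xi_coeff \<nu> (X - D Z) = xi_coeff \<nu> X - d (xi_coeff \<nu> Z)"
        using xi_coeff_D_top[OF ZT Zle xi ge] xi by (simp add: xi_coeff_diff)
      show "xi_coeff \<nu> (X - D Z) = 0"
      proof (cases "\<nu> \<in> ?N")
        case True then show ?thesis unfolding e Zxi[OF xi] using Y by simp
      next
        case False
        then have "xi_coeff \<nu> X = 0"
          using xi ge Xle xi_coeff_outside[OF xi, of X] unfolding wspan_fdeg_iff
          by (cases "mon_weight fdeg_var \<nu> = int N") auto
        then show ?thesis unfolding e Zxi[OF xi] using False by auto
      qed
    qed
    moreover have "X - D Z \<in> NN" using Suc.prems(1) ZNN by (intro NN_diff NN_D)
    moreover have "D (X - D Z) = 0" using Suc.prems(2) D_D_T[OF ZT] by (simp add: der_diff)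
    ultimately obtain W where "W \<in> NN" "D W = X - D Z" using Suc.IH by blast
    then show ?case using ZNN by (intro bexI[of _ "W + Z"]) (auto simp: der_add NN_add)
  qed
  moreover have "X \<in> wspan fdeg_var {..<int (Suc (nat (Max (insert 0 (mon_weight fdeg_var ` gkeys X)))))}"
  proof -
    let ?M = "Max (insert 0 (mon_weight fdeg_var ` gkeys X))"
    have "mon_weight fdeg_var u < int (Suc (nat ?M))" if "u \<in> gkeys X" for u
    proof -
      have "mon_weight fdeg_var u \<le> ?M" using that by simp
      then show ?thesis by linarith
    qed
    then show ?thesis by (simp add: wspan_def kspan_def subset_iff)
  qed
  ultimately show ?thesis using assms by blast
qed

text \<open>The long exact sequence of \<open>NN\<close> inside T: acyclicity of \<open>NN\<close>
  corrects a cycle modulo \<open>NN\<close> to a true cycle, and T is acyclic away from the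
  constants.\<close>

lemma exact_mod_NN:
  assumes "X \<in> subalg TV" "D X \<in> NN" "gcoeff X 0 = 0"
  shows "\<exists>e\<in>subalg TV. X - D e \<in> NN"
proof -
  obtain Y where Y: "Y \<in> NN" "D Y = D X" using NN_acyclic[OF assms(2)] D_D_T[OF assms(1)] by blast
  have "\<exists>e\<in>subalg TV. D e = X - Y"
    by (rule T_acyclic) (use assms Y NN_T NN_eps[OF Y(1), of 0] in \<open>auto simp: der_diff subalg_diff\<close>)
  then obtain e where "e \<in> subalg TV" "D e = X - Y" by blast
  then show ?thesis using Y(1) by (intro bexI[of _ e]) auto
qed

text \<open>I is homogeneous and S has cohomological degree 0, so selecting a bidegree selects a
  polynomial degree in each coefficient.\<close>

lemma NN_gproj:
  assumes "X \<in> NN" shows "gproj (\<lambda>u. mon_weight cT u = e \<and> mon_weight iT u = f) X \<in> NN"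
proof -
  let ?P = "\<lambda>u. mon_weight cT u = e \<and> mon_weight iT u = f"
  have "proj_S n (xi_coeff \<nu> (gproj ?P X)) \<in> I" if xi: "xi_only \<nu>" for \<nu>
  proof -
    let ?s = "proj_S n (xi_coeff \<nu> X)"
    have s: "?s \<in> I" using assms xi by (simp add: NN_def)
    have "proj_S n (xi_coeff \<nu> (gproj ?P X)) = gproj (\<lambda>u. ?P (u + \<nu>)) ?s"
      by (rule galg_eqI) (auto simp: proj_S_gproj gcoeff_xi_coeff xi)
    also have "\<dots> = gproj (\<lambda>u. mon_weight (\<lambda>_. 1) u = f - mon_weight iT \<nu> \<and> mon_weight cT \<nu> = e) ?s"
    proof (rule gproj_cong)
      fix u assume "u \<in> gkeys ?s"
      then have k: "Poly_Mapping.keys u \<subseteq> Sv" using proj_S_S[of "xi_coeff \<nu> X"] by (auto simp: S_alg_eq subalg_def)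
      have "mon_weight cT u = 0" unfolding mon_weight_def using k by (intro sum.neutral) (auto simp: Sv_def)
      moreover have "mon_weight iT u = mon_weight (\<lambda>_. 1) u" unfolding mon_weight_def
        using k by (intro sum.cong) (auto simp: Sv_def wt0 J0)
      ultimately show "?P (u + \<nu>) \<longleftrightarrow> mon_weight (\<lambda>_. 1) u = f - mon_weight iT \<nu> \<and> mon_weight cT \<nu> = e"
        by (auto simp: mon_weight_add)
    qed
    also have "\<dots> = (if mon_weight cT \<nu> = e then gproj (\<lambda>u. mon_weight (\<lambda>_. 1) u = f - mon_weight iT \<nu>) ?s else 0)"
      by (auto intro: gproj_none)
    finally show ?thesis using I_gproj[OF s] by simp
  qed
  then show ?thesis using assms by (auto simp: NN_def intro: gproj_subalg)
qed

end

subsection \<open>Comparison with the linear resolution\<close>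

context minimal_model begin

lemma xi_lift:
  fixes E :: "gmon \<Rightarrow> 'k galg"
  assumes "finite N" "\<And>\<nu>. \<nu> \<in> N \<Longrightarrow> xi_only \<nu> \<and> admissible \<nu> \<and> E \<nu> \<in> S_alg n" "xi_only \<mu>"
  shows "xi_coeff \<mu> (\<Sum>\<nu>\<in>N. E \<nu> * gmonom \<nu> 1) = (if \<mu> \<in> N then E \<mu> else 0)"
proof -
  have "xi_coeff \<mu> (\<Sum>\<nu>\<in>N. E \<nu> * gmonom \<nu> 1) = (\<Sum>\<nu>\<in>N. if \<mu> = \<nu> then E \<nu> else 0)"
    unfolding xi_coeff_sum[OF assms(3)]
  proof (intro sum.cong refl)
    fix \<nu> assume "\<nu> \<in> N"
    then have "xi_only \<nu>" "admissible \<nu>" "E \<nu> \<in> subalg XV" using assms(2) R_XV S_R by blast+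
    then show "xi_coeff \<mu> (E \<nu> * gmonom \<nu> 1) = (if \<mu> = \<nu> then E \<nu> else 0)"
      by (intro xi_coeff_basis assms(3))
  qed
  then show ?thesis using assms(1) by simp
qed

lemma S_XV: "s \<in> S_alg n \<Longrightarrow> s \<in> subalg XV"
  using R_XV S_R by blast

lemma proj_xi_sum:
  fixes M c :: "nat \<Rightarrow> 'k galg"
  assumes "xi_only \<nu>" "\<And>j. j < k \<Longrightarrow> M j \<in> S_alg n"
  shows "proj_S n (xi_coeff \<nu> (\<Sum>j<k. M j * c j)) = (\<Sum>j<k. M j * proj_S n (xi_coeff \<nu> (c j)))"
  unfolding xi_coeff_sum[OF assms(1)] proj_S_linear
  using assms by (intro sum.cong) (auto simp: xi_coeff_mult_left S_XV proj_S_mult proj_S_id)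

lemma S_T: "s \<in> S_alg n \<Longrightarrow> s \<in> subalg TV"
  by (rule R_T[OF S_R])

text \<open>Linear systems over A are solved separately in each \<xi>-coefficient, and the finitely
  many solutions are reassembled along the \<xi>-monomials.\<close>

lemma S_linear_lift:
  fixes k l :: nat and c :: "nat \<Rightarrow> 'k galg" and M :: "nat \<Rightarrow> nat \<Rightarrow> 'k galg"
  assumes c: "\<And>j. j < k \<Longrightarrow> c j \<in> subalg TV"
    and M: "\<And>j i. j < k \<Longrightarrow> i < l \<Longrightarrow> M j i \<in> S_alg n"
    and sol: "\<And>\<nu>. xi_only \<nu> \<Longrightarrow> \<exists>e. (\<forall>i<l. e i \<in> S_alg n) \<and>
       (\<forall>j<k. proj_S n (xi_coeff \<nu> (c j)) - (\<Sum>i<l. M j i * e i) \<in> I)"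
  shows "\<exists>e. (\<forall>i<l. e i \<in> subalg TV) \<and> (\<forall>j<k. c j - (\<Sum>i<l. M j i * e i) \<in> NN)"
proof -
  define N where "N = (\<Union>j<k. mon_restr (- XV) ` gkeys (c j))"
  have fin: "finite N" by (simp add: N_def)
  have N: "xi_only \<nu>" "admissible \<nu>" "(gmonom \<nu> 1 :: 'k galg) \<in> subalg TV" if "\<nu> \<in> N" for \<nu>
  proof -
    from that obtain j where j: "j < k" "\<nu> \<in> mon_restr (- XV) ` gkeys (c j)" by (auto simp: N_def)
    from j(2) show "xi_only \<nu>" by auto
    from j(2) show "admissible \<nu>" by (rule gkeys_restr_admissible)
    from j(2) c[OF j(1)] show "(gmonom \<nu> 1 :: 'k galg) \<in> subalg TV" by (rule gmonom_T)
  qed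
  have "\<exists>E. \<forall>\<nu>\<in>N. (\<forall>i<l. E \<nu> i \<in> S_alg n) \<and>
       (\<forall>j<k. proj_S n (xi_coeff \<nu> (c j)) - (\<Sum>i<l. M j i * E \<nu> i) \<in> I)"
    using sol N(1) by (intro bchoice ballI) blast
  then obtain E where E: "\<And>\<nu> i. \<nu> \<in> N \<Longrightarrow> i < l \<Longrightarrow> E \<nu> i \<in> S_alg n"
    "\<And>\<nu> j. \<nu> \<in> N \<Longrightarrow> j < k \<Longrightarrow> proj_S n (xi_coeff \<nu> (c j)) - (\<Sum>i<l. M j i * E \<nu> i) \<in> I" by blast
  define e where "e i = (\<Sum>\<nu>\<in>N. E \<nu> i * gmonom \<nu> 1)" for i
  have eT: "e i \<in> subalg TV" if "i < l" for i
    unfolding e_def using N E(1) that by (intro subalg_sum subalg_mult) (auto intro: S_T)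
  have exi: "proj_S n (xi_coeff \<nu> (e i)) = (if \<nu> \<in> N then E \<nu> i else 0)" if "i < l" "xi_only \<nu>" for i \<nu>
    using xi_lift[OF fin, of "\<lambda>\<nu>. E \<nu> i" \<nu>] that N E(1) by (auto simp: e_def proj_S_id)
  have "c j - (\<Sum>i<l. M j i * e i) \<in> NN" if j: "j < k" for j
    unfolding NN_def
  proof (intro CollectI conjI allI impI)
    show "c j - (\<Sum>i<l. M j i * e i) \<in> subalg TV"
      using c[OF j] eT M[OF j] by (intro subalg_diff subalg_sum subalg_mult) (auto intro: S_T)
    fix \<nu> assume xi: "xi_only \<nu>"
    have "proj_S n (xi_coeff \<nu> (c j - (\<Sum>i<l. M j i * e i)))
        = proj_S n (xi_coeff \<nu> (c j)) - (\<Sum>i<l. M j i * proj_S n (xi_coeff \<nu> (e i)))"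
      using xi M[OF j] by (simp add: xi_coeff_diff proj_S_linear(2) proj_xi_sum)
    also have "\<dots> \<in> I"
    proof (cases "\<nu> \<in> N")
      case True
      then have "(\<Sum>i<l. M j i * proj_S n (xi_coeff \<nu> (e i))) = (\<Sum>i<l. M j i * E \<nu> i)"
        using exi xi by (intro sum.cong) auto
      then show ?thesis using E(2)[OF True j] by simp
    next
      case False
      then have "\<nu> \<notin> mon_restr (- XV) ` gkeys (c j)" using j by (auto simp: N_def)
      then have "xi_coeff \<nu> (c j) = 0" by (rule xi_coeff_outside[OF xi])
      moreover have "(\<Sum>i<l. M j i * proj_S n (xi_coeff \<nu> (e i))) = 0"
        using exi xi False by (intro sum.neutral) auto
      ultimately show ?thesis by simp
    qed
    finally show "proj_S n (xi_coeff \<nu> (c j - (\<Sum>i<l. M j i * e i))) \<in> I" .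
  qed
  then show ?thesis using eT by blast
qed

end

locale koszul_minimal_model = minimal_model +
  fixes b :: "nat \<Rightarrow> nat" and M :: "nat \<Rightarrow> nat \<Rightarrow> nat \<Rightarrow> 'a galg"
  assumes b0: "b 0 = 1"
    and M1: "\<And>t i j. i < b t \<Longrightarrow> j < b (Suc t) \<Longrightarrow> M t i j \<in> S_deg n 1"
    and M_aug: "\<And>a. a \<in> S_alg n \<Longrightarrow> gcoeff a 0 = 0 \<longleftrightarrow>
           (\<exists>c. (\<forall>j<b 1. c j \<in> S_alg n) \<and> a - (\<Sum>j<b 1. M 0 0 j * c j) \<in> I)"
    and M_exact: "\<And>t c. (\<forall>j<b (Suc t). c j \<in> S_alg n) \<Longrightarrow>
           (\<forall>i<b t. (\<Sum>j<b (Suc t). M t i j * c j) \<in> I) \<longleftrightarrow>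
            (\<exists>e. (\<forall>l<b (Suc (Suc t)). e l \<in> S_alg n) \<and>
                 (\<forall>j<b (Suc t). c j - (\<Sum>l<b (Suc (Suc t)). M (Suc t) j l * e l) \<in> I))"
begin

lemma M_S: "i < b t \<Longrightarrow> j < b (Suc t) \<Longrightarrow> M t i j \<in> S_alg n"
  using M1 by (auto simp: S_deg_def)

lemma M_T: "i < b t \<Longrightarrow> j < b (Suc t) \<Longrightarrow> M t i j \<in> subalg TV"
  using M_S R_T S_R by blast

lemma M_eps: "i < b t \<Longrightarrow> j < b (Suc t) \<Longrightarrow> gcoeff (M t i j) 0 = 0"
proof -
  assume "i < b t" "j < b (Suc t)"
  then have "homogeneous (\<lambda>_. 1) 1 (M t i j)" using M1 by (auto simp: S_deg_def)
  then have "0 \<notin> gkeys (M t i j)" by (auto simp: homogeneous_def)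
  then show ?thesis by (simp add: in_gkeys_iff)
qed

lemma M_sum_T: "i < b t \<Longrightarrow> (\<And>j. j < b (Suc t) \<Longrightarrow> c j \<in> subalg TV) \<Longrightarrow> (\<Sum>j<b (Suc t). M t i j * c j) \<in> subalg TV"
  by (intro subalg_sum subalg_mult) (auto intro: M_T)

lemma D_M_sum: "i < b t \<Longrightarrow> (\<And>j. j < b (Suc t) \<Longrightarrow> c j \<in> subalg TV) \<Longrightarrow>
   D (\<Sum>j<b (Suc t). M t i j * c j) = (\<Sum>j<b (Suc t). M t i j * D (c j))"
  unfolding der_sum by (intro sum.cong) (auto simp: D_S_mult M_S)

lemma NN_M_sum: "i < b t \<Longrightarrow> (\<And>j. j < b (Suc t) \<Longrightarrow> c j \<in> NN) \<Longrightarrow> (\<Sum>j<b (Suc t). M t i j * c j) \<in> NN"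
  by (intro NN_sum NN_mult S_R) (auto intro: M_S)

lemma NN_exact:
  assumes c: "\<And>j. j < b (Suc t) \<Longrightarrow> c j \<in> subalg TV"
    and "\<And>i. i < b t \<Longrightarrow> (\<Sum>j<b (Suc t). M t i j * c j) \<in> NN"
  shows "\<exists>e. (\<forall>l<b (Suc (Suc t)). e l \<in> subalg TV) \<and>
     (\<forall>j<b (Suc t). c j - (\<Sum>l<b (Suc (Suc t)). M (Suc t) j l * e l) \<in> NN)"
proof (rule S_linear_lift[OF c])
  fix \<nu> assume xi: "xi_only \<nu>"
  have "(\<Sum>j<b (Suc t). M t i j * proj_S n (xi_coeff \<nu> (c j))) \<in> I" if "i < b t" for i
    using assms(2)[OF that] xi that by (simp add: NN_def proj_xi_sum M_S)
  then have "\<forall>i<b t. (\<Sum>j<b (Suc t). M t i j * proj_S n (xi_coeff \<nu> (c j))) \<in> I" by simp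
  moreover have "\<forall>j<b (Suc t). proj_S n (xi_coeff \<nu> (c j)) \<in> S_alg n" by (simp add: proj_S_S)
  ultimately show "\<exists>e. (\<forall>i<b (Suc (Suc t)). e i \<in> S_alg n) \<and>
     (\<forall>j<b (Suc t). proj_S n (xi_coeff \<nu> (c j)) - (\<Sum>i<b (Suc (Suc t)). M (Suc t) j i * e i) \<in> I)"
    using iffD1[OF M_exact] by simp
qed (auto intro: M_S)

text \<open>That consecutive matrices compose to zero modulo I is contained in
  \<open>M_exact\<close>, read from right to left.\<close>

lemma NN_complex:
  assumes e: "\<And>l. l < b (Suc (Suc t)) \<Longrightarrow> e l \<in> subalg TV" and i: "i < b t"
  shows "(\<Sum>j<b (Suc t). M t i j * (\<Sum>l<b (Suc (Suc t)). M (Suc t) j l * e l)) \<in> NN"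
  unfolding NN_def
proof (intro CollectI conjI allI impI)
  show "(\<Sum>j<b (Suc t). M t i j * (\<Sum>l<b (Suc (Suc t)). M (Suc t) j l * e l)) \<in> subalg TV"
    using i e by (intro M_sum_T)
  fix \<nu> assume xi: "xi_only \<nu>"
  let ?e = "\<lambda>l. proj_S n (xi_coeff \<nu> (e l))"
  let ?c = "\<lambda>j. \<Sum>l<b (Suc (Suc t)). M (Suc t) j l * ?e l"
  have c: "\<forall>j<b (Suc t). ?c j \<in> S_alg n"
    unfolding S_alg_eq
    by (intro allI impI subalg_sum subalg_mult) (auto simp: S_alg_eq[symmetric] M_S proj_S_S)
  have "\<exists>e. (\<forall>l<b (Suc (Suc t)). e l \<in> S_alg n) \<and>
     (\<forall>j<b (Suc t). ?c j - (\<Sum>l<b (Suc (Suc t)). M (Suc t) j l * e l) \<in> I)"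
    by (rule exI[of _ ?e]) (simp add: proj_S_S)
  then have "(\<Sum>j<b (Suc t). M t i j * ?c j) \<in> I"
    using iffD2[OF M_exact[OF c]] i by blast
  moreover have "proj_S n (xi_coeff \<nu> (\<Sum>j<b (Suc t). M t i j * (\<Sum>l<b (Suc (Suc t)). M (Suc t) j l * e l)))
     = (\<Sum>j<b (Suc t). M t i j * ?c j)"
    using i by (subst proj_xi_sum) (auto intro!: sum.cong simp: xi M_S proj_xi_sum)
  ultimately show "proj_S n (xi_coeff \<nu> (\<Sum>j<b (Suc t). M t i j * (\<Sum>l<b (Suc (Suc t)). M (Suc t) j l * e l))) \<in> I"
    by simp
qed

text \<open>The hypothesis says that no \<xi>-coefficient has a constant term, and by
  \<open>M_aug\<close> the entries of the first matrix generate that augmentation ideal modulo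
  I.\<close>

lemma NN_aug:
  assumes a: "a \<in> subalg TV" "\<And>\<nu>. xi_only \<nu> \<Longrightarrow> gcoeff a \<nu> = 0"
  shows "\<exists>e. (\<forall>l<b 1. e l \<in> subalg TV) \<and> a - (\<Sum>l<b 1. M 0 0 l * e l) \<in> NN"
proof -
  have "\<exists>e. (\<forall>l<b 1. e l \<in> subalg TV) \<and> (\<forall>j<(1::nat). a - (\<Sum>l<b 1. M 0 0 l * e l) \<in> NN)"
  proof (rule S_linear_lift[where c = "\<lambda>_. a" and M = "\<lambda>_. M 0 0"])
    fix \<nu> assume xi: "xi_only \<nu>"
    have "gcoeff (proj_S n (xi_coeff \<nu> a)) 0 = 0"
      using a(2)[OF xi] xi by (simp add: proj_S_gproj gcoeff_xi_coeff_0)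
    then show "\<exists>e. (\<forall>i<b 1. e i \<in> S_alg n) \<and> (\<forall>j<(1::nat). proj_S n (xi_coeff \<nu> a) - (\<Sum>i<b 1. M 0 0 i * e i) \<in> I)"
      using M_aug[OF proj_S_S] by blast
  qed (use a(1) M_S b0 in auto)
  then show ?thesis by blast
qed

definition bihom :: "int \<Rightarrow> int \<Rightarrow> 'a galg \<Rightarrow> bool" where
  "bihom e f X \<longleftrightarrow> X \<in> wspan cT {e} \<and> X \<in> wspan iT {f}"

lemma gproj_bihom: "bihom e f X \<Longrightarrow> gproj (\<lambda>u. mon_weight cT u = e \<and> mon_weight iT u = f) X = X"
  by (rule gproj_id) (auto simp: bihom_def wspan_def kspan_def)

lemma bihom_gproj: "bihom e f (gproj (\<lambda>u. mon_weight cT u = e \<and> mon_weight iT u = f) X)"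
  by (auto simp: bihom_def wspan_def kspan_def gkeys_gproj)

lemma bihom_D: "X \<in> subalg TV \<Longrightarrow> bihom e f X \<Longrightarrow> bihom (e + 1) f (D X)"
  unfolding bihom_def by (meson D_cT D_iT TV_Tlv yy)

lemma gproj_M:
  assumes "i < b t" "j < b (Suc t)"
  shows "gproj (\<lambda>u. mon_weight cT u = e \<and> mon_weight iT u = f) (M t i j * X)
     = M t i j * gproj (\<lambda>u. mon_weight cT u = e \<and> mon_weight iT u = f - 1) X"
proof (rule gproj_mult_left)
  fix u v assume u: "u \<in> gkeys (M t i j)"
  then have k: "Poly_Mapping.keys u \<subseteq> Sv" using M_S[OF assms] by (auto simp: S_alg_eq subalg_def)
  have "mon_weight (\<lambda>_. 1) u = 1" using M1[OF assms] u by (auto simp: S_deg_def homogeneous_def)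
  moreover have "mon_weight cT u = 0" unfolding mon_weight_def using k by (intro sum.neutral) (auto simp: Sv_def)
  moreover have "mon_weight iT u = mon_weight (\<lambda>_. 1) u" unfolding mon_weight_def
    using k by (intro sum.cong) (auto simp: Sv_def wt0 J0)
  ultimately show "(mon_weight cT (u + v) = e \<and> mon_weight iT (u + v) = f) \<longleftrightarrow> (mon_weight cT v = e \<and> mon_weight iT v = f - 1)"
    by (auto simp: mon_weight_add)
qed

lemma bihom_eps: "bihom e f X \<Longrightarrow> e \<noteq> 0 \<or> f \<noteq> 0 \<Longrightarrow> gcoeff X 0 = 0"
  by (rule ccontr) (auto simp: bihom_def wspan_def kspan_def in_gkeys_iff subset_iff)

lemma bihom_pos: "bihom e f X \<Longrightarrow> e > 0 \<Longrightarrow> X = 0"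
proof -
  assume X: "bihom e f X" and e: "e > 0"
  have False if "u \<in> gkeys X" for u
    using X e that fdeg_le_cT[of u] fdeg_nonneg[of u] by (auto simp: bihom_def wspan_def kspan_def)
  then show ?thesis by (metis gkeys_eq_empty_iff ex_in_conv)
qed

text \<open>A staircase in the double complex \<open>T \<otimes> K\<close>, with \<open>K\<close> the linear resolution: going down along \<open>K\<close>
  one arrives at an element of cohomological degree 0, which is a boundary since its internal degree
  is not 0; then one goes back up.\<close>

lemma staircase:
  assumes z: "z \<in> subalg TV" "bihom (- int m - 1) w z" "w \<noteq> int m + 1"
    and Dz: "\<And>\<nu>. xi_only \<nu> \<Longrightarrow> gcoeff (D z) \<nu> = 0"
  shows "\<exists>e e'. e \<in> subalg TV \<and> (\<forall>l<b 1. e' l \<in> subalg TV) \<and> z - (\<Sum>l<b 1. M 0 0 l * e' l) - D e \<in> NN"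
proof -
  \<comment> \<open>As the matrices consist of linear forms, each step lowers the internal degree
    and raises the cohomological degree by one. The last clause is the syzygy condition that permits
    the next step.\<close>
  define inv where "inv t x \<longleftrightarrow> (\<forall>i<b t. x i \<in> subalg TV \<and> bihom (int t - int m - 1) (w - int t) (x i)) \<and>
     (case t of 0 \<Rightarrow> x 0 = z | Suc s \<Rightarrow> \<forall>i<b s. (\<Sum>j<b t. M s i j * D (x j)) \<in> NN)" for t x
  define rel where "rel t x x' \<longleftrightarrow> (\<forall>i<b t. D (x i) - (\<Sum>j<b (Suc t). M t i j * x' j) \<in> NN)" for t x x'
  have step: "\<exists>x'. inv (Suc t) x' \<and> rel t x x'" if x: "inv t x" for t x
  proof -
    have xT: "x i \<in> subalg TV" and xb: "bihom (int t - int m - 1) (w - int t) (x i)" if "i < b t" for i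
      using x that by (auto simp: inv_def)
    have "\<exists>x'. (\<forall>j<b (Suc t). x' j \<in> subalg TV) \<and> rel t x x'"
    proof (cases t)
      case 0
      then have "x 0 = z" using x by (simp add: inv_def)
      then show ?thesis using NN_aug[OF D_T[OF z(1)] Dz] 0 b0 by (simp add: rel_def)
    next
      case (Suc s)
      then have "\<And>i. i < b s \<Longrightarrow> (\<Sum>j<b (Suc s). M s i j * D (x j)) \<in> NN" using x by (simp add: inv_def)
      then show ?thesis using NN_exact[of s "\<lambda>j. D (x j)"] D_T[OF xT] Suc by (simp add: rel_def)
    qed
    then obtain x' where x': "\<And>j. j < b (Suc t) \<Longrightarrow> x' j \<in> subalg TV" "rel t x x'" by blast
    let ?P = "\<lambda>f u. mon_weight cT u = int t - int m \<and> mon_weight iT u = f"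
    \<comment> \<open>Only the component of the expected bidegree is kept; the relation survives
      because the matrix entries are homogeneous.\<close>
    define x'' where "x'' j = gproj (?P (w - int t - 1)) (x' j)" for j
    have x''T: "x'' j \<in> subalg TV" if "j < b (Suc t)" for j using x'(1)[OF that] by (simp add: x''_def gproj_subalg)
    have r: "rel t x x''" unfolding rel_def
    proof (intro allI impI)
      fix i assume i: "i < b t"
      have "gproj (?P (w - int t)) (D (x i) - (\<Sum>j<b (Suc t). M t i j * x' j)) \<in> NN"
        using x'(2) i by (intro NN_gproj) (simp add: rel_def)
      moreover have "gproj (?P (w - int t)) (D (x i)) = D (x i)"
        using gproj_bihom[OF bihom_D[OF xT[OF i] xb[OF i]]] by simp
      moreover have "gproj (?P (w - int t)) (\<Sum>j<b (Suc t). M t i j * x' j) = (\<Sum>j<b (Suc t). M t i j * x'' j)"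
        unfolding gproj_sum using i by (intro sum.cong) (auto simp: gproj_M x''_def)
      ultimately show "D (x i) - (\<Sum>j<b (Suc t). M t i j * x'' j) \<in> NN" by (simp add: gproj_diff)
    qed
    \<comment> \<open>Applying \<open>D\<close> to the relation kills \<open>D (D (x i))\<close> and
      leaves the syzygy condition for the next step.\<close>
    have "(\<Sum>j<b (Suc t). M t i j * D (x'' j)) \<in> NN" if i: "i < b t" for i
    proof -
      have "D (D (x i) - (\<Sum>j<b (Suc t). M t i j * x'' j)) \<in> NN"
        using r i by (intro NN_D) (simp add: rel_def)
      then have "0 - (\<Sum>j<b (Suc t). M t i j * D (x'' j)) \<in> NN"
        using D_D_T[OF xT[OF i]] by (simp add: der_diff D_M_sum[OF i x''T])
      from NN_diff[OF NN_0 this] show ?thesis by simp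
    qed
    moreover have "bihom (int t - int m) (w - int t - 1) (x'' j)" for j
      unfolding x''_def by (rule bihom_gproj)
    ultimately have "inv (Suc t) x''" using x''T by (simp add: inv_def diff_diff_eq add.commute)
    with r show ?thesis by blast
  qed
  have "inv 0 (\<lambda>_. z)" using z b0 by (simp add: inv_def)
  then have "\<exists>f. \<forall>t. inv t (f t) \<and> rel t (f t) (f (Suc t))"
    using step by (intro dependent_nat_choice) auto
  then obtain f where f: "\<And>t. inv t (f t)" "\<And>t. rel t (f t) (f (Suc t))" by blast
  have fT: "f t i \<in> subalg TV" and fb: "bihom (int t - int m - 1) (w - int t) (f t i)" if "i < b t" for t i
    using f(1)[of t] that by (auto simp: inv_def)
  define up where "up t \<longleftrightarrow> (\<exists>e e'. (\<forall>j<b t. e j \<in> subalg TV) \<and> (\<forall>l<b (Suc t). e' l \<in> subalg TV) \<and>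
     (\<forall>j<b t. f t j - (\<Sum>l<b (Suc t). M t j l * e' l) - D (e j) \<in> NN))" for t
  \<comment> \<open>At step m + 1 the cohomological degree is 0, so the entries are cycles, and the
    internal degree w - m - 1 is nonzero, so they have no constant term.\<close>
  have "up (Suc m)"
  proof -
    have "\<exists>e\<in>subalg TV. f (Suc m) j - D e \<in> NN" if j: "j < b (Suc m)" for j
    proof (rule exact_mod_NN[OF fT[OF j]])
      have "D (f (Suc m) j) = 0"
        using bihom_pos[OF bihom_D[OF fT[OF j] fb[OF j]]] by simp
      then show "D (f (Suc m) j) \<in> NN" by simp
      show "gcoeff (f (Suc m) j) 0 = 0" using bihom_eps[OF fb[OF j]] z(3) by simp
    qed
    then have "\<exists>e. \<forall>j<b (Suc m). e j \<in> subalg TV \<and> f (Suc m) j - D (e j) \<in> NN" by metis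
    then obtain e where "\<forall>j<b (Suc m). e j \<in> subalg TV \<and> f (Suc m) j - D (e j) \<in> NN" by blast
    then show ?thesis unfolding up_def by (intro exI[of _ e] exI[of _ "\<lambda>_. 0"]) simp
  qed
  note up_last = this
  have up_step: "up t" if t: "t \<le> m" "up (Suc t)" for t
  proof -
    from t(2) obtain e e' where e: "\<And>j. j < b (Suc t) \<Longrightarrow> e j \<in> subalg TV"
      and e': "\<And>l. l < b (Suc (Suc t)) \<Longrightarrow> e' l \<in> subalg TV"
      and ee': "\<And>j. j < b (Suc t) \<Longrightarrow> f (Suc t) j - (\<Sum>l<b (Suc (Suc t)). M (Suc t) j l * e' l) - D (e j) \<in> NN"
      unfolding up_def by blast
    \<comment> \<open>Subtracting the combination of the \<open>e j\<close> turns
      \<open>f t i\<close> into a cycle modulo \<open>NN\<close>, by the relation to the next step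
      and \<open>NN_complex\<close>.\<close>
    have "\<exists>g\<in>subalg TV. (f t i - (\<Sum>j<b (Suc t). M t i j * e j)) - D g \<in> NN" if i: "i < b t" for i
    proof (rule exact_mod_NN)
      show "f t i - (\<Sum>j<b (Suc t). M t i j * e j) \<in> subalg TV"
        using fT[OF i] M_sum_T[OF i e] by (rule subalg_diff)
      have "gcoeff (f t i) 0 = 0" using bihom_eps[OF fb[OF i]] t(1) by simp
      then show "gcoeff (f t i - (\<Sum>j<b (Suc t). M t i j * e j)) 0 = 0"
        using i by (auto simp: gcoeff_sum gcoeff_mult_0 M_eps)
      let ?s1 = "\<Sum>j<b (Suc t). M t i j * f (Suc t) j"
      let ?s2 = "\<Sum>j<b (Suc t). M t i j * (\<Sum>l<b (Suc (Suc t)). M (Suc t) j l * e' l)"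
      let ?s3 = "\<Sum>j<b (Suc t). M t i j * D (e j)"
      have "?s1 - ?s2 - ?s3 \<in> NN"
        using NN_M_sum[OF i ee'] by (simp add: sum_subtractf right_diff_distrib)
      moreover have "?s2 \<in> NN" by (rule NN_complex[OF e' i])
      moreover have "D (f t i) - ?s1 \<in> NN" using f(2)[of t] i by (simp add: rel_def)
      ultimately have "(?s1 - ?s2 - ?s3) + ?s2 + (D (f t i) - ?s1) \<in> NN" by (intro NN_add)
      moreover have "(?s1 - ?s2 - ?s3) + ?s2 + (D (f t i) - ?s1) = D (f t i) - ?s3" by simp
      ultimately show "D (f t i - (\<Sum>j<b (Suc t). M t i j * e j)) \<in> NN"
        by (simp add: der_diff D_M_sum[OF i e])
    qed
    then have "\<exists>g. \<forall>i<b t. g i \<in> subalg TV \<and> (f t i - (\<Sum>j<b (Suc t). M t i j * e j)) - D (g i) \<in> NN" by metis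
    then obtain g where "\<forall>i<b t. g i \<in> subalg TV \<and> (f t i - (\<Sum>j<b (Suc t). M t i j * e j)) - D (g i) \<in> NN" by blast
    then show ?thesis unfolding up_def using e by (intro exI[of _ g] exI[of _ e]) simp
  qed
  have "up t" if "t \<le> Suc m" for t
    using that by (induction rule: inc_induct) (auto intro: up_last up_step)
  then have "up 0" by simp
  then show ?thesis using f(1)[of 0] b0 by (auto simp: up_def inv_def)
qed

end

subsection \<open>The differential is quadratic\<close>

context minimal_model begin

lemma yy_eq: "i \<in> J m \<Longrightarrow> yy m i \<in> subalg (Tlv m)" "i \<in> J m \<Longrightarrow> yy m i \<in> wspan cT {- int m}"
  "i \<in> J m \<Longrightarrow> yy m i \<in> wspan iT {wt m i}" "i \<in> J m \<Longrightarrow> D (yy m i) = gd (Xvar m i)"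
  using yy[of m] by (auto simp: lift_ok_def)

lemma gcoeff_wspan: "X \<in> wspan w {e} \<Longrightarrow> gcoeff X u \<noteq> 0 \<Longrightarrow> mon_weight w u = e"
  by (auto simp: wspan_def kspan_def in_gkeys_iff)

lemma single_eq_iff: "Poly_Mapping.single v (Suc 0) = (Poly_Mapping.single w (Suc 0) :: gmon) \<longleftrightarrow> v = w"
  by (metis lookup_single_eq lookup_single_not_eq nat.simps(3))

text \<open>The lifts \<open>yy\<close> have no linear part that could cancel a variable \<open>\<xi>\<close>: otherwise
  \<open>\<partial>x\<close> would have a linear part.\<close>

lemma yy_lin:
  assumes "m \<ge> 1" "k \<in> J l"
  shows "gcoeff (yy l k) (Poly_Mapping.single (Xivar m i) (Suc 0)) = 0"
proof (cases "l = m + 1 \<and> i \<in> J m")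
  case False
  show ?thesis
  proof (rule ccontr)
    assume nz: "gcoeff (yy l k) (Poly_Mapping.single (Xivar m i) (Suc 0)) \<noteq> 0"
    have "l = m + 1" using gcoeff_wspan[OF yy_eq(2)[OF assms(2)] nz] by simp
    moreover have "i \<in> J m"
      using subalg_gcoeff_single[OF yy_eq(1)[OF assms(2)], of "Xivar m i"] nz by (auto simp: Tlv_def)
    ultimately show False using False by simp
  qed
next
  case True
  let ?s = "\<lambda>v. Poly_Mapping.single v (Suc 0)"
  \<comment> \<open>Among the variables involved only \<open>Xivar m i\<close> has a differential
    with a linear term in \<open>Xvar m i\<close>, so the coefficient in question appears as a
    linear coefficient of \<partial>x.\<close>
  have g0: "gcoeff (gD yy v) (?s (Xvar m i)) = (if v = Xivar m i then 1 else 0)" if v: "v \<in> Tlv l" for v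
  proof -
    obtain r j where r: "r < l" "j \<in> J r" "v \<in> {Xvar r j, Xivar r j}" using v by (rule TlvE)
    show ?thesis
    proof (cases "v = Xvar r j")
      case True then show ?thesis using assms(1) by (simp add: gd_lin)
    next
      case False
      then have v: "v = Xivar r j" using r by simp
      have "gcoeff (yy r j) (?s (Xvar m i)) = 0"
        by (rule subalg_gcoeff_single[OF yy_eq(1)[OF r(2)]]) (use r True in \<open>auto simp: Tlv_def\<close>)
      then show ?thesis unfolding v by (auto simp: gcoeff_gvar single_eq_iff)
    qed
  qed
  have "gcoeff (D (yy l k)) (?s (Xvar m i))
      = (\<Sum>v\<in>Tlv l. gcoeff (gD yy v) (?s (Xvar m i)) * gcoeff (yy l k) (?s v))"
    by (rule gcoeff_der_single[OF yy_eq(1)[OF assms(2)] finite_Tlv gD_eps[OF yy]])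
  also have "\<dots> = (\<Sum>v\<in>Tlv l. if v = Xivar m i then gcoeff (yy l k) (?s v) else 0)"
    by (intro sum.cong) (auto simp: g0)
  also have "\<dots> = gcoeff (yy l k) (?s (Xivar m i))"
  proof -
    have "Xivar m i \<in> Tlv l" using True by (simp add: Tlv_def)
    then show ?thesis by (simp add: sum.delta)
  qed
  finally show ?thesis using assms by (simp add: yy_eq gd_lin)
qed

text \<open>The values of \<open>D\<close> on variables have no linear \<xi>-term of positive level:
  \<partial>x contains no \<xi> at all, and for the corrections this is
  \<open>yy_lin\<close>.\<close>

lemma D_lin:
  assumes "m \<ge> 1" "X \<in> subalg TV"
  shows "gcoeff (D X) (Poly_Mapping.single (Xivar m i) (Suc 0)) = 0"
proof -
  obtain r where r: "X \<in> subalg (Tlv r)" using TV_Tlv[OF assms(2)] .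
  have "gcoeff (gD yy v) (Poly_Mapping.single (Xivar m i) (Suc 0)) = 0" if "v \<in> Tlv r" for v
  proof -
    obtain l k where l: "l < r" "k \<in> J l" "v \<in> {Xvar l k, Xivar l k}"
      by (rule TlvE[OF \<open>v \<in> Tlv r\<close>])
    have "gcoeff (gd (Xvar l k)) (Poly_Mapping.single (Xivar m i) (Suc 0)) = 0"
      using gd_R[of "Xvar l k"] by (intro subalg_gcoeff_single[of _ Rv]) (auto simp: R_alg_eq Rv_def)
    then show ?thesis using l(3) yy_lin[OF assms(1) l(2)] by (auto simp: gcoeff_gvar single_eq_iff)
  qed
  moreover have "gcoeff (D X) (Poly_Mapping.single (Xivar m i) (Suc 0))
      = (\<Sum>v\<in>Tlv r. gcoeff (gD yy v) (Poly_Mapping.single (Xivar m i) (Suc 0)) * gcoeff X (Poly_Mapping.single v (Suc 0)))"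
    by (rule gcoeff_der_single[OF r finite_Tlv gD_eps[OF yy]])
  ultimately show ?thesis by simp
qed

text \<open>Otherwise the variable would be a cycle mapping to 0 in A, hence a boundary; but
  boundaries have no linear term of positive level.\<close>

lemma gd_nonzero: assumes "m \<ge> 1" "i \<in> J m" shows "gd (Xvar m i) \<noteq> 0"
proof
  assume 0: "gd (Xvar m i) = 0"
  let ?x = "gvar (Xvar m i) :: 'k galg"
  have x: "?x \<in> R_alg J" using assms by (simp add: R_alg_eq subalg_gvar Rv_def)
  have "proj_S n ?x = 0" unfolding proj_S_gproj gvar_def gproj_gmonom
    using assms by (auto simp: Sv_def)
  then obtain Y where Y: "Y \<in> R_alg J" "d Y = ?x" using R_exact[OF x] 0 assms(2) by (auto simp: gd_Xvar)
  from d_lin[OF assms(1) Y(1), of i] Y(2) show False by (simp add: gcoeff_gvar)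
qed

text \<open>Level 1 rests on the quadrics, since there \<partial>x lies in I; from level 2 on it is
  the minimality condition.\<close>

lemma gd_decomposable:
  assumes "m \<ge> 1" "i \<in> J m" "u \<in> gkeys (gd (Xvar m i))"
  shows "mon_weight (\<lambda>_. 1) u \<ge> 2"
proof (cases "m = 1")
  case True
  have "gd (Xvar m i) \<in> subalg (Rlv m)" by (rule gd_level)
  then have "gd (Xvar m i) \<in> S_alg n" unfolding S_alg_eq
    by (rule subalg_mono) (auto simp: True Rlv_def Sv_def J0)
  moreover have "proj_S n (d (gvar (Xvar m i))) \<in> I"
    using assms by (intro proj_d_I) (simp add: R_alg_eq subalg_gvar Rv_def)
  ultimately have "gd (Xvar m i) \<in> I" using assms by (simp add: gd_Xvar proj_S_id)
  then show ?thesis using assms(3) by (rule I_deg)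
next
  case False
  then have "gd (Xvar m i) \<in> aug_ideal_sq J"
    using mm assms by (auto simp: is_minimal_model_def gd_Xvar)
  from gcoeff_aug_ideal_sq[OF this] have "u \<noteq> 0" "u \<noteq> Poly_Mapping.single v (Suc 0)" for v
    using assms(3) by (auto simp: in_gkeys_iff)
  then show ?thesis by (rule mon_weight_ge_2)
qed

end

context koszul_minimal_model begin

text \<open>By induction every x of lower level has internal plus cohomological degree 1, and every
  killing variable has sum 0, so this sum counts the factors x of a monomial.\<close>

lemma koszul_weight: "i \<in> J m \<Longrightarrow> wt m i = int m + 1"
proof (induction m arbitrary: i rule: less_induct)
  case (less m)
  show ?case
  proof (cases "m = 0")
    case True then show ?thesis using wt0 less.prems by simp
  next
    case False
    then have m: "m \<ge> 1" by simp
    let ?w = "wt m i" and ?dx = "gd (Xvar m i)"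
    \<comment> \<open>A monomial of \<partial>x has \<open>?w + 1 - m\<close> factors, and at least
      two by \<open>gd_decomposable\<close>.\<close>
    have "?w \<ge> int m + 1"
    proof -
      obtain u where u: "u \<in> gkeys ?dx" using gd_nonzero[OF m less.prems] by (metis gkeys_eq_empty_iff ex_in_conv)
      have k: "Poly_Mapping.keys u \<subseteq> Rlv m" using u gd_level[of m i] by (auto simp: subalg_def)
      have "mon_weight (\<lambda>_. 1) u = mon_weight iT u + mon_weight cT u"
        unfolding mon_weight_def sum.distrib[symmetric] distrib_left[symmetric]
        using k by (intro sum.cong) (auto simp: Rlv_def less.IH)
      moreover have "mon_weight iT u = ?w" "mon_weight cT u = 1 - int m"
        using u gd_iT[of m i] gd_cT[of m i] by (auto simp: wspan_def kspan_def)
      ultimately show ?thesis using gd_decomposable[OF m less.prems u] by simp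
    qed
    moreover have False if w: "?w \<noteq> int m + 1"
    proof -
      let ?s = "Poly_Mapping.single (Xivar m i) (Suc 0)"
      let ?z = "gvar (Xivar m i) :: 'a galg"
      have z: "?z \<in> subalg TV" using less.prems by (auto intro!: subalg_gvar simp: TV_def)
      have zb: "bihom (- int m - 1) ?w ?z" by (simp add: bihom_def gvar_wspan)
      \<comment> \<open>A monomial in the \<xi> alone has degree sum 0, whereas the correction
        \<open>yy m i\<close> has \<open>?w - m\<close>, which is positive by the lower
        bound.\<close>
      have "gcoeff (D ?z) \<nu> = 0" if xi: "xi_only \<nu>" for \<nu>
      proof (rule ccontr)
        assume nz: "gcoeff (D ?z) \<nu> \<noteq> 0"
        have "\<nu> \<noteq> Poly_Mapping.single (Xvar m i) (Suc 0)" using xi by (auto simp: xi_only_def)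
        then have nz': "gcoeff (yy m i) \<nu> \<noteq> 0" using nz by (simp add: gcoeff_gvar)
        then have k: "Poly_Mapping.keys \<nu> \<subseteq> Tlv m"
          using yy_eq(1)[OF less.prems] by (auto simp: subalg_def in_gkeys_iff)
        have "mon_weight iT \<nu> + mon_weight cT \<nu> = 0"
          unfolding mon_weight_def sum.distrib[symmetric] distrib_left[symmetric]
        proof (rule sum.neutral, rule ballI)
          fix v assume v: "v \<in> Poly_Mapping.keys \<nu>"
          then obtain l j where "l < m" "j \<in> J l" "v \<in> {Xvar l j, Xivar l j}" using k by (blast elim: TlvE)
          moreover have "v \<notin> XV" using xi v by (auto simp: xi_only_def)
          ultimately show "int (Poly_Mapping.lookup \<nu> v) * (iT v + cT v) = 0" using less.IH by auto
        qed
        moreover have "mon_weight iT \<nu> = ?w" "mon_weight cT \<nu> = - int m"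
          using gcoeff_wspan[OF yy_eq(3)[OF less.prems] nz'] gcoeff_wspan[OF yy_eq(2)[OF less.prems] nz'] by simp_all
        ultimately show False using \<open>?w \<ge> int m + 1\<close> by simp
      qed
      from staircase[OF z zb w this] obtain e e' where e: "e \<in> subalg TV"
        and N: "?z - (\<Sum>l<b 1. M 0 0 l * e' l) - D e \<in> NN" by blast
      have xs: "xi_only ?s" by (intro xi_only_single) simp
      \<comment> \<open>The variable \<open>Xivar m i\<close> has coefficient 1 in \<open>?z\<close>
        but 0 in the other terms: multiples of linear forms in S contain no single \<xi>, and
        neither does \<open>D e\<close>.\<close>
      have "gcoeff (M 0 0 l * e' l) ?s = 0" if l: "l < b 1" for l
      proof -
        have "M 0 0 l \<in> subalg Sv" using M_S[of 0 0 l] l b0 by (simp add: S_alg_eq)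
        then have "gcoeff (M 0 0 l) ?s = 0" by (rule subalg_gcoeff_single) (simp add: Sv_def)
        then show ?thesis unfolding gcoeff_mult_single using M_eps[of 0 0 l] l b0 by simp
      qed
      then have "gcoeff (\<Sum>l<b 1. M 0 0 l * e' l) ?s = 0" by (simp add: gcoeff_sum)
      moreover have "gcoeff (D e) ?s = 0" by (rule D_lin[OF m e])
      ultimately show False using NN_eps[OF N xs] by (simp add: gcoeff_gvar)
    qed
    ultimately show ?thesis by blast
  qed
qed

definition xdeg :: "gvariable \<Rightarrow> int" where
  "xdeg v = (case v of Xvar m i \<Rightarrow> 1 | Xivar m i \<Rightarrow> 0)"

lemma xdeg_simps [simp]: "xdeg (Xvar m i) = 1" "xdeg (Xivar m i) = 0"
  by (simp_all add: xdeg_def)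

text \<open>All variables lie on the line where the internal degree exceeds minus the cohomological degree
  by 1, so a homogeneous element is of fixed degree in the variables.\<close>

lemma gd_quadratic: "gd v \<in> wspan xdeg {2}"
proof (cases "v \<in> Rv")
  case True
  then obtain m i where v: "v = Xvar m i" "i \<in> J m" by (auto simp: Rv_def)
  have "mon_weight xdeg u = 2" if u: "u \<in> gkeys (gd v)" for u
  proof -
    have k: "Poly_Mapping.keys u \<subseteq> Rlv m" using u gd_level[of m i] v by (auto simp: subalg_def)
    have "mon_weight xdeg u = mon_weight iT u + mon_weight cT u"
      unfolding mon_weight_def sum.distrib[symmetric] distrib_left[symmetric]
      using k by (intro sum.cong) (auto simp: Rlv_def koszul_weight)
    moreover have "mon_weight iT u = int m + 1" "mon_weight cT u = 1 - int m"
      using u gd_iT[of m i] gd_cT[of m i] v koszul_weight[OF v(2)] by (auto simp: wspan_def kspan_def)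
    ultimately show ?thesis by simp
  qed
  then show ?thesis by (auto simp: wspan_def kspan_def)
qed (simp add: gd_not_R)

end

subsection \<open>The Schouten bracket\<close>

lemma gpar_commute: "gpar p X \<Longrightarrow> gpar q Y \<Longrightarrow> X * Y = (if p \<and> q then - (Y * X) else Y * X)"
proof -
  assume X: "gpar p X" and Y: "gpar q Y"
  show ?thesis
  proof (cases p)
    case False
    then have "X * Y = Y * X" using X by (intro gpar_even_commute) simp
    then show ?thesis by (simp only: False if_False simp_thms)
  next
    case p: True
    show ?thesis
    proof (cases q)
      case False
      then have "Y * X = X * Y" using Y by (intro gpar_even_commute) simp
      then show ?thesis by (simp only: False if_False simp_thms)
    next
      case True
      then have "X * Y = - (Y * X)" using X Y p by (intro gpar_odd_odd) simp_all
      then show ?thesis by (simp only: p True if_True simp_thms)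
    qed
  qed
qed

section \<open>The bracket of even elements in terms of left derivatives\<close>

fun dual_var :: "gvariable \<Rightarrow> gvariable" where
  "dual_var (Xvar m i) = Xivar m i"
| "dual_var (Xivar m i) = Xvar m i"

fun level :: "gvariable \<Rightarrow> nat" where
  "level (Xvar m i) = m"
| "level (Xivar m i) = m"

lemma dual_dual [simp]: "dual_var (dual_var v) = v" and level_dual [simp]: "level (dual_var v) = level v"
  by (cases v; simp)+

lemma odd_dual [simp]: "odd_var (dual_var v) \<longleftrightarrow> \<not> odd_var v"
  by (cases v) (auto simp: odd_var_def)

text \<open>For even \<open>Q\<close> both terms of the bracket acquire the same sign when right
  derivatives become left ones: minus for even \<open>m\<close>, where the \<xi> is odd, and plus
  for odd \<open>m\<close>, where the minus of the bracket cancels that of the odd x.\<close>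

definition level_sign :: "nat \<Rightarrow> 'k::comm_ring_1 galg \<Rightarrow> 'k galg" where
  "level_sign m X = (if even m then - X else X)"

lemma level_sign_add: "level_sign m (X + Y) = level_sign m X + level_sign m Y"
  and level_sign_mult: "level_sign m X * Y = level_sign m (X * Y)" "X * level_sign m Y = level_sign m (X * Y)"
  and level_sign_0 [simp]: "level_sign m 0 = 0"
  by (auto simp: level_sign_def)

lemma level_sign_wspan: "X \<in> wspan w E \<Longrightarrow> level_sign m X \<in> wspan w E"
  and level_sign_subalg: "X \<in> subalg V \<Longrightarrow> level_sign m X \<in> subalg V"
  and gpar_level_sign: "gpar q X \<Longrightarrow> gpar q (level_sign m X)"
  by (auto simp: level_sign_def intro: wspan_uminus subalg_uminus gpar_uminus)

text \<open>\<open>ham Q\<close> are the values on the variables of the derivation \<open>\<lbrakk>Q, _\<rbrakk>\<close>, for even \<open>Q\<close>.\<close>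

definition ham :: "'k::comm_ring_1 galg \<Rightarrow> gvariable \<Rightarrow> 'k galg" where
  "ham Q v = level_sign (level v) (lderiv (dual_var v) Q)"

lemma gpar_ham: "gpar False Q \<Longrightarrow> gpar (\<not> odd_var v) (ham Q v)"
  unfolding ham_def using gpar_lderiv[of False Q "dual_var v"] by (intro gpar_level_sign) simp

lemma rderiv_even:
  "gpar False Q \<Longrightarrow> rderiv v Q = (if odd_var v then - lderiv v Q else lderiv v Q)"
  using gpar_gsgn[OF gpar_lderiv[of False Q v]] by (simp add: rderiv_lderiv)

lemma schouten_even:
  assumes "gpar False Q"
  shows "schouten J r Q Y = (\<Sum>m\<le>r. \<Sum>i\<in>J m. level_sign m
     (lderiv (Xivar m i) Q * lderiv (Xvar m i) Y + lderiv (Xvar m i) Q * lderiv (Xivar m i) Y))"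
  unfolding schouten_def
  by (intro sum.cong refl) (auto simp: rderiv_even[OF assms] odd_var_def level_sign_def)

lemma rderiv_add: "rderiv v (X + Y) = rderiv v X + rderiv v (Y :: 'k::comm_ring_1 galg)"
  and rderiv_0 [simp]: "rderiv v 0 = (0 :: 'k galg)"
  by (cases "odd_var v"; simp add: rderiv_lderiv lderiv_add gsgn_add)+

lemma schouten_add_right: "schouten J r X (Y + Z) = schouten J r X Y + schouten J r X (Z :: 'k::comm_ring_1 galg)"
  by (simp add: schouten_def lderiv_add distrib_left sum.distrib[symmetric] algebra_simps)

lemma schouten_add_left: "schouten J r (X + Y) Z = schouten J r X Z + schouten J r Y (Z :: 'k::comm_ring_1 galg)"
  by (simp add: schouten_def rderiv_add distrib_right sum.distrib[symmetric] algebra_simps)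

lemma schouten_0_left [simp]: "schouten J r 0 Z = (0 :: 'k::comm_ring_1 galg)"
  by (simp add: schouten_def)

lemma schouten_sum_left: "schouten J r (sum f A) Z = (\<Sum>a\<in>A. schouten J r (f a) (Z :: 'k::comm_ring_1 galg))"
  by (induction A rule: infinite_finite_induct) (auto simp: schouten_add_left)

text \<open>In each product the two derivatives have opposite parities, so one of them is even and
  they commute; exchanging them swaps the two terms.\<close>

lemma schouten_commute:
  assumes "gpar False X" "gpar False Y"
  shows "schouten J r X Y = schouten J r Y X"
  unfolding schouten_even[OF assms(1)] schouten_even[OF assms(2)]
proof (intro sum.cong refl)
  fix m i
  have o: "odd_var (Xivar m i) \<longleftrightarrow> \<not> odd_var (Xvar m i)" using odd_dual[of "Xvar m i"] by simp
  show "level_sign m (lderiv (Xivar m i) X * lderiv (Xvar m i) Y + lderiv (Xvar m i) X * lderiv (Xivar m i) Y)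
    = level_sign m (lderiv (Xivar m i) Y * lderiv (Xvar m i) X + lderiv (Xvar m i) Y * lderiv (Xivar m i) X)"
    using gpar_commute[OF gpar_lderiv[OF assms(1), of "Xivar m i"] gpar_lderiv[OF assms(2), of "Xvar m i"]]
      gpar_commute[OF gpar_lderiv[OF assms(1), of "Xvar m i"] gpar_lderiv[OF assms(2), of "Xivar m i"]] o
    by (simp add: add.commute)
qed

lemma schouten_level:
  assumes "X \<in> h_le J a" "a \<le> r"
  shows "schouten J r X Y = schouten J a X (Y :: 'k::comm_ring_1 galg)"
  unfolding schouten_def
proof (rule sum.mono_neutral_right)
  show "\<forall>m\<in>{..r} - {..a}. (\<Sum>i\<in>J m. rderiv (Xivar m i) X * lderiv (Xvar m i) Y
     - rderiv (Xvar m i) X * lderiv (Xivar m i) Y) = 0"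
  proof
    fix m assume "m \<in> {..r} - {..a}"
    then have "lderiv (Xivar m i) X = 0" "lderiv (Xvar m i) X = 0" for i
      by (auto intro!: lderiv_subalg_0[OF assms(1)[unfolded h_le_def]])
    then have "rderiv (Xivar m i) X = 0" "rderiv (Xvar m i) X = 0" for i
      by (simp_all add: rderiv_lderiv)
    then show "(\<Sum>i\<in>J m. rderiv (Xivar m i) X * lderiv (Xvar m i) Y
     - rderiv (Xvar m i) X * lderiv (Xivar m i) Y) = 0" by simp
  qed
qed (use assms in auto)

lemma schouten_wspan:
  assumes Q: "gpar False Q" "Q \<in> wspan w E" and Y: "Y \<in> wspan w F"
    and le: "\<And>m i e f. m \<le> r \<Longrightarrow> i \<in> J m \<Longrightarrow> e \<in> E \<Longrightarrow> f \<in> F \<Longrightarrow> e + f - w (Xvar m i) - w (Xivar m i) \<in> G"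
  shows "schouten J r Q (Y :: 'k::comm_ring_1 galg) \<in> wspan w G"
  unfolding schouten_even[OF Q(1)]
proof (intro wspan_sum level_sign_wspan wspan_add)
  fix m i assume mi: "m \<in> {..r}" "i \<in> J m"
  show "lderiv (Xivar m i) Q * lderiv (Xvar m i) Y \<in> wspan w G"
    by (rule wspan_mult[OF lderiv_wspan[OF Q(2), where v = "Xivar m i" and F = "(\<lambda>e. e - w (Xivar m i)) ` E"]
          lderiv_wspan[OF Y, where v = "Xvar m i" and F = "(\<lambda>e. e - w (Xvar m i)) ` F"]])
      (use le[of m i] mi in \<open>auto simp: algebra_simps\<close>)
  show "lderiv (Xvar m i) Q * lderiv (Xivar m i) Y \<in> wspan w G"
    by (rule wspan_mult[OF lderiv_wspan[OF Q(2), where v = "Xvar m i" and F = "(\<lambda>e. e - w (Xvar m i)) ` E"]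
          lderiv_wspan[OF Y, where v = "Xivar m i" and F = "(\<lambda>e. e - w (Xivar m i)) ` F"]])
      (use le[of m i] mi in \<open>auto simp: algebra_simps\<close>)
qed

context minimal_model begin

lemma h_le_eq: "h_le J r = subalg (Tlv (Suc r))"
  by (simp add: h_le_def Tlv_def less_Suc_eq_le)

lemma sum_Tlv: "(\<Sum>v\<in>Tlv (Suc r). f v) = (\<Sum>m\<le>r. \<Sum>i\<in>J m. f (Xvar m i) + (f (Xivar m i) :: 'k galg))"
proof -
  let ?S = "Sigma {..r} J"
  have T: "Tlv (Suc r) = (\<lambda>(m, i). Xvar m i) ` ?S \<union> (\<lambda>(m, i). Xivar m i) ` ?S"
    by (auto simp: Tlv_def less_Suc_eq_le image_iff)
  have fin: "finite ?S" by auto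
  have "(\<Sum>v\<in>Tlv (Suc r). f v) = (\<Sum>v\<in>(\<lambda>(m, i). Xvar m i) ` ?S. f v) + (\<Sum>v\<in>(\<lambda>(m, i). Xivar m i) ` ?S. f v)"
    unfolding T using fin by (intro sum.union_disjoint) auto
  also have "(\<Sum>v\<in>(\<lambda>(m, i). Xvar m i) ` ?S. f v) = (\<Sum>(m, i)\<in>?S. f (Xvar m i))"
    by (subst sum.reindex) (auto simp: inj_on_def intro!: sum.cong)
  also have "(\<Sum>v\<in>(\<lambda>(m, i). Xivar m i) ` ?S. f v) = (\<Sum>(m, i)\<in>?S. f (Xivar m i))"
    by (subst sum.reindex) (auto simp: inj_on_def intro!: sum.cong)
  finally show ?thesis by (simp add: sum.Sigma sum.distrib)
qed

lemma schouten_der: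
  fixes Q Y :: "'k galg"
  assumes "gpar False Q" "Y \<in> h_le J r"
  shows "schouten J r Q Y = der (ham Q) Y"
  unfolding schouten_even[OF assms(1)] der_superset[OF finite_Tlv assms(2)[unfolded h_le_eq]] sum_Tlv
  by (intro sum.cong refl) (simp add: ham_def level_sign_mult level_sign_add)

lemma dual_Tlv: "dual_var v \<in> Tlv r \<longleftrightarrow> v \<in> Tlv r"
  by (cases v) (auto simp: Tlv_def)

lemma sum_dual: "(\<Sum>v\<in>Tlv r. f (dual_var v)) = (\<Sum>v\<in>Tlv r. f v)"
  by (rule sum.reindex_bij_witness[of _ dual_var dual_var]) (auto simp: dual_Tlv)

text \<open>With \<open>\<Delta> = \<lbrakk>Q, _\<rbrakk>\<close> and \<open>B = \<Delta> Q\<close> one has \<open>\<partial>\<^sub>w B = \<plusminus> 2 \<Delta> \<partial>\<^sub>w Q\<close>, which turns \<open>2 \<Delta> B\<close> into \<open>- 2 \<Delta> B\<close>.\<close>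

lemma schouten_jacobi:
  fixes Q :: "'k galg"
  assumes Q: "gpar False Q" "Q \<in> h_le J r"
  shows "schouten J r Q (schouten J r Q Q) = 0"
proof -
  let ?T = "Tlv (Suc r)"
  let ?g = "ham Q"
  have QT: "Q \<in> subalg ?T" using Q(2) by (simp add: h_le_eq)
  define De where "De = der ?g"
  define B where "B = De Q"
  define s where "s q X = (if q then - X else (X :: 'k galg))" for q X
  have gT: "?g v \<in> subalg ?T" for v
    unfolding ham_def by (intro level_sign_subalg lderiv_subalg QT)
  have De_sum: "De Y = (\<Sum>v\<in>?T. level_sign (level v) (lderiv (dual_var v) Q * lderiv v Y))" if "Y \<in> subalg ?T" for Y
    unfolding De_def der_superset[OF finite_Tlv that] by (simp add: ham_def level_sign_mult)
  have De_T: "De Y \<in> subalg ?T" if "Y \<in> subalg ?T" for Y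
    unfolding De_def by (rule der_subalg[OF that]) (auto intro: gT)
  have BT: "B \<in> subalg ?T" unfolding B_def by (rule De_T[OF QT])
  have lQ: "lderiv v Q \<in> subalg ?T" for v by (rule lderiv_subalg[OF QT])
  have pQ: "gpar (odd_var v) (lderiv v Q)" for v using gpar_lderiv[OF Q(1), of v] by simp
  have pB: "gpar True B"
  proof -
    have "gpar True (?g v * lderiv v Q)" for v using gpar_mult[OF gpar_ham[OF Q(1), of v] pQ[of v]] by simp
    then show ?thesis unfolding B_def De_def der_def by (rule gpar_sum)
  qed
  have key: "lderiv w B = s (odd_var w) (De (lderiv w Q) + De (lderiv w Q))" for w
  proof -
    have "lderiv w B = (\<Sum>v\<in>?T. level_sign (level v) (lderiv w (lderiv (dual_var v) Q * lderiv v Q)))"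
      unfolding B_def De_sum[OF QT] lderiv_sum
      by (intro sum.cong refl) (simp add: level_sign_def lderiv_uminus)
    \<comment> \<open>The derivative hits either factor; substituting \<open>dual_var v\<close> for
      \<open>v\<close> will identify the two resulting sums.\<close>
    also have "\<dots> = (\<Sum>v\<in>?T. s (odd_var w) (level_sign (level v) (lderiv v Q * lderiv (dual_var v) (lderiv w Q)))
        + s (odd_var w) (level_sign (level v) (lderiv (dual_var v) Q * lderiv v (lderiv w Q))))"
    proof (intro sum.cong refl)
      fix v
      have 1: "lderiv w (lderiv (dual_var v) Q) * lderiv v Q = s (odd_var w) (lderiv v Q * lderiv (dual_var v) (lderiv w Q))"
        using gpar_commute[OF gpar_lderiv[OF pQ[of w], of "dual_var v"] pQ[of v]]
        by (auto simp: lderiv_lderiv[of w "dual_var v"] s_def)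
      have 2: "gsgn_if (odd_var w) (lderiv (dual_var v) Q) * lderiv w (lderiv v Q)
          = s (odd_var w) (lderiv (dual_var v) Q * lderiv v (lderiv w Q))"
        using gpar_gsgn[OF pQ[of "dual_var v"]] by (auto simp: lderiv_lderiv[of w v] s_def gsgn_if_def)
      show "level_sign (level v) (lderiv w (lderiv (dual_var v) Q * lderiv v Q))
        = s (odd_var w) (level_sign (level v) (lderiv v Q * lderiv (dual_var v) (lderiv w Q)))
        + s (odd_var w) (level_sign (level v) (lderiv (dual_var v) Q * lderiv v (lderiv w Q)))"
        unfolding lderiv_mult 1 2 by (auto simp: s_def level_sign_def)
    qed
    also have "\<dots> = s (odd_var w) ((\<Sum>v\<in>?T. level_sign (level v) (lderiv v Q * lderiv (dual_var v) (lderiv w Q)))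
        + (\<Sum>v\<in>?T. level_sign (level v) (lderiv (dual_var v) Q * lderiv v (lderiv w Q))))"
      by (simp add: s_def sum.distrib sum_negf)
    also have "(\<Sum>v\<in>?T. level_sign (level v) (lderiv v Q * lderiv (dual_var v) (lderiv w Q))) = De (lderiv w Q)"
      unfolding De_sum[OF lQ]
      using sum_dual[of "\<lambda>v. level_sign (level v) (lderiv (dual_var v) Q * lderiv v (lderiv w Q))"] by simp
    also have "(\<Sum>v\<in>?T. level_sign (level v) (lderiv (dual_var v) Q * lderiv v (lderiv w Q))) = De (lderiv w Q)"
      unfolding De_sum[OF lQ] ..
    finally show ?thesis .
  qed
  have De_mult: "De (X * Y) = De X * Y + gsgn X * De Y" if "X \<in> subalg ?T" "Y \<in> subalg ?T" for X Y
    unfolding De_def by (rule der_mult_odd[OF that]) (rule gpar_ham[OF Q(1)])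
  have "De B = (\<Sum>v\<in>?T. level_sign (level v) (De (lderiv (dual_var v) Q * lderiv v Q)))"
    unfolding B_def De_sum[OF QT] unfolding De_def der_sum
    by (intro sum.cong refl) (simp add: level_sign_def der_uminus)
  \<comment> \<open>Doubled because \<open>key\<close> expresses a derivative of \<open>B\<close>
    through two copies of \<open>De\<close> of a derivative of \<open>Q\<close>.\<close>
  then have "De B + De B = (\<Sum>v\<in>?T. level_sign (level v) (De (lderiv (dual_var v) Q * lderiv v Q)
      + De (lderiv (dual_var v) Q * lderiv v Q)))"
    by (simp add: sum.distrib level_sign_add)
  also have "\<dots> = (\<Sum>v\<in>?T. - level_sign (level v) (lderiv v Q * lderiv (dual_var v) B)
      + - level_sign (level v) (lderiv (dual_var v) Q * lderiv v B))"
  proof (intro sum.cong refl)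
    fix v
    let ?a = "De (lderiv (dual_var v) Q)" and ?b = "De (lderiv v Q)"
    have ab: "?a + ?a = s (\<not> odd_var v) (lderiv (dual_var v) B)" "?b + ?b = s (odd_var v) (lderiv v B)"
      using key[of "dual_var v"] key[of v] by (auto simp: s_def)
    have c: "lderiv (dual_var v) B * lderiv v Q = s (odd_var v) (lderiv v Q * lderiv (dual_var v) B)"
      using gpar_commute[OF gpar_lderiv[OF pB, of "dual_var v"] pQ[of v]] by (simp add: s_def)
    have g: "gsgn (lderiv (dual_var v) Q) = s (\<not> odd_var v) (lderiv (dual_var v) Q)"
      using gpar_gsgn[OF pQ[of "dual_var v"]] by (simp add: s_def)
    have "De (lderiv (dual_var v) Q * lderiv v Q) + De (lderiv (dual_var v) Q * lderiv v Q)
        = (?a + ?a) * lderiv v Q + gsgn (lderiv (dual_var v) Q) * (?b + ?b)"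
      by (simp add: De_mult[OF lQ lQ] algebra_simps)
    also have "\<dots> = - (lderiv v Q * lderiv (dual_var v) B) - lderiv (dual_var v) Q * lderiv v B"
      unfolding ab g using c by (cases "odd_var v") (auto simp: s_def)
    finally show "level_sign (level v) (De (lderiv (dual_var v) Q * lderiv v Q)
        + De (lderiv (dual_var v) Q * lderiv v Q))
      = - level_sign (level v) (lderiv v Q * lderiv (dual_var v) B) + - level_sign (level v) (lderiv (dual_var v) Q * lderiv v B)"
      by (auto simp: level_sign_def)
  qed
  also have "\<dots> = - (\<Sum>v\<in>?T. level_sign (level v) (lderiv v Q * lderiv (dual_var v) B)) - De B"
    unfolding De_sum[OF BT] by (simp add: sum_subtractf sum_negf)
  also have "(\<Sum>v\<in>?T. level_sign (level v) (lderiv v Q * lderiv (dual_var v) B)) = De B"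
    unfolding De_sum[OF BT]
    using sum_dual[of "\<lambda>v. level_sign (level v) (lderiv (dual_var v) Q * lderiv v B)"] by simp
  finally have "De B + De B + De B + De B = 0" by (simp add: algebra_simps)
  then have "(1 + 1 + 1 + 1) * De B = 0" by (simp only: distrib_right mult_1_left add.assoc)
  then have "gconst 4 * De B = 0" by (simp add: gconst_numeral)
  then have "gconst (1/4) * (gconst 4 * De B) = 0" by simp
  then have "De B = 0" by (simp flip: mult.assoc gconst_mult)
  then show ?thesis
    using Q BT by (simp add: schouten_der h_le_eq B_def De_def)
qed

end

subsection \<open>Filtration estimates\<close>

lemma wspan_XV_nonpos:
  assumes "X \<in> wspan w {e}" "\<And>v. v \<in> XV \<Longrightarrow> w v = 1" "\<And>v. v \<notin> XV \<Longrightarrow> w v = 0" "e \<le> 0"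
  shows "X \<in> subalg (- XV)"
  unfolding subalg_def
proof safe
  fix u v assume u: "u \<in> gkeys X" and v: "v \<in> Poly_Mapping.keys u" "v \<in> XV"
  have nn: "w x \<ge> 0" for x using assms(2,3)[of x] by (cases "x \<in> XV") auto
  have "mon_weight w u \<le> 0" using u assms(1,4) by (auto simp: wspan_def kspan_def)
  then have "(\<Sum>v\<in>Poly_Mapping.keys u. int (Poly_Mapping.lookup u v) * w v) = 0"
    using mon_weight_nonneg[of u w] nn by (simp add: mon_weight_def)
  then have "int (Poly_Mapping.lookup u v) * w v = 0"
    using v by (subst (asm) sum_nonneg_eq_0_iff) (auto simp: nn)
  then show False using v assms(2) by (simp add: in_keys_iff)
qed

context minimal_model begin

definition fge :: "int \<Rightarrow> 'k galg set" where "fge q = wspan fdeg_var {q..}"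

lemma fge_0 [simp]: "0 \<in> fge q"
  and fge_add: "X \<in> fge q \<Longrightarrow> Y \<in> fge q \<Longrightarrow> X + Y \<in> fge q"
  and fge_diff: "X \<in> fge q \<Longrightarrow> Y \<in> fge q \<Longrightarrow> X - Y \<in> fge q"
  and fge_uminus: "X \<in> fge q \<Longrightarrow> - X \<in> fge q"
  and fge_sum: "(\<And>a. a \<in> A \<Longrightarrow> f a \<in> fge q) \<Longrightarrow> sum f A \<in> fge q"
  unfolding fge_def by (auto intro: wspan_add wspan_diff wspan_uminus wspan_sum wspan_mono)

lemma fge_mult: "X \<in> fge p \<Longrightarrow> Y \<in> fge q \<Longrightarrow> p + q \<ge> r \<Longrightarrow> X * Y \<in> fge r"
  unfolding fge_def by (erule (1) wspan_mult) auto

lemma fge_lderiv: "X \<in> fge q \<Longrightarrow> lderiv v X \<in> fge (q - fdeg_var v)"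
  unfolding fge_def by (erule lderiv_wspan) auto

lemma fge_iff: "X \<in> fge q \<longleftrightarrow> (\<forall>\<nu>. xi_only \<nu> \<longrightarrow> mon_weight fdeg_var \<nu> < q \<longrightarrow> xi_coeff \<nu> X = 0)"
  unfolding fge_def wspan_fdeg_iff by (auto simp: not_le)

lemma fge_level_sign: "X \<in> fge q \<Longrightarrow> level_sign m X \<in> fge q"
  unfolding fge_def by (rule level_sign_wspan)

lemma gproj_fge: "X \<in> fge q \<Longrightarrow> gproj P X \<in> fge q"
  unfolding fge_def wspan_def by (rule gproj_kspan')

lemma filt_iff: "X \<in> filt J q r \<longleftrightarrow> X \<in> h_le J r \<and> X \<in> fge (int q)"
  by (auto simp: filt_def fge_def wspan_def kspan_def)

text \<open>Differentiating by a \<xi> of level at most \<open>a\<close> costs at most a + 1, while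
  \<open>A\<close> contributes a + 2. So \<open>\<pi> i\<close>, of level at most i - 1 and
  filtration degree at least i + 1, raises the filtration.\<close>

lemma schouten_fge:
  assumes A: "A \<in> h_le J a" "A \<in> fge (int a + 2)" "gpar False A" and X: "X \<in> fge q"
  shows "schouten J r A X \<in> fge (q + 1)"
  unfolding schouten_even[OF A(3)]
proof (intro fge_sum)
  fix m i
  show "level_sign m (lderiv (Xivar m i) A * lderiv (Xvar m i) X + lderiv (Xvar m i) A * lderiv (Xivar m i) X) \<in> fge (q + 1)"
  proof (cases "m \<le> a")
    case False
    then have "lderiv (Xivar m i) A = 0" "lderiv (Xvar m i) A = 0"
      by (auto intro!: lderiv_subalg_0[OF A(1)[unfolded h_le_eq]] simp: Tlv_def)
    then show ?thesis by simp
  next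
    case True
    have "lderiv (Xivar m i) A * lderiv (Xvar m i) X \<in> fge (q + 1)"
      by (rule fge_mult[OF fge_lderiv[OF A(2)] fge_lderiv[OF X]]) (use True in auto)
    moreover have "lderiv (Xvar m i) A * lderiv (Xivar m i) X \<in> fge (q + 1)"
      by (rule fge_mult[OF fge_lderiv[OF A(2)] fge_lderiv[OF X]]) (use True in auto)
    ultimately show ?thesis by (intro fge_level_sign fge_add)
  qed
qed

lemma schouten_fge':
  assumes "A \<in> h_le J (i - 1)" "A \<in> fge (int i + 1)" "gpar False A" "X \<in> fge q" "i \<ge> 1"
  shows "schouten J r A X \<in> fge (q + 1)"
proof -
  obtain a where a: "i = Suc a" using assms(5) by (cases i) auto
  have "int a + 2 = int i + 1" using a by simp
  then have "A \<in> fge (int a + 2)" using assms(2) by (simp only:)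
  then show ?thesis by (intro schouten_fge[of A a]) (use assms a in auto)
qed

lemma gd_Tlv: "m \<le> r \<Longrightarrow> gd (Xvar m i) \<in> subalg (Tlv r)"
  by (rule subalg_mono[OF gd_level]) (auto simp: Rlv_def Tlv_def)

section \<open>The bracket with \<open>pi0\<close>\<close>

lemma pi0_eq: "pi0 J d r = (\<Sum>m=1..r. \<Sum>j\<in>J m. gd (Xvar m j) * gvar (Xivar m j))"
  unfolding pi0_def by (intro sum.cong refl) (simp add: gd_Xvar)

lemma pi0_h_le: "pi0 J d r \<in> h_le J r"
  unfolding pi0_eq h_le_eq
proof (intro subalg_sum subalg_mult)
  fix m i assume "m \<in> {1..r}" "i \<in> J m"
  then show "gd (Xvar m i) \<in> subalg (Tlv (Suc r))" "gvar (Xivar m i) \<in> subalg (Tlv (Suc r))"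
    by (auto intro!: gd_Tlv subalg_gvar) (auto simp: Tlv_def)
qed

lemma pi0_cdeg: "pi0 J d r \<in> wspan cdeg_var {2}"
  unfolding pi0_eq
proof (intro wspan_sum)
  fix m i
  show "gd (Xvar m i) * gvar (Xivar m i) \<in> wspan cdeg_var {2}"
    by (rule wspan_mult[OF gd_cdeg gvar_wspan[of _ _ "{int m + 1}"]]) auto
qed

lemma cdeg2_even: "X \<in> wspan cdeg_var {2} \<Longrightarrow> gpar False X"
  using homogeneous_gpar[of X cdeg_var 2] even_cdeg_iff by simp

lemma pi0_even: "gpar False (pi0 J d r)"
  by (rule cdeg2_even[OF pi0_cdeg])

lemma d_ext_der: "X \<in> h_le J r \<Longrightarrow> d_ext J d r X = der gd X"
  and d_ext_sum: "d_ext J d r X = (\<Sum>m\<le>r. \<Sum>i\<in>J m. gd (Xvar m i) * lderiv (Xvar m i) X)"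
proof -
  have "{..r} = insert 0 {1..r}" by auto
  then have "(\<Sum>m\<le>r. \<Sum>i\<in>J m. gd (Xvar m i) * lderiv (Xvar m i) X)
    = (\<Sum>m=1..r. \<Sum>i\<in>J m. gd (Xvar m i) * lderiv (Xvar m i) X)" by simp
  also have "\<dots> = d_ext J d r X" unfolding d_ext_def by (intro sum.cong refl) (simp add: gd_Xvar)
  finally show e: "d_ext J d r X = (\<Sum>m\<le>r. \<Sum>i\<in>J m. gd (Xvar m i) * lderiv (Xvar m i) X)" by simp
  assume "X \<in> h_le J r"
  then show "d_ext J d r X = der gd X"
    unfolding e h_le_eq by (simp add: der_superset[of "Tlv (Suc r)"] sum_Tlv)
qed

lemma lderiv_xi_pi0:
  assumes "m \<le> r" "i \<in> J m"
  shows "level_sign m (lderiv (Xivar m i) (pi0 J d r)) = gd (Xvar m i)"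
proof -
  have t: "lderiv (Xivar m i) (gd (Xvar l j) * gvar (Xivar l j))
      = (if l = m \<and> j = i then level_sign m (gd (Xvar m i)) else 0)" for l j
  proof -
    have "lderiv (Xivar m i) (gd (Xvar l j)) = 0"
      using gd_R[of "Xvar l j"] by (intro lderiv_subalg_0[of _ Rv]) (auto simp: R_alg_eq Rv_def)
    moreover have "gsgn_if (odd_var (Xivar m i)) (gd (Xvar m i)) = level_sign m (gd (Xvar m i))"
      using gpar_gsgn[OF gpar_gd, of "Xvar m i"] by (auto simp: gsgn_if_def level_sign_def odd_var_def)
    ultimately show ?thesis by (auto simp: lderiv_mult lderiv_gvar)
  qed
  have "lderiv (Xivar m i) (pi0 J d r) = (\<Sum>l=1..r. \<Sum>j\<in>J l. if l = m \<and> j = i then level_sign m (gd (Xvar m i)) else 0)"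
    unfolding pi0_eq lderiv_sum t ..
  also have "\<dots> = (\<Sum>l=1..r. if l = m then level_sign m (gd (Xvar m i)) else 0)"
    using assms by (intro sum.cong refl) (auto simp: sum.delta)
  also have "\<dots> = level_sign m (gd (Xvar m i))"
    using assms by (cases "m = 0") auto
  finally show ?thesis by (simp add: level_sign_def)
qed

text \<open>\<partial> is triangular: a term of \<open>pi0\<close> whose coefficient contains an x
  of level m carries a \<xi> of level greater than m.\<close>

lemma lderiv_x_pi0: "lderiv (Xvar m i) (pi0 J d r) \<in> fge (int m + 2)"
  unfolding pi0_eq lderiv_sum
proof (intro fge_sum)
  fix l j
  have e: "lderiv (Xvar m i) (gd (Xvar l j) * gvar (Xivar l j)) = lderiv (Xvar m i) (gd (Xvar l j)) * gvar (Xivar l j)"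
    by (simp add: lderiv_mult lderiv_gvar)
  show "lderiv (Xvar m i) (gd (Xvar l j) * gvar (Xivar l j)) \<in> fge (int m + 2)"
  proof (cases "m < l")
    case True
    have "lderiv (Xvar m i) (gd (Xvar l j)) \<in> fge 0"
      using fdeg_nonneg by (auto simp: fge_def wspan_def kspan_def)
    moreover have "gvar (Xivar l j) \<in> fge (int l + 1)" unfolding fge_def by (rule gvar_wspan) simp
    ultimately show ?thesis unfolding e by (rule fge_mult) (use True in simp)
  next
    case False
    then have "lderiv (Xvar m i) (gd (Xvar l j)) = 0"
      by (intro lderiv_subalg_0[OF gd_level]) (auto simp: Rlv_def)
    then show ?thesis unfolding e by simp
  qed
qed

lemma schouten_pi0:
  "schouten J r (pi0 J d r) X = d_ext J d r X
     + (\<Sum>m\<le>r. \<Sum>i\<in>J m. level_sign m (lderiv (Xvar m i) (pi0 J d r) * lderiv (Xivar m i) X))"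
proof -
  have "schouten J r (pi0 J d r) X = (\<Sum>m\<le>r. \<Sum>i\<in>J m. gd (Xvar m i) * lderiv (Xvar m i) X
     + level_sign m (lderiv (Xvar m i) (pi0 J d r) * lderiv (Xivar m i) X))"
    unfolding schouten_even[OF pi0_even]
    by (intro sum.cong refl) (simp add: level_sign_add lderiv_xi_pi0 flip: level_sign_mult(1))
  then show ?thesis by (simp add: d_ext_sum sum.distrib)
qed

text \<open>Beyond the differential, a \<xi> of level m is removed at the cost m + 1, and the factor
  from \<open>pi0\<close> brings at least m + 2.\<close>

lemma schouten_pi0_fge:
  assumes "X \<in> fge q" shows "schouten J r (pi0 J d r) X - d_ext J d r X \<in> fge (q + 1)"
proof -
  have "level_sign m (lderiv (Xvar m i) (pi0 J d r) * lderiv (Xivar m i) X) \<in> fge (q + 1)" for m i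
    by (rule fge_level_sign[OF fge_mult[OF lderiv_x_pi0 fge_lderiv[OF assms]]]) simp
  then show ?thesis unfolding schouten_pi0 by (auto intro!: fge_sum)
qed

text \<open>Both halves of the bracket equal \<open>d_ext\<close> of \<open>pi0\<close>, which
  vanishes because its coefficients \<partial>x are cycles.\<close>

lemma schouten_pi0_pi0: "schouten J r (pi0 J d r) (pi0 J d r) = 0"
proof -
  let ?p = "pi0 J d r"
  have "(\<Sum>m\<le>r. \<Sum>i\<in>J m. level_sign m (lderiv (Xvar m i) ?p * lderiv (Xivar m i) ?p)) = d_ext J d r ?p"
    unfolding d_ext_sum
  proof (intro sum.cong refl)
    fix m i assume mi: "m \<in> {..r}" "i \<in> J m"
    have o: "odd_var (Xivar m i) \<longleftrightarrow> \<not> odd_var (Xvar m i)" using odd_dual[of "Xvar m i"] by simp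
    have "lderiv (Xvar m i) ?p * lderiv (Xivar m i) ?p = lderiv (Xivar m i) ?p * lderiv (Xvar m i) ?p"
      using gpar_commute[OF gpar_lderiv[OF pi0_even, of "Xvar m i"] gpar_lderiv[OF pi0_even, of "Xivar m i"]] o by simp
    then show "level_sign m (lderiv (Xvar m i) ?p * lderiv (Xivar m i) ?p) = gd (Xvar m i) * lderiv (Xvar m i) ?p"
      using mi by (simp add: lderiv_xi_pi0 flip: level_sign_mult(1))
  qed
  moreover have "d_ext J d r ?p = 0"
  proof -
    have "der gd (gd (Xvar m i) * gvar (Xivar m i)) = 0" for m i
    proof -
      have "der gd (gd (Xvar m i)) = 0"
        unfolding d_eq_der[OF gd_R, symmetric]
        by (cases "Xvar m i \<in> Rv") (auto simp: gd_not_R gd_def d_d R_alg_eq subalg_gvar)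
      then show ?thesis using der_mult_odd[of "gd (Xvar m i)" UNIV "gvar (Xivar m i)" gd] gpar_gd by simp
    qed
    then have "der gd ?p = 0" by (simp add: pi0_eq der_sum)
    then show ?thesis by (simp add: d_ext_der pi0_h_le)
  qed
  ultimately show ?thesis by (simp add: schouten_pi0)
qed

text \<open>The next stage adds \<open>\<pi> m\<close> and the level \<open>m\<close> part
  \<open>F\<close> of \<open>pi0\<close>, both of filtration degree at least m + 1. Bracketing them
  with any \<open>\<pi> i\<close> gains one more, the square of \<open>pi0\<close> vanishes, and
  what remains of \<open>pi0\<close> against \<open>\<pi> m\<close> is the differential, twice by
  symmetry.\<close>

lemma obstruction_step:
  fixes \<pi> :: "nat \<Rightarrow> 'k galg"
  assumes \<pi>: "\<And>i. 1 \<le> i \<Longrightarrow> i \<le> m \<Longrightarrow> \<pi> i \<in> h_le J (i - 1) \<and> \<pi> i \<in> fge (int i + 1) \<and> \<pi> i \<in> wspan cdeg_var {2}"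
    and m: "m \<ge> 1"
    and P: "P = pi0 J d (m - 1) + (\<Sum>i=1..m - 1. \<pi> i)"
    and X: "schouten J (m - 1) P P + 2 * d_ext J d (m - 1) (\<pi> m) \<in> fge (int m + 2)"
    and P': "P' = pi0 J d m + (\<Sum>i=1..m. \<pi> i)"
  shows "schouten J m P' P' \<in> fge (int m + 2)"
proof -
  define r where "r = m - 1"
  have mr: "m = Suc r" using m by (simp add: r_def)
  let ?A = "pi0 J d r" and ?S = "\<Sum>i=1..r. \<pi> i" and ?p = "\<pi> m"
  let ?S' = "\<Sum>i=1..m. \<pi> i"
  define F where "F = (\<Sum>j\<in>J m. gd (Xvar m j) * gvar (Xivar m j))"
  have A': "pi0 J d m = ?A + F" by (simp add: pi0_eq F_def mr)
  have S': "?S' = ?S + ?p" by (simp add: mr)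
  have h: "\<pi> i \<in> h_le J r" if "i \<in> {1..m}" for i
    using \<pi>[of i] that Tlv_mono[of i m] by (auto simp: h_le_eq mr intro: subalg_mono)
  have ev: "gpar False (\<pi> i)" if "i \<in> {1..m}" for i
    using \<pi>[of i] that by (auto intro: cdeg2_even)
  have S'h: "?S' \<in> h_le J r" using h unfolding h_le_eq by (intro subalg_sum) auto
  have Sev: "gpar False ?S" "gpar False ?S'" "gpar False ?p"
    by (intro gpar_sum ev; auto simp: mr)+
  have Aev: "gpar False ?A" "gpar False (pi0 J d m)" by (rule pi0_even)+
  have pif: "schouten J k (\<pi> i) Y \<in> fge (q + 1)" if "i \<in> {1..m}" "Y \<in> fge q" for i Y q k
    by (rule schouten_fge'[of _ i]) (use \<pi>[of i] that ev in auto)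
  have q1: "int m + 1 + 1 = int m + 2" by simp
  have pif': "schouten J k (\<pi> i) Y \<in> fge (int m + 2)" if "i \<in> {1..m}" "Y \<in> fge (int m + 1)" for i Y k
    using pif[OF that] unfolding q1 .
  have pf: "?p \<in> fge (int m + 1)" using \<pi>[of m] m by simp
  have Ff: "F \<in> fge (int m + 1)" unfolding F_def
  proof (intro fge_sum)
    fix j
    have "gd (Xvar m j) \<in> fge 0" using fdeg_nonneg by (auto simp: fge_def wspan_def kspan_def)
    moreover have "gvar (Xivar m j) \<in> fge (int m + 1)" unfolding fge_def by (rule gvar_wspan) simp
    ultimately show "gd (Xvar m j) * gvar (Xivar m j) \<in> fge (int m + 1)" by (rule fge_mult) simp
  qed
  let ?b = "schouten J r"
  have "schouten J m P' P' = schouten J m (pi0 J d m) (pi0 J d m) + schouten J m ?S' (pi0 J d m)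
      + schouten J m (pi0 J d m) ?S' + schouten J m ?S' ?S'"
    unfolding P' by (simp add: schouten_add_left schouten_add_right)
  also have "schouten J m (pi0 J d m) ?S' = schouten J m ?S' (pi0 J d m)"
    by (rule schouten_commute[OF Aev(2) Sev(2)])
  also have "schouten J m (pi0 J d m) (pi0 J d m) = 0" by (rule schouten_pi0_pi0)
  also have "schouten J m ?S' (pi0 J d m) = ?b ?S' ?A + ?b ?S' F"
  proof -
    have "r \<le> m" by (simp add: mr)
    from schouten_level[OF S'h this] show ?thesis by (simp only: A' schouten_add_right)
  qed
  also have "schouten J m ?S' ?S' = ?b ?S' ?S'"
    by (rule schouten_level[OF S'h]) (simp add: mr)
  finally have 1: "schouten J m P' P' = (?b ?S' ?A + ?b ?S' F) + (?b ?S' ?A + ?b ?S' F) + ?b ?S' ?S'" by simp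
  have 2: "schouten J r P P = ?b ?S ?A + ?b ?S ?A + ?b ?S ?S"
    unfolding P r_def[symmetric]
    using schouten_commute[OF Aev(1) Sev(1)] schouten_pi0_pi0[of r] by (simp add: schouten_add_left schouten_add_right)
  have e1: "?b ?S' ?A = ?b ?S ?A + ?b ?A ?p"
    unfolding S' using schouten_commute[OF Aev(1) Sev(3)] by (simp add: schouten_add_left)
  have e2: "?b ?S' ?S' = ?b ?S ?S + ?b ?S ?p + ?b ?S ?p + ?b ?p ?p"
    unfolding S' using schouten_commute[OF Sev(3,1)] by (simp add: schouten_add_left schouten_add_right)
  let ?x = "?b ?A ?p - d_ext J d r ?p"
  have "schouten J m P' P' = (schouten J r P P + 2 * d_ext J d r ?p) + (?x + ?x) + (?b ?S' F + ?b ?S' F)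
      + (?b ?S ?p + ?b ?S ?p) + ?b ?p ?p"
    unfolding 1 2 e1 e2 mult_2 by (simp add: algebra_simps)
  moreover have "?x \<in> fge (int m + 2)" using schouten_pi0_fge[OF pf, of r] unfolding q1 .
  moreover have "?b ?S' F \<in> fge (int m + 2)" unfolding schouten_sum_left
    by (intro fge_sum pif' Ff)
  moreover have "?b ?S ?p \<in> fge (int m + 2)" unfolding schouten_sum_left
    by (intro fge_sum pif' pf) (simp add: mr)
  moreover have "?b ?p ?p \<in> fge (int m + 2)" using m by (intro pif' pf) simp
  ultimately show ?thesis using X by (auto simp: r_def intro!: fge_add)
qed

text \<open>In the Jacobi identity for \<open>P\<close> the summand \<open>pi0\<close> acts as the
  differential up to higher filtration, and every \<open>\<pi> i\<close> raises the
  filtration.\<close>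

lemma obstruction_closed:
  fixes \<pi> :: "nat \<Rightarrow> 'k galg"
  assumes \<pi>: "\<And>i. 1 \<le> i \<Longrightarrow> i \<le> r \<Longrightarrow> \<pi> i \<in> h_le J (i - 1) \<and> \<pi> i \<in> fge (int i + 1) \<and> \<pi> i \<in> wspan cdeg_var {2}"
    and P: "P = pi0 J d r + (\<Sum>i=1..r. \<pi> i)"
    and X: "schouten J r P P \<in> fge q"
  shows "d_ext J d r (schouten J r P P) \<in> fge (q + 1)"
proof -
  let ?X = "schouten J r P P"
  have ev: "gpar False (\<pi> i)" if "i \<in> {1..r}" for i using \<pi>[of i] that by (auto intro: cdeg2_even)
  have h: "\<pi> i \<in> h_le J r" if "i \<in> {1..r}" for i
    using \<pi>[of i] that Tlv_mono[of i "Suc r"] by (auto simp: h_le_eq intro: subalg_mono)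
  have Ph: "P \<in> h_le J r" unfolding P using pi0_h_le h by (auto simp: h_le_eq intro!: subalg_add subalg_sum)
  have Pev: "gpar False P" unfolding P by (intro gpar_add pi0_even gpar_sum ev)
  have "0 = schouten J r (pi0 J d r) ?X + (\<Sum>i=1..r. schouten J r (\<pi> i) ?X)"
    using schouten_jacobi[OF Pev Ph] unfolding P by (simp add: schouten_add_left schouten_sum_left)
  then have "d_ext J d r ?X = - (schouten J r (pi0 J d r) ?X - d_ext J d r ?X) - (\<Sum>i=1..r. schouten J r (\<pi> i) ?X)"
    by (simp add: algebra_simps)
  moreover have "schouten J r (\<pi> i) ?X \<in> fge (q + 1)" if "i \<in> {1..r}" for i
    by (rule schouten_fge'[of _ i]) (use \<pi>[of i] that ev X in auto)
  ultimately show ?thesis using schouten_pi0_fge[OF X, of r]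
    by (metis (no_types, lifting) fge_diff fge_sum fge_uminus)
qed

end

subsection \<open>Exactness of the obstructions\<close>

lemma mon_weight_nonpos: "(\<And>v. v \<in> Poly_Mapping.keys u \<Longrightarrow> w v \<le> 0) \<Longrightarrow> mon_weight w u \<le> 0"
  unfolding mon_weight_def by (intro sum_nonpos) (auto intro: mult_nonneg_nonpos)

lemma cdeg_xi_only: "xi_only \<nu> \<Longrightarrow> mon_weight cdeg_var \<nu> = mon_weight fdeg_var \<nu>"
  unfolding mon_weight_def
proof (intro sum.cong refl)
  fix v assume "xi_only \<nu>" "v \<in> Poly_Mapping.keys \<nu>"
  then have "v \<notin> XV" by (auto simp: xi_only_def)
  then show "int (Poly_Mapping.lookup \<nu> v) * cdeg_var v = int (Poly_Mapping.lookup \<nu> v) * fdeg_var v"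
    by (cases v) auto
qed

context minimal_model begin

text \<open>In contrast to \<open>D\<close> the \<xi> are killed here, so the differential acts on
  coefficients in every filtration degree, not only the top one.\<close>

lemma xi_coeff_der_gd:
  assumes X: "X \<in> subalg TV" and \<nu>: "xi_only \<nu>"
  shows "xi_coeff \<nu> (der gd X) = d (xi_coeff \<nu> X)"
proof -
  let ?N = "mon_restr (- XV) ` gkeys X"
  have "xi_coeff \<nu> (der gd (xi_coeff \<mu> X * gmonom \<mu> 1)) = (if \<nu> = \<mu> then d (xi_coeff \<nu> X) else 0)" if \<mu>: "\<mu> \<in> ?N" for \<mu>
  proof -
    have xi: "xi_only \<mu>" using \<mu> by auto
    have adm: "admissible \<mu>" using \<mu> by (rule gkeys_restr_admissible)
    have r: "xi_coeff \<mu> X \<in> R_alg J" using xi X(1) by (rule xi_coeff_R)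
    have "(gmonom \<mu> 1 :: 'k galg) \<in> subalg (- XV)"
      using xi by (intro subalg_gmonom) (auto simp: xi_only_def)
    then have "der gd (gmonom \<mu> 1) = 0"
      by (rule der_zero_fun) (use Rv_XV in \<open>auto intro!: gd_not_R\<close>)
    moreover have "der gd (xi_coeff \<mu> X * gmonom \<mu> 1)
        = der gd (xi_coeff \<mu> X) * gmonom \<mu> 1 + gsgn (xi_coeff \<mu> X) * der gd (gmonom \<mu> 1)"
      by (rule der_mult_odd[of _ UNIV]) (auto intro: gpar_gd)
    ultimately have "der gd (xi_coeff \<mu> X * gmonom \<mu> 1) = d (xi_coeff \<mu> X) * gmonom \<mu> 1"
      using r by (simp add: d_eq_der)
    moreover have "xi_coeff \<nu> (d (xi_coeff \<mu> X) * gmonom \<mu> 1) = (if \<nu> = \<mu> then d (xi_coeff \<mu> X) else 0)"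
      using r d_R by (intro xi_coeff_basis \<nu> xi adm R_XV)
    ultimately show ?thesis by auto
  qed
  then have "xi_coeff \<nu> (der gd (\<Sum>\<mu>\<in>?N. xi_coeff \<mu> X * gmonom \<mu> 1)) = (\<Sum>\<mu>\<in>?N. if \<nu> = \<mu> then d (xi_coeff \<nu> X) else 0)"
    unfolding der_sum xi_coeff_sum[OF \<nu>(1)] by (rule sum.cong[OF refl])
  also have "\<dots> = d (xi_coeff \<nu> X)" using xi_coeff_outside[OF \<nu>(1), of X] by auto
  finally show ?thesis by (simp add: xi_coeff_expand_self)
qed

lemma der_gd_gproj:
  assumes g: "\<And>v. gd v \<in> wspan w {w v + c}"
  shows "gproj (\<lambda>u. mon_weight w u = e + c) (der gd X) = der gd (gproj (\<lambda>u. mon_weight w u = e) X)"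
proof (rule gproj_commute[of X UNIV])
  fix u v and a :: 'k assume v: "v \<in> gkeys (der gd (gmonom u a))"
  have "der gd (gmonom u a) \<in> wspan w {mon_weight w u + c}"
    by (rule der_wspan[of _ UNIV w "{mon_weight w u}" _ "\<lambda>v. {w v + c}"]) (auto intro: g gmonom_wspan)
  then show "mon_weight w v = e + c \<longleftrightarrow> mon_weight w u = e" using v by (auto simp: wspan_def kspan_def)
qed (auto simp: kspan_def der_add)

text \<open>All degrees are nonpositive, so a variable of level l forces degree at most -l. This
  keeps primitives inside the multiderivations of level at most \<open>r\<close>.\<close>

lemma R_cdeg_level:
  assumes "Y \<in> R_alg J" "Y \<in> wspan cdeg_var {- int r}"
  shows "Y \<in> subalg (Rlv (Suc r))"
  unfolding subalg_def
proof safe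
  fix u v assume u: "u \<in> gkeys Y" and v: "v \<in> Poly_Mapping.keys u"
  have k: "Poly_Mapping.keys u \<subseteq> Rv" using u assms(1) by (auto simp: R_alg_eq subalg_def)
  then obtain l i where l: "v = Xvar l i" "i \<in> J l" using v by (auto simp: Rv_def)
  let ?u = "u - Poly_Mapping.single v (Suc 0)"
  have "mon_weight cdeg_var ?u \<le> 0"
  proof (rule mon_weight_nonpos)
    fix x assume "x \<in> Poly_Mapping.keys ?u"
    then have "x \<in> Rv" using keys_minus_subset k by blast
    then show "cdeg_var x \<le> 0" by (auto simp: Rv_def)
  qed
  moreover have "mon_weight cdeg_var ?u = mon_weight cdeg_var u - cdeg_var v"
    using v by (intro mon_weight_minus) (simp add: in_keys_iff)
  moreover have "mon_weight cdeg_var u = - int r" using u assms(2) by (auto simp: wspan_def kspan_def)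
  ultimately have "l < Suc r" using l by simp
  then show "v \<in> Rlv (Suc r)" using l by (auto simp: Rlv_def)
qed

text \<open>Only coefficients at filtration degree r + 2 matter. On \<xi>-monomials this is also the
  cohomological degree, so the coefficients are cycles of degree 1 - r: for r at least 2 they
  project to 0 in S, and for r = 1 \<open>base\<close> puts the projection into I. Exactness of R
  supplies primitives.\<close>

lemma obstruction_exact:
  assumes r: "r \<ge> 1" and X: "X \<in> h_le J r" "X \<in> wspan cdeg_var {3}" "X \<in> fge (int r + 2)"
    and closed: "d_ext J d r X \<in> fge (int r + 3)"
    and base: "\<And>\<nu>. r = 1 \<Longrightarrow> xi_only \<nu> \<Longrightarrow> proj_S n (xi_coeff \<nu> X) \<in> I"
  shows "\<exists>\<tau>. \<tau> \<in> h_le J r \<and> \<tau> \<in> wspan cdeg_var {2} \<and> \<tau> \<in> fge (int r + 2) \<and>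
     X + 2 * der gd \<tau> \<in> fge (int r + 3)"
proof -
  let ?q = "int r + 2"
  have XT: "X \<in> subalg TV" using X(1) Tlv_TV by (auto simp: h_le_eq intro: subalg_mono)
  let ?N = "{\<nu> \<in> mon_restr (- XV) ` gkeys X. mon_weight fdeg_var \<nu> = ?q}"
  have N: "xi_only \<nu>" "admissible \<nu>" "(gmonom \<nu> 1 :: 'k galg) \<in> subalg (Tlv (Suc r))"
      "mon_weight fdeg_var \<nu> = ?q" if "\<nu> \<in> ?N" for \<nu>
  proof -
    from that show "xi_only \<nu>" "mon_weight fdeg_var \<nu> = ?q" by auto
    from that show "admissible \<nu>" by (auto simp: admissible_restr gkeys_admissible)
    from that obtain u where u: "u \<in> gkeys X" "\<nu> = mon_restr (- XV) u" by auto
    have "Poly_Mapping.keys \<nu> \<subseteq> Poly_Mapping.keys u" unfolding u(2) by (auto simp: in_keys_iff split: if_splits)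
    then show "(gmonom \<nu> 1 :: 'k galg) \<in> subalg (Tlv (Suc r))"
      using u(1) X(1) by (intro subalg_gmonom) (auto simp: h_le_eq subalg_def)
  qed
  have "\<exists>Y. Y \<in> subalg (Rlv (Suc r)) \<and> Y \<in> R_alg J \<and> Y \<in> wspan cdeg_var {- int r} \<and> d Y = xi_coeff \<nu> X" if \<nu>: "\<nu> \<in> ?N" for \<nu>
  proof -
    let ?z = "xi_coeff \<nu> X"
    note xi = N(1)[OF \<nu>]
    have zR: "?z \<in> R_alg J" using xi XT by (rule xi_coeff_R)
    have zc: "?z \<in> wspan cdeg_var {1 - int r}"
      by (rule xi_coeff_wspan[OF xi X(2)]) (use N(4)[OF \<nu>] xi in \<open>simp add: cdeg_xi_only\<close>)
    have "d ?z = 0"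
    proof -
      have "xi_coeff \<nu> (d_ext J d r X) = 0" using closed xi N(4)[OF \<nu>] by (auto simp: fge_iff)
      then show ?thesis using X(1) by (simp add: d_ext_der xi_coeff_der_gd[OF XT xi])
    qed
    moreover have "proj_S n ?z \<in> I"
    proof (cases "r = 1")
      case True then show ?thesis using base xi by simp
    next
      case False
      have "proj_S n ?z = 0" unfolding proj_S_gproj
      proof (rule gproj_none)
        fix u assume u: "u \<in> gkeys ?z"
        show "\<not> Poly_Mapping.keys u \<subseteq> Sv"
        proof
          assume "Poly_Mapping.keys u \<subseteq> Sv"
          then have "mon_weight cdeg_var u = 0" unfolding mon_weight_def by (intro sum.neutral) (auto simp: Sv_def)
          moreover have "mon_weight cdeg_var u = 1 - int r" using u zc by (auto simp: wspan_def kspan_def)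
          ultimately show False using False by simp
        qed
      qed
      then show ?thesis by simp
    qed
    ultimately obtain Y0 where Y0: "Y0 \<in> R_alg J" "d Y0 = ?z" using R_exact[OF zR] by blast
    let ?Y = "gproj (\<lambda>u. mon_weight cdeg_var u = - int r) Y0"
    have YR: "?Y \<in> R_alg J" using Y0(1) unfolding R_alg_eq by (rule gproj_subalg)
    have Yc: "?Y \<in> wspan cdeg_var {- int r}" by (auto simp: wspan_def kspan_def gkeys_gproj)
    have "gproj (\<lambda>u. mon_weight cdeg_var u = - int r + 1) ?z = ?z"
      using zc by (intro gproj_id) (auto simp: wspan_def kspan_def)
    then have "d ?Y = ?z"
      using der_gd_gproj[OF gd_cdeg, of "- int r" Y0] Y0 YR by (simp add: d_eq_der)
    then show ?thesis using YR Yc R_cdeg_level[OF YR Yc] by blast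
  qed
  then have "\<exists>Y. \<forall>\<nu>\<in>?N. Y \<nu> \<in> subalg (Rlv (Suc r)) \<and> Y \<nu> \<in> R_alg J \<and> Y \<nu> \<in> wspan cdeg_var {- int r} \<and> d (Y \<nu>) = xi_coeff \<nu> X"
    by (intro bchoice ballI)
  then obtain Y where Y: "\<And>\<nu>. \<nu> \<in> ?N \<Longrightarrow> Y \<nu> \<in> subalg (Rlv (Suc r)) \<and> Y \<nu> \<in> R_alg J \<and> Y \<nu> \<in> wspan cdeg_var {- int r} \<and> d (Y \<nu>) = xi_coeff \<nu> X"
    by blast
  define Z where "Z = (\<Sum>\<nu>\<in>?N. Y \<nu> * gmonom \<nu> 1)"
  \<comment> \<open>The factor -1/2 solves X + 2 \<partial>\<tau> = 0 in leading order.\<close>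
  define \<tau> where "\<tau> = gconst (- (1/2)) * Z"
  have Zxi: "xi_coeff \<nu> Z = (if \<nu> \<in> ?N then Y \<nu> else 0)" if xi: "xi_only \<nu>" for \<nu>
  proof -
    have "xi_coeff \<nu> Z = (\<Sum>\<mu>\<in>?N. if \<nu> = \<mu> then Y \<mu> else 0)"
      unfolding Z_def xi_coeff_sum[OF xi]
    proof (intro sum.cong refl)
      fix \<mu> assume \<mu>: "\<mu> \<in> ?N"
      have "Y \<mu> \<in> subalg XV" using Y[OF \<mu>] R_XV by blast
      then show "xi_coeff \<nu> (Y \<mu> * gmonom \<mu> 1) = (if \<nu> = \<mu> then Y \<mu> else 0)"
        by (rule xi_coeff_basis[OF xi N(1)[OF \<mu>] N(2)[OF \<mu>]])
    qed
    then show ?thesis by simp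
  qed
  have Zh: "Z \<in> h_le J r" unfolding Z_def h_le_eq
  proof (intro subalg_sum subalg_mult)
    fix \<nu> assume \<nu>: "\<nu> \<in> ?N"
    show "Y \<nu> \<in> subalg (Tlv (Suc r))" using Y[OF \<nu>] Rlv_Tlv[of "Suc r"] by (blast intro: subalg_mono)
    show "gmonom \<nu> (1 :: 'k) \<in> subalg (Tlv (Suc r))" using \<nu> by (rule N(3))
  qed
  have Zc: "Z \<in> wspan cdeg_var {2}" unfolding Z_def
  proof (intro wspan_sum)
    fix \<nu> assume \<nu>: "\<nu> \<in> ?N"
    have "gmonom \<nu> 1 \<in> wspan cdeg_var {?q}" by (rule gmonom_wspan) (simp add: cdeg_xi_only N[OF \<nu>])
    then show "Y \<nu> * gmonom \<nu> 1 \<in> wspan cdeg_var {2}"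
      using Y[OF \<nu>] by (auto intro: wspan_mult)
  qed
  have Zf: "Z \<in> fge ?q" unfolding fge_iff using Zxi by auto
  have t2: "2 * der gd \<tau> = - der gd Z"
  proof -
    have "2 * der gd \<tau> = gconst (2 * - (1/2)) * der gd Z"
      unfolding \<tau>_def der_gconst_mult gconst_mult by (simp add: gconst_numeral mult.assoc)
    also have "gconst (2 * - (1/2) :: 'k) = - 1" by (simp add: gconst_uminus)
    finally show ?thesis by simp
  qed
  have ZT: "Z \<in> subalg TV" using Zh Tlv_TV by (auto simp: h_le_eq intro: subalg_mono)
  have "X + 2 * der gd \<tau> \<in> fge (int r + 3)" unfolding fge_iff
  proof (intro allI impI)
    fix \<nu> assume xi: "xi_only \<nu>" and lt: "mon_weight fdeg_var \<nu> < int r + 3"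
    have e: "xi_coeff \<nu> (X + 2 * der gd \<tau>) = xi_coeff \<nu> X - d (xi_coeff \<nu> Z)"
      unfolding t2 using xi xi_coeff_der_gd[OF ZT xi] by (simp add: xi_coeff_diff)
    show "xi_coeff \<nu> (X + 2 * der gd \<tau>) = 0"
    proof (cases "\<nu> \<in> ?N")
      case True then show ?thesis unfolding e Zxi[OF xi] using Y by simp
    next
      case False
      then have "xi_coeff \<nu> X = 0"
        using xi lt X(3) xi_coeff_outside[OF xi, of X] unfolding fge_iff
        by (cases "mon_weight fdeg_var \<nu> = ?q") auto
      then show ?thesis unfolding e Zxi[OF xi] using False by auto
    qed
  qed
  moreover have "\<tau> \<in> h_le J r" "\<tau> \<in> wspan cdeg_var {2}" "\<tau> \<in> fge ?q"
    using Zh Zc Zf unfolding \<tau>_def h_le_eq fge_def by (auto intro: subalg_gconst_mult wspan_gconst_mult)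
  ultimately show ?thesis by (intro exI[of _ \<tau>] conjI)
qed

end

section \<open>Poisson brackets as biderivations\<close>

locale poisson_minimal_model = minimal_model +
  fixes br :: "'a galg \<Rightarrow> 'a galg \<Rightarrow> 'a galg"
  assumes br: "is_poisson_bracket n br" and br_ideal: "is_poisson_ideal n br I"
begin

abbreviation x :: "nat \<Rightarrow> 'a galg" where "x i \<equiv> gvar (Xvar 0 i)"
abbreviation \<xi> :: "nat \<Rightarrow> 'a galg" where "\<xi> i \<equiv> gvar (Xivar 0 i)"

lemma br_S: "a \<in> S_alg n \<Longrightarrow> b \<in> S_alg n \<Longrightarrow> br a b \<in> S_alg n"
  and br_add: "a \<in> S_alg n \<Longrightarrow> b \<in> S_alg n \<Longrightarrow> c \<in> S_alg n \<Longrightarrow> br (a + b) c = br a c + br b c"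
  and br_scale: "a \<in> S_alg n \<Longrightarrow> b \<in> S_alg n \<Longrightarrow> br (gconst t * a) b = gconst t * br a b"
  and br_anti: "a \<in> S_alg n \<Longrightarrow> b \<in> S_alg n \<Longrightarrow> br a b = - br b a"
  and br_leibniz: "a \<in> S_alg n \<Longrightarrow> b \<in> S_alg n \<Longrightarrow> c \<in> S_alg n \<Longrightarrow> br a (b * c) = br a b * c + b * br a c"
  and br_jacobi: "a \<in> S_alg n \<Longrightarrow> b \<in> S_alg n \<Longrightarrow> c \<in> S_alg n \<Longrightarrow>
        br a (br b c) + br b (br c a) + br c (br a b) = 0"
  using br unfolding is_poisson_bracket_def by blast+

lemma x_S: "i \<in> {1..n} \<Longrightarrow> x i \<in> S_alg n"
  by (auto simp: S_alg_eq Sv_def intro!: subalg_gvar)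

lemma br_mult_left: "a \<in> S_alg n \<Longrightarrow> b \<in> S_alg n \<Longrightarrow> c \<in> S_alg n \<Longrightarrow> br (a * b) c = br a c * b + a * br b c"
  using br_anti[of "a * b" c] br_leibniz[of c a b] br_anti[of a c] br_anti[of b c]
  by (simp add: S_alg_eq subalg_mult)

lemma br_1: "c \<in> S_alg n \<Longrightarrow> br 1 c = 0"
  using br_mult_left[of 1 1 c] by (simp add: S_alg_eq)

lemma br_chain:
  assumes f: "f \<in> S_alg n" and c: "c \<in> S_alg n"
  shows "br f c = (\<Sum>i=1..n. lderiv (Xvar 0 i) f * br (x i) c)"
  using f unfolding S_alg_eq
proof (induction f rule: subalg_induct)
  case (add X Y)
  then show ?case using c by (simp add: br_add S_alg_eq lderiv_add distrib_right sum.distrib)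
next
  case (const t)
  have "br (gconst t * 1) c = 0" using br_scale[of 1 c t] c by (simp add: S_alg_eq br_1)
  then show ?case by simp
next
  case (mult v X)
  then obtain i where v: "v = Xvar 0 i" "i \<in> {1..n}" by (auto simp: Sv_def)
  have xi: "x i \<in> S_alg n" using v by (intro x_S) auto
  have o: "\<not> odd_var (Xvar 0 k)" for k by (simp add: odd_var_def)
  have "(\<Sum>k=1..n. lderiv (Xvar 0 k) (gvar v * X) * br (x k) c)
     = (\<Sum>k=1..n. (if k = i then X * br (x i) c else 0) + x i * (lderiv (Xvar 0 k) X * br (x k) c))"
    by (intro sum.cong refl) (auto simp: v lderiv_gvar_mult gsgn_if_def o distrib_right mult.assoc)
  also have "\<dots> = X * br (x i) c + x i * br X c"
    using v mult.IH by (simp add: sum.distrib sum_distrib_left sum.delta)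
  also have "\<dots> = br (gvar v * X) c"
    using br_mult_left[OF xi _ c, of X] mult.hyps S_commute[OF br_S[OF xi c], of X] by (simp add: v S_alg_eq)
  finally show ?case by simp
qed

end

subsection \<open>The Poisson bivector\<close>

lemma sum_rotate: "(\<Sum>a\<in>A. \<Sum>b\<in>A. \<Sum>c\<in>A. F b c a) = (\<Sum>a\<in>A. \<Sum>b\<in>A. \<Sum>c\<in>A. (F a b c :: 'x::comm_monoid_add))"
proof -
  have "(\<Sum>a\<in>A. \<Sum>b\<in>A. \<Sum>c\<in>A. F b c a) = (\<Sum>b\<in>A. \<Sum>a\<in>A. \<Sum>c\<in>A. F b c a)" by (rule sum.swap)
  also have "\<dots> = (\<Sum>b\<in>A. \<Sum>c\<in>A. \<Sum>a\<in>A. F b c a)" by (rule sum.cong[OF refl]) (rule sum.swap)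
  finally show ?thesis .
qed

context minimal_model begin

lemma schouten_h_le: "X \<in> h_le J r \<Longrightarrow> Y \<in> h_le J r \<Longrightarrow> schouten J r X Y \<in> h_le J r"
  unfolding h_le_eq schouten_def rderiv_lderiv
  by (intro subalg_sum subalg_diff subalg_mult) (auto intro!: lderiv_subalg gsgn_subalg)

lemma der_gd_h_le: "X \<in> h_le J r \<Longrightarrow> der gd X \<in> h_le J r"
  unfolding h_le_eq
proof (rule der_subalg)
  fix v assume "v \<in> Tlv (Suc r)"
  then obtain m i where "m < Suc r" "v \<in> {Xvar m i, Xivar m i}" by (rule TlvE)
  then show "gd v \<in> subalg (Tlv (Suc r))" using gd_Tlv[of m "Suc r" i] by auto
qed auto

end

context poisson_minimal_model begin

abbreviation LL :: "nat \<Rightarrow> nat \<Rightarrow> 'a galg" where "LL i j \<equiv> br (x i) (x j)"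

lemma LL_S: "i \<in> {1..n} \<Longrightarrow> j \<in> {1..n} \<Longrightarrow> LL i j \<in> S_alg n"
  by (intro br_S x_S)

lemma S_gsgn: "s \<in> S_alg n \<Longrightarrow> gsgn s = (s :: 'a galg)"
proof -
  assume s: "s \<in> S_alg n"
  then have "gpar False s" by (auto simp: gpar_def S_alg_eq subalg_def odd_part_Sv)
  then show ?thesis by (simp add: gpar_gsgn)
qed

lemma S_lderiv_xi: "s \<in> S_alg n \<Longrightarrow> lderiv (Xivar m i) s = (0 :: 'a galg)"
  unfolding S_alg_eq by (rule lderiv_subalg_0) (auto simp: Sv_def)

lemma odd_xi: "odd_var (Xivar 0 i)" "\<not> odd_var (Xvar 0 i)"
  by (simp_all add: odd_var_def)

lemma half_double: "gconst (1/2) * X + gconst (1/2) * X = (X :: 'a galg)"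
  by (rule galg_eqI) simp

lemma pi1_eq: "pi1 n br = gconst (1/2) * (\<Sum>a=1..n. \<Sum>b=1..n. LL a b * \<xi> a * \<xi> b)"
  by (simp add: pi1_def)

lemma S_cdeg: "s \<in> S_alg n \<Longrightarrow> (s :: 'a galg) \<in> wspan cdeg_var {0}"
proof (rule wspan_cong[of _ Sv "\<lambda>_. 0"])
  show "s \<in> wspan (\<lambda>_. 0) {0}" by (auto simp: wspan_def kspan_def mon_weight_def)
qed (auto simp: S_alg_eq Sv_def)

lemma pi1_cdeg: "pi1 n br \<in> wspan cdeg_var {2}"
  unfolding pi1_eq
proof (intro wspan_gconst_mult wspan_sum)
  fix a b assume "a \<in> {1..n}" "b \<in> {1..n}"
  then have "LL a b \<in> wspan cdeg_var {0}" by (intro S_cdeg LL_S)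
  moreover have "\<xi> a \<in> wspan cdeg_var {1}" "\<xi> b \<in> wspan cdeg_var {1}" by (simp_all add: gvar_wspan)
  ultimately have "LL a b * \<xi> a \<in> wspan cdeg_var {1}" "\<xi> b \<in> wspan cdeg_var {1}" by (auto intro: wspan_mult)
  then show "LL a b * \<xi> a * \<xi> b \<in> wspan cdeg_var {2}" by (rule wspan_mult) auto
qed

lemma pi1_even: "gpar False (pi1 n br)"
  by (rule cdeg2_even[OF pi1_cdeg])

lemma S_h0: "s \<in> S_alg n \<Longrightarrow> s \<in> subalg (Tlv (Suc 0))"
  unfolding S_alg_eq by (rule subalg_mono) (auto simp: Sv_def Tlv_def J0)

lemma xi_h0: "i \<in> {1..n} \<Longrightarrow> \<xi> i \<in> subalg (Tlv (Suc 0))"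
  by (rule subalg_gvar) (auto simp: Tlv_def J0)

lemma pi1_h: "pi1 n br \<in> h_le J 0"
  unfolding pi1_eq h_le_eq
  by (intro subalg_gconst_mult subalg_sum subalg_mult) (auto intro!: S_h0 LL_S xi_h0)

lemma pi1_fge: "pi1 n br \<in> fge 2"
  unfolding pi1_eq fge_def
proof (intro wspan_gconst_mult wspan_sum, fold fge_def)
  fix a b
  have "LL a b \<in> fge 0" using fdeg_nonneg by (auto simp: fge_def wspan_def kspan_def)
  moreover have x1: "\<xi> i \<in> fge 1" for i unfolding fge_def by (rule gvar_wspan) simp
  ultimately have "LL a b * \<xi> a \<in> fge 1" by (rule fge_mult) simp
  then show "LL a b * \<xi> a * \<xi> b \<in> fge 2" using x1 by (rule fge_mult) simp
qed

text \<open>Each bracket occurs twice by antisymmetry, which cancels the factor 1/2.\<close>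

lemma lderiv_xi_pi1:
  assumes i: "i \<in> {1..n}"
  shows "lderiv (Xivar 0 i) (pi1 n br) = (\<Sum>k=1..n. LL i k * \<xi> k)"
proof -
  have t: "lderiv (Xivar 0 i) (LL a b * \<xi> a * \<xi> b)
      = (if a = i then LL a b * \<xi> b else 0) - (if b = i then LL a b * \<xi> a else 0)"
    if "a \<in> {1..n}" "b \<in> {1..n}" for a b
    using S_gsgn[OF LL_S[OF that]] S_lderiv_xi[OF LL_S[OF that], of 0 i]
    by (auto simp: lderiv_mult lderiv_gvar gsgn_if_def odd_xi gsgn_mult gsgn_gvar)
  have "lderiv (Xivar 0 i) (\<Sum>a=1..n. \<Sum>b=1..n. LL a b * \<xi> a * \<xi> b)
      = (\<Sum>a=1..n. \<Sum>b=1..n. (if a = i then LL a b * \<xi> b else 0) - (if b = i then LL a b * \<xi> a else 0))"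
    unfolding lderiv_sum by (intro sum.cong refl t)
  also have "\<dots> = (\<Sum>a=1..n. \<Sum>b=1..n. if a = i then LL a b * \<xi> b else 0)
      - (\<Sum>a=1..n. \<Sum>b=1..n. if b = i then LL a b * \<xi> a else 0)"
    by (simp add: sum_subtractf)
  also have "(\<Sum>a=1..n. \<Sum>b=1..n. if a = i then LL a b * \<xi> b else 0) = (\<Sum>b=1..n. LL i b * \<xi> b)"
    by (subst sum.swap) (use i in \<open>simp add: sum.delta\<close>)
  also have "(\<Sum>a=1..n. \<Sum>b=1..n. if b = i then LL a b * \<xi> a else 0) = (\<Sum>a=1..n. - (LL i a * \<xi> a))"
  proof (rule sum.cong[OF refl])
    fix a assume a: "a \<in> {1..n}"
    have "(\<Sum>b=1..n. if b = i then LL a b * \<xi> a else 0) = LL a i * \<xi> a" using i by (simp add: sum.delta)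
    also have "LL a i = - LL i a" by (intro br_anti x_S a i)
    finally show "(\<Sum>b=1..n. if b = i then LL a b * \<xi> a else 0) = - (LL i a * \<xi> a)" by simp
  qed
  also have "(\<Sum>b=1..n. LL i b * \<xi> b) - (\<Sum>a=1..n. - (LL i a * \<xi> a)) = (\<Sum>k=1..n. LL i k * \<xi> k) + (\<Sum>k=1..n. LL i k * \<xi> k)"
    by (simp add: sum_negf)
  finally show ?thesis
    unfolding pi1_eq lderiv_gconst_mult by (simp add: distrib_left half_double)
qed

lemma lderiv_x_pi1:
  "lderiv (Xvar 0 i) (pi1 n br) = gconst (1/2) * (\<Sum>a=1..n. \<Sum>b=1..n. lderiv (Xvar 0 i) (LL a b) * (\<xi> a * \<xi> b))"
  unfolding pi1_eq lderiv_gconst_mult lderiv_sum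
  by (simp add: lderiv_mult lderiv_gvar mult.assoc)

lemma S_xi_commute:
  assumes "s \<in> S_alg n" "t \<in> S_alg n" shows "(s * \<xi> k) * (t * Y) = (t * s) * (\<xi> k * Y)"
proof -
  have "(s * \<xi> k) * (t * Y) = s * (\<xi> k * t) * Y" by (simp add: mult.assoc)
  also have "\<xi> k * t = t * \<xi> k" by (rule S_commute[OF assms(2), symmetric])
  also have "s * (t * \<xi> k) * Y = (s * t) * (\<xi> k * Y)" by (simp add: mult.assoc)
  also have "s * t = t * s" by (rule S_commute[OF assms(1)])
  finally show ?thesis .
qed

lemma lderiv_S: "s \<in> S_alg n \<Longrightarrow> lderiv v s \<in> S_alg n"
  unfolding S_alg_eq by (rule lderiv_subalg)

text \<open>The chain rule for the bracket: contracting the Hamiltonian coefficients with the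
  gradient of \<open>f\<close> produces the brackets of \<open>f\<close> with the
  coordinates.\<close>

lemma contract:
  assumes f: "f \<in> S_alg n"
  shows "(\<Sum>i=1..n. (\<Sum>k=1..n. LL i k * \<xi> k) * (lderiv (Xvar 0 i) f * Y)) = (\<Sum>k=1..n. br f (x k) * (\<xi> k * Y))"
proof -
  have "(\<Sum>i=1..n. (\<Sum>k=1..n. LL i k * \<xi> k) * (lderiv (Xvar 0 i) f * Y))
      = (\<Sum>i=1..n. \<Sum>k=1..n. (lderiv (Xvar 0 i) f * LL i k) * (\<xi> k * Y))"
    unfolding sum_distrib_right
    by (intro sum.cong refl S_xi_commute LL_S lderiv_S f) auto
  also have "\<dots> = (\<Sum>k=1..n. \<Sum>i=1..n. (lderiv (Xvar 0 i) f * LL i k) * (\<xi> k * Y))" by (rule sum.swap)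
  also have "\<dots> = (\<Sum>k=1..n. br f (x k) * (\<xi> k * Y))"
    by (intro sum.cong refl) (simp add: br_chain[OF f x_S] sum_distrib_right)
  finally show ?thesis .
qed

lemma schouten_pi1: "schouten J 0 (pi1 n br) Y = - (\<Sum>i=1..n.
     lderiv (Xivar 0 i) (pi1 n br) * lderiv (Xvar 0 i) Y + lderiv (Xvar 0 i) (pi1 n br) * lderiv (Xivar 0 i) Y)"
  unfolding schouten_even[OF pi1_even] level_sign_def sum_negf[symmetric] by (simp add: J0)

text \<open>The square is a sum of iterated brackets times products of three odd \<xi>, which are
  invariant under cyclic rotation. Adding the three rotations of the sum produces the Jacobi
  identity, so three times the sum vanishes.\<close>

lemma schouten_pi1_pi1: "schouten J 0 (pi1 n br) (pi1 n br) = 0"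
proof -
  let ?G = "\<lambda>a b c. br (LL a b) (x c)"
  define Z where "Z = (\<Sum>a=1..n. \<Sum>b=1..n. \<Sum>c=1..n. ?G a b c * (\<xi> c * (\<xi> a * \<xi> b)))"
  have t: "lderiv (Xivar 0 i) (pi1 n br) * lderiv (Xvar 0 i) (pi1 n br) + lderiv (Xvar 0 i) (pi1 n br) * lderiv (Xivar 0 i) (pi1 n br)
      = (\<Sum>a=1..n. \<Sum>b=1..n. (\<Sum>k=1..n. LL i k * \<xi> k) * (lderiv (Xvar 0 i) (LL a b) * (\<xi> a * \<xi> b)))"
    if i: "i \<in> {1..n}" for i
  proof -
    let ?a = "lderiv (Xivar 0 i) (pi1 n br)"
    let ?W = "\<Sum>a=1..n. \<Sum>b=1..n. lderiv (Xvar 0 i) (LL a b) * (\<xi> a * \<xi> b)"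
    have "lderiv (Xvar 0 i) (pi1 n br) * ?a = ?a * lderiv (Xvar 0 i) (pi1 n br)"
      using gpar_commute[OF gpar_lderiv[OF pi1_even, of "Xvar 0 i"] gpar_lderiv[OF pi1_even, of "Xivar 0 i"]]
      by (simp add: odd_xi)
    then have "?a * lderiv (Xvar 0 i) (pi1 n br) + lderiv (Xvar 0 i) (pi1 n br) * ?a
        = ?a * (gconst (1/2) * ?W + gconst (1/2) * ?W)"
      unfolding lderiv_x_pi1 by (simp only: distrib_left)
    also have "gconst (1/2) * ?W + gconst (1/2) * ?W = ?W" by (rule half_double)
    also have "?a * ?W = (\<Sum>a=1..n. \<Sum>b=1..n. (\<Sum>k=1..n. LL i k * \<xi> k) * (lderiv (Xvar 0 i) (LL a b) * (\<xi> a * \<xi> b)))"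
      unfolding lderiv_xi_pi1[OF i] by (simp only: sum_distrib_left)
    finally show ?thesis .
  qed
  have "schouten J 0 (pi1 n br) (pi1 n br)
      = - (\<Sum>i=1..n. \<Sum>a=1..n. \<Sum>b=1..n. (\<Sum>k=1..n. LL i k * \<xi> k) * (lderiv (Xvar 0 i) (LL a b) * (\<xi> a * \<xi> b)))"
    unfolding schouten_pi1 by (intro arg_cong[of _ _ uminus] sum.cong[OF refl] t)
  also have "(\<Sum>i=1..n. \<Sum>a=1..n. \<Sum>b=1..n. (\<Sum>k=1..n. LL i k * \<xi> k) * (lderiv (Xvar 0 i) (LL a b) * (\<xi> a * \<xi> b)))
      = (\<Sum>a=1..n. \<Sum>b=1..n. \<Sum>i=1..n. (\<Sum>k=1..n. LL i k * \<xi> k) * (lderiv (Xvar 0 i) (LL a b) * (\<xi> a * \<xi> b)))"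
  proof -
    have "(\<Sum>i=1..n. \<Sum>a=1..n. \<Sum>b=1..n. F i a b) = (\<Sum>a=1..n. \<Sum>b=1..n. \<Sum>i=1..n. F i a b)"
      for F :: "nat \<Rightarrow> nat \<Rightarrow> nat \<Rightarrow> 'a galg"
      by (rule trans[OF sum.swap]) (rule sum.cong[OF refl], rule sum.swap)
    then show ?thesis .
  qed
  also have "\<dots> = Z" unfolding Z_def by (intro sum.cong refl contract LL_S)
  finally have Z: "schouten J 0 (pi1 n br) (pi1 n br) = - Z" .
  have odd: "gpar True (\<xi> a)" for a using gpar_gvar[of "Xivar 0 a"] by (simp add: odd_xi)
  have rot: "\<xi> c * (\<xi> a * \<xi> b) = \<xi> a * (\<xi> b * \<xi> c)" for a b c
    using gpar_even_commute[of "\<xi> a * \<xi> b" "\<xi> c"] gpar_mult[OF odd[of a] odd[of b]] by (simp add: mult.assoc)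
  have Z1: "Z = (\<Sum>a=1..n. \<Sum>b=1..n. \<Sum>c=1..n. ?G b c a * (\<xi> c * (\<xi> a * \<xi> b)))"
  proof -
    have "Z = (\<Sum>a=1..n. \<Sum>b=1..n. \<Sum>c=1..n. ?G b c a * (\<xi> a * (\<xi> b * \<xi> c)))"
      unfolding Z_def by (rule sum_rotate[where F = "\<lambda>a b c. ?G a b c * (\<xi> c * (\<xi> a * \<xi> b))", symmetric])
    also have "\<dots> = (\<Sum>a=1..n. \<Sum>b=1..n. \<Sum>c=1..n. ?G b c a * (\<xi> c * (\<xi> a * \<xi> b)))"
      by (intro sum.cong[OF refl] arg_cong2[where f = "(*)", OF refl rot[symmetric]])
    finally show ?thesis .
  qed
  have Z2: "Z = (\<Sum>a=1..n. \<Sum>b=1..n. \<Sum>c=1..n. ?G c a b * (\<xi> c * (\<xi> a * \<xi> b)))"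
  proof -
    have "Z = (\<Sum>a=1..n. \<Sum>b=1..n. \<Sum>c=1..n. ?G c a b * (\<xi> a * (\<xi> b * \<xi> c)))"
      unfolding Z1 by (rule sum_rotate[where F = "\<lambda>a b c. ?G b c a * (\<xi> c * (\<xi> a * \<xi> b))", symmetric])
    also have "\<dots> = (\<Sum>a=1..n. \<Sum>b=1..n. \<Sum>c=1..n. ?G c a b * (\<xi> c * (\<xi> a * \<xi> b)))"
      by (intro sum.cong[OF refl] arg_cong2[where f = "(*)", OF refl rot[symmetric]])
    finally show ?thesis .
  qed
  have J: "?G a b c + ?G b c a + ?G c a b = 0" if "a \<in> {1..n}" "b \<in> {1..n}" "c \<in> {1..n}" for a b c
  proof -
    have "?G a b c = - br (x c) (LL a b)" "?G b c a = - br (x a) (LL b c)" "?G c a b = - br (x b) (LL c a)"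
      using that by (auto intro!: br_anti LL_S x_S)
    then show ?thesis using br_jacobi[OF x_S x_S x_S, OF that] by (simp add: algebra_simps add_eq_0_iff)
  qed
  have "Z + Z + Z = (\<Sum>a=1..n. \<Sum>b=1..n. \<Sum>c=1..n. ?G a b c * (\<xi> c * (\<xi> a * \<xi> b)))
     + (\<Sum>a=1..n. \<Sum>b=1..n. \<Sum>c=1..n. ?G b c a * (\<xi> c * (\<xi> a * \<xi> b)))
     + (\<Sum>a=1..n. \<Sum>b=1..n. \<Sum>c=1..n. ?G c a b * (\<xi> c * (\<xi> a * \<xi> b)))"
    by (simp only: Z1[symmetric] Z2[symmetric] Z_def[symmetric])
  also have "\<dots> = (\<Sum>a=1..n. \<Sum>b=1..n. \<Sum>c=1..n. (?G a b c + ?G b c a + ?G c a b) * (\<xi> c * (\<xi> a * \<xi> b)))"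
    by (simp only: sum.distrib distrib_right)
  also have "\<dots> = 0" using J by (intro sum.neutral ballI) simp
  finally have "(1 + 1 + 1) * Z = 0" by (simp only: distrib_right mult_1_left)
  then have "gconst 3 * Z = 0" by (simp add: gconst_numeral)
  then have "gconst (1/3) * (gconst 3 * Z) = 0" by simp
  then have "Z = 0" by (simp flip: mult.assoc gconst_mult)
  then show ?thesis using Z by simp
qed

text \<open>\<partial> of a level 1 variable lies in I, and its brackets with the coordinates stay
  there because I is a Poisson ideal.\<close>

lemma schouten_pi1_pi0: "schouten J 0 (pi1 n br) (pi0 J d 1) \<in> NN"
proof -
  let ?f = "\<lambda>j. gd (Xvar 1 j)" and ?X = "\<lambda>j. gvar (Xivar 1 j) :: 'a galg"
  have fS: "?f j \<in> S_alg n" for j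
    using gd_level[of 1 j] unfolding S_alg_eq by (rule subalg_mono) (auto simp: Rlv_def Sv_def J0)
  have fI: "?f j \<in> I" if "j \<in> J 1" for j
  proof -
    have "proj_S n (d (gvar (Xvar 1 j))) \<in> I"
      using that by (intro proj_d_I) (simp add: R_alg_eq subalg_gvar Rv_def)
    then show ?thesis using fS[of j] that by (simp add: gd_Xvar proj_S_id)
  qed
  have p: "pi0 J d 1 = (\<Sum>j\<in>J 1. ?f j * ?X j)" by (simp add: pi0_eq)
  have 1: "lderiv (Xvar 0 i) (pi0 J d 1) = (\<Sum>j\<in>J 1. lderiv (Xvar 0 i) (?f j) * ?X j)" for i
    unfolding p lderiv_sum by (simp add: lderiv_mult lderiv_gvar)
  have 2: "lderiv (Xivar 0 i) (pi0 J d 1) = 0" for i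
    unfolding p lderiv_sum using S_lderiv_xi[OF fS] by (simp add: lderiv_mult lderiv_gvar)
  have "schouten J 0 (pi1 n br) (pi0 J d 1)
      = - (\<Sum>i=1..n. \<Sum>j\<in>J 1. (\<Sum>k=1..n. LL i k * \<xi> k) * (lderiv (Xvar 0 i) (?f j) * ?X j))"
    unfolding schouten_pi1 1 2 by (simp add: lderiv_xi_pi1 sum_distrib_left)
  also have "(\<Sum>i=1..n. \<Sum>j\<in>J 1. (\<Sum>k=1..n. LL i k * \<xi> k) * (lderiv (Xvar 0 i) (?f j) * ?X j))
      = (\<Sum>j\<in>J 1. \<Sum>k=1..n. br (?f j) (x k) * (\<xi> k * ?X j))"
    by (subst sum.swap) (intro sum.cong refl contract fS)
  finally have e: "schouten J 0 (pi1 n br) (pi0 J d 1) = 0 - (\<Sum>j\<in>J 1. \<Sum>k=1..n. br (?f j) (x k) * (\<xi> k * ?X j))" by simp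
  show ?thesis unfolding e
  proof (intro NN_diff NN_0 NN_sum)
    fix j k assume jk: "j \<in> J 1" "k \<in> {1..n}"
    have bI: "br (?f j) (x k) \<in> I" using br_ideal fI[OF jk(1)] x_S[OF jk(2)] by (auto simp: is_poisson_ideal_def)
    have "\<xi> k * ?X j \<in> subalg TV" using jk by (intro subalg_mult subalg_gvar) (auto simp: TV_def J0)
    then show "br (?f j) (x k) * (\<xi> k * ?X j) \<in> NN"
      using I_S[OF bI] bI by (intro NN_I_mult S_R) (auto simp: proj_S_id)
  qed
qed

text \<open>Both squares vanish, so only the mixed bracket of \<open>pi0\<close> and
  \<open>pi1\<close> is left.\<close>

lemma obstruction_base:
  assumes "P = pi0 J d 1 + pi1 n br" "xi_only \<nu>"
  shows "proj_S n (xi_coeff \<nu> (schouten J 1 P P)) \<in> I"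
proof -
  let ?p = "pi1 n br" and ?q = "pi0 J d 1"
  have l: "schouten J 1 ?p Y = schouten J 0 ?p Y" for Y by (rule schouten_level[OF pi1_h]) simp
  have "schouten J 1 P P = schouten J 0 ?p ?q + schouten J 0 ?p ?q"
    unfolding assms(1) schouten_add_left schouten_add_right schouten_pi0_pi0
      schouten_commute[OF pi0_even pi1_even] l schouten_pi1_pi1 by simp
  then have "schouten J 1 P P \<in> NN" using NN_add[OF schouten_pi1_pi0 schouten_pi1_pi0] by simp
  then show ?thesis using assms(2) by (simp add: NN_def)
qed

end

subsection \<open>The recursion\<close>

context koszul_minimal_model begin

lemma gd_xdeg: "gd v \<in> wspan xdeg {xdeg v + 1}"
proof (cases v)
  case (Xvar m i)
  then show ?thesis using gd_quadratic[of v] by simp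
next
  case (Xivar m i)
  then show ?thesis by simp
qed

lemma pi0_xdeg: "pi0 J d r \<in> wspan xdeg {2}"
  unfolding pi0_eq
proof (intro wspan_sum)
  fix m i
  show "gd (Xvar m i) * gvar (Xivar m i) \<in> wspan xdeg {2}"
    by (rule wspan_mult[OF gd_quadratic gvar_wspan[of _ _ "{0}"]]) auto
qed

text \<open>In x-degree at most 0 no x occurs, and \<open>gd\<close> vanishes on the \<xi>.\<close>

lemma der_gd_xi: "X \<in> wspan xdeg {e} \<Longrightarrow> e \<le> 0 \<Longrightarrow> der gd X = 0"
proof (rule der_zero_fun)
  assume "X \<in> wspan xdeg {e}" "e \<le> 0"
  then show "X \<in> subalg (- XV)"
    by (intro wspan_XV_nonpos[where w = xdeg and e = e]) (auto simp: XV_def xdeg_def split: gvariable.splits)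
  show "gd v = 0" if "v \<in> - XV" for v using that Rv_XV by (intro gd_not_R) auto
qed

lemma gproj_wspan: "gproj (\<lambda>u. mon_weight w u = e) X \<in> wspan w {e}"
  by (auto simp: wspan_def kspan_def gkeys_gproj)

text \<open>If \<open>p < 0\<close>, the part of the obstruction that is quadratic in the bivector has \<open>x\<close>-degree
  \<open>2 p + 3\<close>; it bounds an element of \<open>x\<close>-degree \<open>2 p + 2 \<le> 0\<close>, which is closed.\<close>

lemma x_degree_part:
  assumes p: "p \<le> 0" and X: "X \<in> wspan xdeg {p + 3, 2 * p + 3}" and \<tau>: "X + 2 * der gd \<tau> \<in> fge q"
  shows "X + 2 * der gd (gproj (\<lambda>u. mon_weight xdeg u = p + 2) \<tau>) \<in> fge q"
proof -
  let ?g = "\<lambda>e. gproj (\<lambda>u. mon_weight xdeg u = e)"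
  let ?Z = "X + 2 * der gd \<tau>"
  have g2: "?g (e + 1) ?Z = ?g (e + 1) X + 2 * der gd (?g e \<tau>)" for e
    using der_gd_gproj[OF gd_xdeg, of e \<tau>] by (simp add: gproj_add mult_2)
  have e3: "p + 2 + 1 = p + 3" by simp
  \<comment> \<open>\<partial> raises the x-degree by exactly one, so the part of degree p + 3
    involves only the part of \<tau> of degree p + 2.\<close>
  have "?g (p + 2 + 1) ?Z \<in> fge q" by (rule gproj_fge[OF \<tau>])
  then have 1: "?g (p + 3) X + 2 * der gd (?g (p + 2) \<tau>) \<in> fge q" unfolding g2 unfolding e3 .
  show ?thesis
  proof (cases "p = 0")
    case True
    have "?g (p + 3) X = X" using X True by (intro gproj_id) (auto simp: wspan_def kspan_def)
    with 1 show ?thesis by simp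
  next
    case False
    have eq: "X = ?g (p + 3) X + ?g (2 * p + 3) X"
      by (rule galg_eqI) (use X False in \<open>auto simp: wspan_def kspan_def in_gkeys_iff\<close>)
    have "?g (2 * p + 3) X \<in> fge q"
    proof -
      have "der gd (?g (2 * p + 2) \<tau>) = 0" by (rule der_gd_xi[OF gproj_wspan]) (use p False in simp)
      then have "?g (2 * p + 2 + 1) X = ?g (2 * p + 2 + 1) ?Z" using g2[of "2 * p + 2"] by simp
      moreover have "2 * p + 2 + 1 = 2 * p + 3" by simp
      ultimately show ?thesis using gproj_fge[OF \<tau>] by simp
    qed
    from fge_add[OF 1 this] have "?g (p + 3) X + ?g (2 * p + 3) X + 2 * der gd (?g (p + 2) \<tau>) \<in> fge q"
      by (simp only: add_ac)
    then show ?thesis by (subst eq)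
  qed
qed

lemma pi_sequence_ex:
  assumes pb: "is_poisson_bracket n br" "is_poisson_ideal n br I" "bracket_has_degree n br p" and p: "p \<le> 0"
  shows "\<exists>\<pi>. is_pi_sequence n br J d \<pi> \<and> (\<forall>m\<ge>1. \<pi> m \<in> wspan xdeg {p + 2})"
proof -
  interpret poisson_minimal_model n J wt d I br
    by unfold_locales (rule pb)+
  define P where "P m \<pi> = pi0 J d (m - 1) + (\<Sum>i=1..m - 1. \<pi> i)" for m and \<pi> :: "nat \<Rightarrow> 'a galg"
  \<comment> \<open>The invariant includes m = 1, where \<open>P 1\<close> and \<open>d_ext\<close>
    are zero and the congruence is trivial; thus \<open>obstruction_step\<close> also covers the
    passage to m = 2.\<close>
  define ok where "ok m \<pi> \<longleftrightarrow> (m \<ge> 1 \<longrightarrow> (\<pi> m \<in> h_le J (m - 1) \<and> \<pi> m \<in> fge (int m + 1) \<and> \<pi> m \<in> wspan cdeg_var {2})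
     \<and> \<pi> m \<in> wspan xdeg {p + 2} \<and> (m = 1 \<longrightarrow> \<pi> m = pi1 n br)
     \<and> schouten J (m - 1) (P m \<pi>) (P m \<pi>) + 2 * d_ext J d (m - 1) (\<pi> m) \<in> fge (int m + 2))" for m \<pi>
  have P_cong: "P m f = P m g" if "\<And>l. l < m \<Longrightarrow> f l = g l" for m f g
  proof -
    have "(\<Sum>i=1..m - 1. f i) = (\<Sum>i=1..m - 1. g i)" by (intro sum.cong refl that) auto
    then show ?thesis by (simp add: P_def)
  qed
  have pi1_x: "pi1 n br \<in> wspan xdeg {p + 2}"
    unfolding pi1_eq
  proof (intro wspan_gconst_mult wspan_sum)
    fix a b assume ab: "a \<in> {1..n}" "b \<in> {1..n}"
    have "x i \<in> S_deg n 1" if "i \<in> {1..n}" for i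
      using x_S[OF that] by (auto simp: S_deg_def homogeneous_wspan gvar_wspan)
    then have "LL a b \<in> S_deg n (1 + 1 + p)" using pb(3) ab unfolding bracket_has_degree_def by blast
    then have "LL a b \<in> subalg Sv" "LL a b \<in> wspan (\<lambda>_. 1) {p + 2}"
      by (auto simp: S_deg_def S_alg_eq homogeneous_wspan add.commute)
    then have "LL a b \<in> wspan xdeg {p + 2}" by (intro wspan_cong[of _ Sv "\<lambda>_. 1" xdeg]) (auto simp: Sv_def)
    moreover have xi: "\<xi> i \<in> wspan xdeg {0}" for i by (rule gvar_wspan) simp
    ultimately have "LL a b * \<xi> a \<in> wspan xdeg {p + 2}" by (rule wspan_mult) auto
    then show "LL a b * \<xi> a * \<xi> b \<in> wspan xdeg {p + 2}" using xi by (rule wspan_mult) auto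
  qed
  have "\<exists>\<pi>. \<forall>m. ok m \<pi>"
  proof (rule dependent_choice_below)
    fix m and f :: "nat \<Rightarrow> 'a galg" assume below: "\<And>l. l < m \<Longrightarrow> ok l f"
    have P_upd: "P m (f(m := t)) = P m f" for t by (rule P_cong) simp
    consider "m = 0" | "m = 1" | "m \<ge> 2" by linarith
    then show "\<exists>t. ok m (f(m := t))"
    proof cases
      case 1 then show ?thesis by (simp add: ok_def)
    next
      case 2
      have "P (Suc 0) g = 0" for g by (simp add: P_def pi0_eq)
      then show ?thesis using 2 pi1_h pi1_fge pi1_cdeg pi1_x
        by (intro exI[of _ "pi1 n br"]) (simp add: ok_def d_ext_def)
    next
      case 3
      define r where "r = m - 1"
      have mr: "m = Suc r" "r \<ge> 1" using 3 by (auto simp: r_def)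
      define X where "X = schouten J r (P m f) (P m f)"
      have PP: "P m f = pi0 J d r + (\<Sum>i=1..r. f i)" by (simp add: P_def r_def)
      have f: "f i \<in> h_le J (i - 1) \<and> f i \<in> fge (int i + 1) \<and> f i \<in> wspan cdeg_var {2}" if "1 \<le> i" "i \<le> r" for i
        using below[of i] that mr by (simp add: ok_def)
      have fx: "f i \<in> wspan xdeg {p + 2}" if "1 \<le> i" "i \<le> r" for i
        using below[of i] that mr by (simp add: ok_def)
      have fh: "f i \<in> h_le J r" if "i \<in> {1..r}" for i
        using f[of i] that Tlv_mono[of i "Suc r"] by (auto simp: h_le_eq intro: subalg_mono)
      have Ph: "P m f \<in> h_le J r"
        unfolding PP using pi0_h_le[of r] fh unfolding h_le_eq by (intro subalg_add subalg_sum) auto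
      have Sc: "(\<Sum>i=1..r. f i) \<in> wspan cdeg_var {2}" using f by (intro wspan_sum) auto
      have Pc: "P m f \<in> wspan cdeg_var {2}"
        unfolding PP using pi0_cdeg[of r] Sc by (intro wspan_add) auto
      have Xh: "X \<in> h_le J r" unfolding X_def by (rule schouten_h_le[OF Ph Ph])
      have Xc: "X \<in> wspan cdeg_var {3}" unfolding X_def
        by (rule schouten_wspan[OF cdeg2_even[OF Pc] Pc Pc]) auto
      \<comment> \<open>The congruence of stage \<open>r\<close>, part of the invariant, is what
        makes the obstruction vanish below filtration degree r + 2.\<close>
      have Xf: "X \<in> fge (int r + 2)"
        unfolding X_def
        by (rule obstruction_step[where P = "P r f"])
          (use f below[of r] mr PP in \<open>auto simp: ok_def P_def\<close>)
      have cl: "d_ext J d r X \<in> fge (int r + 3)"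
      proof -
        have "d_ext J d r X \<in> fge (int r + 2 + 1)"
          unfolding X_def by (rule obstruction_closed[OF f PP]) (use Xf in \<open>simp_all add: X_def\<close>)
        then show ?thesis by (simp only: add.assoc one_plus_numeral numeral_plus_one add_num_simps)
      qed
      have base: "proj_S n (xi_coeff \<nu> X) \<in> I" if "r = 1" "xi_only \<nu>" for \<nu>
      proof -
        have "f 1 = pi1 n br" using below[of 1] mr by (simp add: ok_def)
        then have "P m f = pi0 J d 1 + pi1 n br" using that(1) by (simp add: PP)
        then show ?thesis using obstruction_base[OF _ that(2)] that(1) by (simp add: X_def)
      qed
      obtain \<tau> where \<tau>: "\<tau> \<in> h_le J r" "\<tau> \<in> wspan cdeg_var {2}" "\<tau> \<in> fge (int r + 2)" "X + 2 * der gd \<tau> \<in> fge (int r + 3)"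
        using obstruction_exact[OF mr(2) Xh Xc Xf cl base] by blast
      have Sx: "(\<Sum>i=1..r. f i) \<in> wspan xdeg {p + 2}" using fx by (intro wspan_sum) auto
      \<comment> \<open>The bracket lowers the x-degree sum by one: \<open>pi0\<close> of degree 2
        against degree p + 2 gives p + 3, and two elements of degree p + 2 give 2 p + 3.\<close>
      have Xx: "X \<in> wspan xdeg {p + 3, 2 * p + 3}"
      proof -
        let ?S = "\<Sum>i=1..r. f i" and ?A = "pi0 J d r"
        have "X = schouten J r ?A ?S + schouten J r ?S ?A + schouten J r ?S ?S"
          by (simp add: X_def PP schouten_add_left schouten_add_right schouten_pi0_pi0)
        moreover have "schouten J r ?A ?S \<in> wspan xdeg {p + 3, 2 * p + 3}"
          by (rule schouten_wspan[OF pi0_even pi0_xdeg Sx]) auto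
        moreover have "schouten J r ?S ?A \<in> wspan xdeg {p + 3, 2 * p + 3}"
          by (rule schouten_wspan[OF cdeg2_even[OF Sc] Sx pi0_xdeg]) auto
        moreover have "schouten J r ?S ?S \<in> wspan xdeg {p + 3, 2 * p + 3}"
          by (rule schouten_wspan[OF cdeg2_even[OF Sc] Sx Sx]) auto
        ultimately show ?thesis by (simp only: wspan_add)
      qed
      \<comment> \<open>Taking a component does not disturb level, cohomological degree or
        filtration; that the congruence survives is \<open>x_degree_part\<close>.\<close>
      define t where "t = gproj (\<lambda>u. mon_weight xdeg u = p + 2) \<tau>"
      have th: "t \<in> h_le J r" using \<tau>(1) unfolding t_def h_le_eq by (rule gproj_subalg)
      have "t \<in> wspan cdeg_var {2}" using \<tau>(2) unfolding t_def wspan_def by (rule gproj_kspan')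
      moreover have "t \<in> fge (int m + 1)" using gproj_fge[OF \<tau>(3)] by (simp add: t_def mr(1) add.commute)
      moreover have "t \<in> wspan xdeg {p + 2}" unfolding t_def by (rule gproj_wspan)
      moreover have "X + 2 * d_ext J d r t \<in> fge (int m + 2)"
      proof -
        have "X + 2 * der gd t \<in> fge (int r + 3)" unfolding t_def by (rule x_degree_part[OF p Xx \<tau>(4)])
        then show ?thesis by (simp add: d_ext_der[OF th] mr(1) add.commute)
      qed
      ultimately have "ok m (f(m := t))" using th 3 by (simp add: ok_def P_upd X_def r_def)
      then show ?thesis ..
    qed
  next
    fix m and f g :: "nat \<Rightarrow> 'a galg" assume eq: "\<And>l. l \<le> m \<Longrightarrow> f l = g l" and f: "ok m f"
    have "P m f = P m g" by (rule P_cong) (simp add: eq)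
    then show "ok m g" using f eq[of m] by (cases "m = 1") (auto simp: ok_def)
  qed
  then obtain \<pi> where \<pi>: "\<And>m. ok m \<pi>" by blast
  have "is_pi_sequence n br J d \<pi>"
    unfolding is_pi_sequence_def Let_def
  proof (intro conjI allI impI)
    show "\<pi> 1 = pi1 n br" using \<pi>[of 1] by (simp add: ok_def)
    fix m :: nat assume m: "m \<ge> 2"
    have okm: "\<pi> m \<in> h_le J (m - 1)" "\<pi> m \<in> fge (int m + 1)" "\<pi> m \<in> wspan cdeg_var {2}"
      "schouten J (m - 1) (P m \<pi>) (P m \<pi>) + 2 * d_ext J d (m - 1) (\<pi> m) \<in> fge (int m + 2)"
      using \<pi>[of m] m by (auto simp: ok_def)
    show "\<pi> m \<in> filt J (m + 1) (m - 1)" using okm(1,2) by (simp add: filt_iff add.commute)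
    show "homogeneous cdeg_var 2 (\<pi> m)" using okm(3) by (simp add: homogeneous_wspan)
    have h: "\<pi> i \<in> h_le J (m - 1)" if "i \<in> {1..m - 1}" for i
      using \<pi>[of i] that Tlv_mono[of i "Suc (m - 1)"] by (auto simp: ok_def h_le_eq intro: subalg_mono)
    have Ph: "P m \<pi> \<in> h_le J (m - 1)"
      unfolding P_def using pi0_h_le[of "m - 1"] h unfolding h_le_eq by (intro subalg_add subalg_sum) auto
    have "d_ext J d (m - 1) (\<pi> m) \<in> h_le J (m - 1)" using okm(1) by (simp add: d_ext_der der_gd_h_le)
    then have "schouten J (m - 1) (P m \<pi>) (P m \<pi>) + 2 * d_ext J d (m - 1) (\<pi> m) \<in> h_le J (m - 1)"
      using schouten_h_le[OF Ph Ph] unfolding h_le_eq mult_2 by (intro subalg_add)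
    then show "schouten J (m - 1) (pi0 J d (m - 1) + sum \<pi> {1..m - 1}) (pi0 J d (m - 1) + sum \<pi> {1..m - 1})
        - - 2 * d_ext J d (m - 1) (\<pi> m) \<in> filt J (m + 2) (m - 1)"
      using okm(4) by (simp add: filt_iff P_def add.commute)
  qed
  moreover have "\<forall>m\<ge>1. \<pi> m \<in> wspan xdeg {p + 2}"
  proof (intro allI impI)
    fix m :: nat assume "m \<ge> 1"
    then show "\<pi> m \<in> wspan xdeg {p + 2}" using \<pi>[of m] by (simp add: ok_def)
  qed
  ultimately show ?thesis by (intro exI[of _ \<pi>] conjI)
qed

end

theorem theorem6p6:
  fixes n :: nat and p :: int
    and br :: "'k::field_char_0 galg \<Rightarrow> 'k galg \<Rightarrow> 'k galg"
    and I :: "'k galg set"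
    and J :: "nat \<Rightarrow> nat set" and wt :: "nat \<Rightarrow> nat \<Rightarrow> int" and d :: "'k galg \<Rightarrow> 'k galg"
  assumes "is_poisson_bracket n br"
    and "bracket_has_degree n br p" and "p \<le> 0"
    and "is_poisson_ideal n br I"
    and "generated_by_quadrics n I"
    and "is_koszul_quotient n I"
    and "is_minimal_model n J wt d I"
  shows "\<exists>\<pi>. is_pi_sequence n br J d \<pi> \<and> (\<forall>m\<ge>1. x_homogeneous (p + 2) (\<pi> m))"
proof -
  interpret minimal_model n J wt d I
    using assms by unfold_locales (auto simp: is_poisson_ideal_def)
  obtain b :: "nat \<Rightarrow> nat" and M :: "nat \<Rightarrow> nat \<Rightarrow> nat \<Rightarrow> 'k galg" where bM: "b 0 = 1"
    "\<forall>t. \<forall>i<b t. \<forall>j<b (Suc t). M t i j \<in> S_deg n 1"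
    "\<forall>a\<in>S_alg n. gcoeff a 0 = 0 \<longleftrightarrow> (\<exists>c. (\<forall>j<b 1. c j \<in> S_alg n) \<and> a - (\<Sum>j<b 1. M 0 0 j * c j) \<in> I)"
    "\<forall>t c. (\<forall>j<b (Suc t). c j \<in> S_alg n) \<longrightarrow>
           ((\<forall>i<b t. (\<Sum>j<b (Suc t). M t i j * c j) \<in> I) \<longleftrightarrow>
            (\<exists>e. (\<forall>l<b (Suc (Suc t)). e l \<in> S_alg n) \<and>
                 (\<forall>j<b (Suc t). c j - (\<Sum>l<b (Suc (Suc t)). M (Suc t) j l * e l) \<in> I)))"
    using assms(6) unfolding is_koszul_quotient_def by (elim exE conjE) (rule that; assumption)
  interpret koszul_minimal_model n J wt d I b M
  proof unfold_locales
    show "b 0 = 1" by (rule bM(1))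
    show "\<And>t i j. i < b t \<Longrightarrow> j < b (Suc t) \<Longrightarrow> M t i j \<in> S_deg n 1" using bM(2) by simp
    show "\<And>a. a \<in> S_alg n \<Longrightarrow> gcoeff a 0 = 0 \<longleftrightarrow>
        (\<exists>c. (\<forall>j<b 1. c j \<in> S_alg n) \<and> a - (\<Sum>j<b 1. M 0 0 j * c j) \<in> I)" by (rule bspec[OF bM(3)])
    show "\<And>t c. (\<forall>j<b (Suc t). c j \<in> S_alg n) \<Longrightarrow>
           (\<forall>i<b t. (\<Sum>j<b (Suc t). M t i j * c j) \<in> I) \<longleftrightarrow>
            (\<exists>e. (\<forall>l<b (Suc (Suc t)). e l \<in> S_alg n) \<and>
                 (\<forall>j<b (Suc t). c j - (\<Sum>l<b (Suc (Suc t)). M (Suc t) j l * e l) \<in> I))"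
      by (rule bM(4)[THEN spec, THEN spec, THEN mp])
  qed
  obtain \<pi> where \<pi>: "is_pi_sequence n br J d \<pi>" "\<forall>m\<ge>1. \<pi> m \<in> wspan xdeg {p + 2}"
    using pi_sequence_ex[OF assms(1,4,2,3)] by blast
  have "xdeg = (\<lambda>v. case v of Xvar m i \<Rightarrow> 1 | Xivar m i \<Rightarrow> 0)" by (simp add: fun_eq_iff xdeg_def)
  then have "x_homogeneous (p + 2) (\<pi> m)" if "m \<ge> 1" for m
    using x_homogeneousI[of "\<pi> m" "p + 2"] \<pi>(2) that by simp
  then show ?thesis using \<pi>(1) by blast
qed

end
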